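(* Let $N$ be a group of order $4!$. Then $$\#\mathcal{E}(S_4,N) = \begin{cases} 8 & \text{for } N\simeq S_4,\\ 36 & \text{for } N\simeq A_4\times C_2,\\ 24 & \text{for } N\simeq S_3\times C_2\times C_2,\\ 48 & \text{for } N\simeq C_6\times C_2\times C_2,\\ 0 & \text{otherwise.}\end{cases}$$ In particular, $\#\mathcal{E}(S_4) = 116$.
   Context: For $n\in\mathbb{N}$, $S_n$ is the symmetric group on $n$ letters, $A_n$ is the alternating group on $n$ letters, and $C_n$ is the cyclic group of order $n$. For a finite group $G$, $\mathrm{Perm}(G)$ is the group of all permutations of the set $G$. A subgroup $\mathcal{N}$ of $\mathrm{Perm}(G)$ is called regular if the map $\mathcal{N}\to G$, $\eta\mapsto\eta(1)$, is bijective (equivalently, the action of $\mathcal{N}$ on $G$ is transitive and free). Let $\lambda:G\to\mathrm{Perm}(G)$, $\lambda(\sigma)=(x\mapsto\sigma x)$, be the left regular representation. Define $\mathcal{E}(G)$ to be the set of all regular subgroups of $\mathrm{Perm}(G)$ which are normalized by $\lambda(G)$. For a group $N$ of order $|G|$, define $\mathcal{E}(G,N)$ to be the set of those elements of $\mathcal{E}(G)$ which are isomorphic to $N$ as groups. (By Greither and Pareigis, $\mathcal{E}(G)$ is in bijection with the Hopf-Galois structures on a finite Galois extension with Galois group $G$.) *)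

theory Defs
  imports
    "HOL-Algebra.Bij"
    "HOL-Algebra.Elementary_Groups"
    "HOL-Algebra.Sym_Groups"
    "HOL-Algebra.Zassenhaus"
begin

text \<open>
  The library group \<^term>\<open>BijGroup S\<close> plays the role of $\mathrm{Perm}(S)$. Its elements are
  the bijections of \<open>S\<close> that are extensional (\<^term>\<open>undefined\<close> outside \<open>S\<close>), so
  that each permutation of \<open>S\<close> has exactly one representative and subgroups are counted correctly.
\<close>

abbreviation Perm :: "('a, 'm) monoid_scheme \<Rightarrow> ('a \<Rightarrow> 'a) monoid"
  where "Perm G \<equiv> BijGroup (carrier G)"

definition regular_subgroup :: "('a \<Rightarrow> 'a) set \<Rightarrow> ('a, 'm) monoid_scheme \<Rightarrow> bool"
  where "regular_subgroup R G \<longleftrightarrow>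
    subgroup R (Perm G) \<and> bij_betw (\<lambda>\<eta>. \<eta> \<one>\<^bsub>G\<^esub>) R (carrier G)"

definition left_regular :: "('a, 'm) monoid_scheme \<Rightarrow> 'a \<Rightarrow> 'a \<Rightarrow> 'a"
  where "left_regular G \<sigma> = (\<lambda>x\<in>carrier G. \<sigma> \<otimes>\<^bsub>G\<^esub> x)"

definition normalized_regular_subgroups :: "('a, 'm) monoid_scheme \<Rightarrow> ('a \<Rightarrow> 'a) set set"
  where "normalized_regular_subgroups G =
    {R. regular_subgroup R G \<and> left_regular G ` carrier G \<subseteq> normalizer (Perm G) R}"

definition normalized_regular_subgroups_of_type ::
    "('a, 'm) monoid_scheme \<Rightarrow> ('b, 'n) monoid_scheme \<Rightarrow> ('a \<Rightarrow> 'a) set set"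
  where "normalized_regular_subgroups_of_type G N =
    {R \<in> normalized_regular_subgroups G. (Perm G)\<lparr>carrier := R\<rparr> \<cong> N}"

end

theory Submission
  imports Defs
begin

text \<open>
  Let \<open>R\<close> be a regular subgroup of the permutations of a group \<open>G\<close>, and let \<open>e s\<close> be its unique element
  with \<open>e s 1 = s\<close>. Left translation by \<open>s\<close> and \<open>e s\<close> agree at \<open>1\<close>, so
  \<open>t s = (e s)\<^sup>-\<^sup>1 \<circ> left_regular G s\<close> fixes \<open>1\<close>. If the left translations normalize \<open>R\<close>, then
  \<open>t\<close> is an action of \<open>G\<close> on its own underlying set, and
  \[ t_s (x y) = t_s(x) \cdot t_{s'}(y) \quad\hbox{where } s x = t_s(x) s'. \]
  Conversely, an action with this property, here called braided, gives back \<open>R\<close> as the set of the maps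
  \<open>x \<mapsto> s * t s\<^sup>-\<^sup>1 x\<close>, and \<open>R\<close> is isomorphic to the set \<open>G\<close> with the multiplication \<open>(s, x) \<mapsto> s * t s\<^sup>-\<^sup>1 x\<close>
  (lemmas \<open>star_translations_normalized_regular\<close>, \<open>normalized_regular_is_star_translations\<close> and
  \<open>star_group_iso\<close>). In other words, the task is to find all skew braces whose multiplicative group is
  the symmetric group of degree four, and the types of their additive groups.

  A value \<open>t s x = y\<close> together with \<open>s x = y u\<close> is drawn as a square with vertical sides \<open>s\<close>, \<open>u\<close> and
  horizontal sides \<open>x\<close>, \<open>y\<close>. That \<open>t\<close> is an action means that squares may be pasted along horizontal
  sides, the braiding law means that they may be pasted along vertical sides, and both kinds of
  pasting imply that squares may be reflected. Hence a few values of \<open>t\<close> force many others. This makes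
  a complete case analysis short: some nontrivial element is fixed by \<open>t\<close> of a three-cycle, because
  three does not divide 23; after that, branch on the value of a well-chosen \<open>t s x\<close> and paste squares
  until two of them contradict each other, or all values at two generators of the group are known, or
  the case is, up to conjugation in the symmetric group, one that has been dealt with before. The
  decisions and the pastings were found by a computer search and are recorded in certificates. The rewriting
  engine recomputes every pasting, and \<open>check_sound\<close> draws the conclusion. The result is that there are
  exactly fifteen braided actions up to conjugation (\<open>braided_iff_known\<close>).

  For each of the fifteen actions a table gives an isomorphism from its multiplication to a fixed model
  of one of the four types. The types are told apart by the numbers of solutions of \<open>x\<^sup>2 = 1\<close> and of
  \<open>x\<^sup>3 = 1\<close>. Listing the 24 conjugates of each action and removing repetitions gives the numbers
  8, 36, 24 and 48.
\<close>

section \<open>Normalized regular subgroups as braided actions\<close>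

text \<open>
  The last law says that the factorization \<open>s x = y u\<close> with \<open>y = t s x\<close> is compatible with multiplication:
  moving \<open>s\<close> past \<open>x y\<close> is the same as moving it past \<open>x\<close>, which turns it into \<open>u\<close>, and then moving \<open>u\<close>
  past \<open>y\<close>.
\<close>

definition braided :: "('a, 'm) monoid_scheme \<Rightarrow> ('a \<Rightarrow> 'a \<Rightarrow> 'a) \<Rightarrow> bool"
  where "braided G t \<longleftrightarrow>
    (\<forall>s\<in>carrier G. \<forall>x\<in>carrier G. t s x \<in> carrier G) \<and>
    (\<forall>x\<in>carrier G. t \<one>\<^bsub>G\<^esub> x = x) \<and>
    (\<forall>s\<in>carrier G. t s \<one>\<^bsub>G\<^esub> = \<one>\<^bsub>G\<^esub>) \<and>
    (\<forall>r\<in>carrier G. \<forall>s\<in>carrier G. \<forall>x\<in>carrier G. t (r \<otimes>\<^bsub>G\<^esub> s) x = t r (t s x)) \<and>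
    (\<forall>s\<in>carrier G. \<forall>x\<in>carrier G. \<forall>y\<in>carrier G.
      t s (x \<otimes>\<^bsub>G\<^esub> y) = t s x \<otimes>\<^bsub>G\<^esub> t (inv\<^bsub>G\<^esub> (t s x) \<otimes>\<^bsub>G\<^esub> s \<otimes>\<^bsub>G\<^esub> x) y)"

text \<open>
  The operation of the additive group of the skew brace whose multiplicative group is \<open>G\<close>. The element of
  the regular subgroup that maps \<open>\<one>\<close> to \<open>s\<close> is left translation by \<open>s\<close> for this operation.
\<close>

definition star_mult :: "('a, 'm) monoid_scheme \<Rightarrow> ('a \<Rightarrow> 'a \<Rightarrow> 'a) \<Rightarrow> 'a \<Rightarrow> 'a \<Rightarrow> 'a"
  where "star_mult G t s x = s \<otimes>\<^bsub>G\<^esub> t (inv\<^bsub>G\<^esub> s) x"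

definition star_group :: "('a, 'm) monoid_scheme \<Rightarrow> ('a \<Rightarrow> 'a \<Rightarrow> 'a) \<Rightarrow> 'a monoid"
  where "star_group G t = \<lparr>carrier = carrier G, monoid.mult = star_mult G t, one = \<one>\<^bsub>G\<^esub>\<rparr>"

definition star_translation :: "('a, 'm) monoid_scheme \<Rightarrow> ('a \<Rightarrow> 'a \<Rightarrow> 'a) \<Rightarrow> 'a \<Rightarrow> 'a \<Rightarrow> 'a"
  where "star_translation G t s = (\<lambda>x\<in>carrier G. star_mult G t s x)"

definition star_translations :: "('a, 'm) monoid_scheme \<Rightarrow> ('a \<Rightarrow> 'a \<Rightarrow> 'a) \<Rightarrow> ('a \<Rightarrow> 'a) set"
  where "star_translations G t = star_translation G t ` carrier G"

context group begin

lemma Perm_mult: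
  assumes "f \<in> Bij (carrier G)" "g \<in> Bij (carrier G)"
  shows "f \<otimes>\<^bsub>Perm G\<^esub> g = (\<lambda>x\<in>carrier G. f (g x))"
  using assms by (simp add: BijGroup_def compose_def)

lemma left_regular_Bij:
  assumes s: "s \<in> carrier G"
  shows "left_regular G s \<in> Bij (carrier G)"
proof -
  have "bij_betw (left_regular G s) (carrier G) (carrier G)"
    by (rule bij_betw_byWitness[where f' = "left_regular G (inv s)"])
       (use s in \<open>auto simp: left_regular_def m_assoc [symmetric]\<close>)
  then show ?thesis
    by (simp add: Bij_def left_regular_def)
qed

lemma left_regular_conj:
  assumes s: "s \<in> carrier G" and r: "r \<in> Bij (carrier G)"
  shows "left_regular G s \<otimes>\<^bsub>Perm G\<^esub> r \<otimes>\<^bsub>Perm G\<^esub> inv\<^bsub>Perm G\<^esub> left_regular G s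
    = (\<lambda>x\<in>carrier G. s \<otimes> r (inv s \<otimes> x))"
proof -
  interpret P: group "Perm G" by (rule group_BijGroup)
  have L: "left_regular G u \<in> carrier (Perm G)" if "u \<in> carrier G" for u
    using left_regular_Bij[OF that] by (simp add: BijGroup_def)
  have "left_regular G (inv s) \<otimes>\<^bsub>Perm G\<^esub> left_regular G s = \<one>\<^bsub>Perm G\<^esub>"
    using s by (subst Perm_mult) (simp_all add: left_regular_Bij,
      auto simp: BijGroup_def left_regular_def m_assoc [symmetric])
  then have inv: "inv\<^bsub>Perm G\<^esub> left_regular G s = left_regular G (inv s)"
    using P.inv_equality L s by simp
  have r': "r x \<in> carrier G" if "x \<in> carrier G" for x
    using r that by (auto dest: Bij_imp_funcset)
  have "left_regular G s \<otimes>\<^bsub>Perm G\<^esub> r = (\<lambda>x\<in>carrier G. s \<otimes> r x)"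
    unfolding Perm_mult[OF left_regular_Bij[OF s] r]
    using r' by (intro restrict_ext) (simp add: left_regular_def)
  moreover have "left_regular G s \<otimes>\<^bsub>Perm G\<^esub> r \<in> Bij (carrier G)"
    using P.m_closed[of "left_regular G s" r] L s r by (simp add: BijGroup_def)
  ultimately show ?thesis
    using s by (simp add: inv Perm_mult left_regular_Bij)
      (intro restrict_ext, simp add: left_regular_def)
qed

lemma left_regular_normalizes_iff:
  assumes R: "R \<subseteq> Bij (carrier G)"
  shows "left_regular G ` carrier G \<subseteq> normalizer (Perm G) R \<longleftrightarrow>
    (\<forall>s\<in>carrier G. \<forall>r\<in>R. (\<lambda>x\<in>carrier G. s \<otimes> r (inv s \<otimes> x)) \<in> R)"
proof -
  have sub: "R \<subseteq> carrier (Perm G)" using R by (simp add: BijGroup_def)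
  define c where "c s r = (\<lambda>x\<in>carrier G. s \<otimes> r (inv s \<otimes> x))" for s and r :: "'a \<Rightarrow> 'a"
  have *: "left_regular G s \<in> normalizer (Perm G) R \<longleftrightarrow> c s ` R = R"
    if s: "s \<in> carrier G" for s
  proof -
    have "left_regular G s <#\<^bsub>Perm G\<^esub> R #>\<^bsub>Perm G\<^esub> (inv\<^bsub>Perm G\<^esub> left_regular G s) = c s ` R"
      unfolding l_coset_def r_coset_def c_def using left_regular_conj[OF s] R by fastforce
    moreover have "left_regular G s \<in> carrier (Perm G)"
      using left_regular_Bij[OF s] by (simp add: BijGroup_def)
    ultimately show ?thesis
      unfolding normalizer_def stabilizer_def using sub by simp
  qed
  have inv_c: "c s (c (inv s) r) = r" if s: "s \<in> carrier G" and r: "r \<in> R" for s r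
  proof -
    have "r \<in> Bij (carrier G)" using r R by auto
    then have "r \<in> extensional (carrier G)" "\<And>x. x \<in> carrier G \<Longrightarrow> r x \<in> carrier G"
      by (auto dest: Bij_imp_funcset Bij_imp_extensional)
    then show ?thesis
      using s by (intro extensionalityI[of _ "carrier G"])
        (auto simp: c_def m_assoc [symmetric])
  qed
  have "c s ` R = R" if "\<forall>s\<in>carrier G. \<forall>r\<in>R. c s r \<in> R" "s \<in> carrier G" for s
  proof
    show "c s ` R \<subseteq> R" using that by auto
    show "R \<subseteq> c s ` R"
    proof
      fix r assume "r \<in> R"
      then show "r \<in> c s ` R"
        using inv_c[of s r] that by (metis image_eqI inv_closed)
    qed
  qed
  then have "(\<forall>s\<in>carrier G. c s ` R = R) \<longleftrightarrow> (\<forall>s\<in>carrier G. \<forall>r\<in>R. c s r \<in> R)"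
    by blast
  then show ?thesis using * by (auto simp: c_def)
qed

context
  fixes t
  assumes br: "braided G t"
begin

lemma act_closed [simp]: "s \<in> carrier G \<Longrightarrow> x \<in> carrier G \<Longrightarrow> t s x \<in> carrier G"
  and act_one [simp]: "x \<in> carrier G \<Longrightarrow> t \<one> x = x"
  and act_fix [simp]: "s \<in> carrier G \<Longrightarrow> t s \<one> = \<one>"
  and act_mult: "r \<in> carrier G \<Longrightarrow> s \<in> carrier G \<Longrightarrow> x \<in> carrier G \<Longrightarrow> t (r \<otimes> s) x = t r (t s x)"
  and act_braid: "s \<in> carrier G \<Longrightarrow> x \<in> carrier G \<Longrightarrow> y \<in> carrier G \<Longrightarrow>
    t s (x \<otimes> y) = t s x \<otimes> t (inv (t s x) \<otimes> s \<otimes> x) y"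
  using br by (simp_all add: braided_def)

lemma star_closed [simp]:
  "s \<in> carrier G \<Longrightarrow> x \<in> carrier G \<Longrightarrow> star_mult G t s x \<in> carrier G"
  by (simp add: star_mult_def)

text \<open>
  With \<open>y = t (inv s) u\<close>, the braiding law splits \<open>t (inv s) (u \<otimes> z)\<close> into \<open>y\<close> and a value of
  \<open>t (inv y \<otimes> inv s \<otimes> u)\<close>; the factor \<open>u\<close> cancels against \<open>t (inv u)\<close>, and what remains is
  \<open>t (inv (s \<otimes> y))\<close>, where \<open>s \<otimes> y\<close> is the product of \<open>s\<close> and \<open>u\<close>.
\<close>

lemma star_assoc:
  assumes [simp]: "s \<in> carrier G" "u \<in> carrier G" "x \<in> carrier G"
  shows "star_mult G t (star_mult G t s u) x = star_mult G t s (star_mult G t u x)"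
proof -
  define y where "y = t (inv s) u"
  have [simp]: "y \<in> carrier G" by (simp add: y_def)
  have "star_mult G t s (star_mult G t u x) = s \<otimes> (y \<otimes> t (inv y \<otimes> inv s \<otimes> u) (t (inv u) x))"
    by (simp add: star_mult_def act_braid y_def)
  also have "t (inv y \<otimes> inv s \<otimes> u) (t (inv u) x) = t (inv (s \<otimes> y)) x"
    by (simp add: act_mult [symmetric] m_assoc inv_mult_group)
  finally show ?thesis
    by (simp add: star_mult_def y_def m_assoc)
qed

text \<open>
  Every \<open>s\<close> has the right inverse \<open>t s (inv s)\<close>. In a monoid in which every element has a right inverse,
  right inverses are also left inverses.
\<close>

lemma group_star_group: "group (star_group G t)"
proof (rule groupI)
  fix s assume "s \<in> carrier (star_group G t)"
  then have [simp]: "s \<in> carrier G" by (simp add: star_group_def)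
  define u where "u = t s (inv s)"
  have [simp]: "u \<in> carrier G" by (simp add: u_def)
  have r: "star_mult G t x (t x (inv x)) = \<one>" if "x \<in> carrier G" for x
    using that by (simp add: star_mult_def act_mult [symmetric])
  have "star_mult G t u s = star_mult G t (star_mult G t u s) \<one>"
    by (simp add: star_mult_def)
  also have "\<dots> = star_mult G t (star_mult G t u s) (star_mult G t u (t u (inv u)))"
    using r[of u] by simp
  also have "\<dots> = star_mult G t u (star_mult G t (star_mult G t s u) (t u (inv u)))"
    by (simp add: star_assoc)
  also have "\<dots> = \<one>"
    using r[of s] r[of u] by (simp add: u_def[symmetric]) (simp add: star_mult_def)
  finally show "\<exists>y\<in>carrier (star_group G t). y \<otimes>\<^bsub>star_group G t\<^esub> s = \<one>\<^bsub>star_group G t\<^esub>"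
    using \<open>u \<in> carrier G\<close> by (auto simp: star_group_def)
qed (auto simp: star_group_def star_assoc, simp add: star_mult_def)

lemma star_translation_Bij:
  assumes s: "s \<in> carrier G"
  shows "star_translation G t s \<in> Bij (carrier G)"
proof -
  interpret S: group "star_group G t" by (rule group_star_group)
  have "s \<in> carrier (star_group G t)" using s by (simp add: star_group_def)
  then have "bij_betw (\<lambda>x. s \<otimes>\<^bsub>star_group G t\<^esub> x) (carrier (star_group G t)) (carrier (star_group G t))"
    by (intro bij_betw_byWitness[where f' = "\<lambda>x. inv\<^bsub>star_group G t\<^esub> s \<otimes>\<^bsub>star_group G t\<^esub> x"])
       (auto simp: S.m_assoc [symmetric])
  then have "bij_betw (star_translation G t s) (carrier G) (carrier G)"
    by (subst bij_betw_cong[where g = "\<lambda>x. s \<otimes>\<^bsub>star_group G t\<^esub> x"])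
       (auto simp: star_group_def star_translation_def)
  then show ?thesis
    by (simp add: Bij_def star_translation_def)
qed

lemma star_translation_hom:
  assumes "s \<in> carrier G" "u \<in> carrier G"
  shows "star_translation G t (star_mult G t s u) = star_translation G t s \<otimes>\<^bsub>Perm G\<^esub> star_translation G t u"
  using assms by (subst Perm_mult) (simp_all add: star_translation_Bij,
    auto simp: star_translation_def star_assoc)

lemma star_translation_at_one [simp]: "s \<in> carrier G \<Longrightarrow> star_translation G t s \<one> = s"
  by (simp add: star_translation_def star_mult_def)

lemma star_translation_group_hom: "group_hom (star_group G t) (Perm G) (star_translation G t)"
  unfolding group_hom_def group_hom_axioms_def hom_def
  using group_star_group group_BijGroup star_translation_Bij star_translation_hom
  by (auto simp: star_group_def) (auto simp: BijGroup_def)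

lemma inj_star_translation: "inj_on (star_translation G t) (carrier G)"
  by (rule inj_onI) (metis star_translation_at_one)

lemma star_group_iso: "(Perm G)\<lparr>carrier := star_translations G t\<rparr> \<cong> star_group G t"
proof -
  have "star_translation G t \<in> iso (star_group G t) ((Perm G)\<lparr>carrier := star_translations G t\<rparr>)"
    using inj_star_translation star_translation_hom
    by (auto simp: iso_def hom_def bij_betw_def star_group_def star_translations_def)
  then have "star_group G t \<cong> (Perm G)\<lparr>carrier := star_translations G t\<rparr>"
    by (rule is_isoI)
  then show ?thesis
    by (rule group.iso_sym[OF group_star_group])
qed

text \<open>
  Conjugating the star translation by \<open>u\<close> with the left translation by \<open>s\<close> gives, again by the braiding
  law, the star translation by \<open>s \<otimes> u \<otimes> t (inv u) (inv s)\<close>.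
\<close>

lemma star_translations_normalized_regular: "star_translations G t \<in> normalized_regular_subgroups G"
proof -
  interpret h: group_hom "star_group G t" "Perm G" "star_translation G t"
    by (rule star_translation_group_hom)
  have sub: "subgroup (star_translations G t) (Perm G)"
    using h.img_is_subgroup by (simp add: star_translations_def star_group_def)
  have bij: "bij_betw (\<lambda>r. r \<one>) (star_translations G t) (carrier G)"
    unfolding star_translations_def
    by (rule bij_betw_byWitness[where f' = "star_translation G t"]) auto
  have "(\<lambda>x\<in>carrier G. s \<otimes> star_translation G t u (inv s \<otimes> x)) \<in> star_translations G t"
    if [simp]: "s \<in> carrier G" "u \<in> carrier G" for s u
  proof -
    define y where "y = t (inv u) (inv s)"
    have [simp]: "y \<in> carrier G" by (simp add: y_def)
    have "s \<otimes> star_translation G t u (inv s \<otimes> x) = star_translation G t (s \<otimes> u \<otimes> y) x"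
      if [simp]: "x \<in> carrier G" for x
    proof -
      have "star_translation G t u (inv s \<otimes> x) = u \<otimes> (y \<otimes> t (inv y \<otimes> inv u \<otimes> inv s) x)"
        by (simp add: star_translation_def star_mult_def act_braid y_def)
      also have "inv y \<otimes> inv u \<otimes> inv s = inv (s \<otimes> u \<otimes> y)"
        by (simp add: inv_mult_group m_assoc)
      finally show ?thesis
        by (simp add: star_translation_def star_mult_def m_assoc)
    qed
    then have "(\<lambda>x\<in>carrier G. s \<otimes> star_translation G t u (inv s \<otimes> x)) = star_translation G t (s \<otimes> u \<otimes> y)"
      by (intro extensionalityI[of _ "carrier G"]) (auto simp: star_translation_def)
    then show ?thesis by (auto simp: star_translations_def)
  qed
  moreover have "star_translations G t \<subseteq> Bij (carrier G)"
    using star_translation_Bij by (auto simp: star_translations_def)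
  ultimately have "left_regular G ` carrier G \<subseteq> normalizer (Perm G) (star_translations G t)"
    by (subst left_regular_normalizes_iff) (auto simp: star_translations_def)
  with sub bij show ?thesis
    by (simp add: normalized_regular_subgroups_def regular_subgroup_def)
qed

end

lemma star_translations_cong:
  assumes "\<And>s x. s \<in> carrier G \<Longrightarrow> x \<in> carrier G \<Longrightarrow> t s x = t' s x"
  shows "star_translations G t = star_translations G t'"
proof -
  have "star_translation G t s = star_translation G t' s" if "s \<in> carrier G" for s
    using that assms by (auto simp: star_translation_def star_mult_def fun_eq_iff)
  then show ?thesis
    by (auto simp: star_translations_def)
qed

lemma star_translations_inj:
  assumes t: "braided G t" and t': "braided G t'"
    and eq: "star_translations G t = star_translations G t'"
    and s: "s \<in> carrier G" and x: "x \<in> carrier G"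
  shows "t s x = t' s x"
proof -
  have "star_translation G t (inv s) \<in> star_translations G t'"
    using eq s by (auto simp: star_translations_def)
  then obtain u where u: "u \<in> carrier G" "star_translation G t (inv s) = star_translation G t' u"
    by (auto simp: star_translations_def)
  then have "u = inv s"
    using star_translation_at_one[OF t, of "inv s"] star_translation_at_one[OF t', of u] s by simp
  with u have "star_translation G t (inv s) x = star_translation G t' (inv s) x" by simp
  then have "inv s \<otimes> t s x = inv s \<otimes> t' s x"
    using s x by (simp add: star_translation_def star_mult_def)
  then show ?thesis
    using s x act_closed[OF t] act_closed[OF t'] by simp
qed

text \<open>
  The action is \<open>t s = (e s)\<^sup>-\<^sup>1 \<circ> left_regular G s\<close>, where \<open>e s\<close> is the element of \<open>R\<close> that maps \<open>\<one>\<close> to \<open>s\<close>.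
  As \<open>R\<close> is normalized, composites of such maps and of left translations can be written as an element of \<open>R\<close>
  after a left translation. The laws of a braided action compare two such expressions with the same left
  translation. They hold because regular subgroups act freely: two elements of \<open>R\<close> that agree at one
  point are equal, and at \<open>\<one>\<close> both sides are known.
\<close>

lemma normalized_regular_is_star_translations:
  assumes "R \<in> normalized_regular_subgroups G"
  shows "\<exists>t. braided G t \<and> R = star_translations G t"
proof -
  interpret P: group "Perm G" by (rule group_BijGroup)
  have sub: "subgroup R (Perm G)" and bij: "bij_betw (\<lambda>r. r \<one>) R (carrier G)"
    and norm: "left_regular G ` carrier G \<subseteq> normalizer (Perm G) R"
    using assms by (auto simp: normalized_regular_subgroups_def regular_subgroup_def)
  interpret R: subgroup R "Perm G" by (rule sub)
  have RBij: "R \<subseteq> Bij (carrier G)" using R.subset by (simp add: BijGroup_def)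
  have cl: "r x \<in> carrier G" if "r \<in> R" "x \<in> carrier G" for r x
    using RBij that Bij_imp_funcset by fastforce
  have conj: "\<exists>q\<in>R. \<forall>x\<in>carrier G. q x = s \<otimes> r (inv s \<otimes> x)"
    if "s \<in> carrier G" "r \<in> R" for s r
    using norm[unfolded left_regular_normalizes_iff[OF RBij]] that
    by (intro bexI[of _ "\<lambda>x\<in>carrier G. s \<otimes> r (inv s \<otimes> x)"]) auto
  have comp: "\<exists>q\<in>R. \<forall>x\<in>carrier G. q x = r (r' x)" if "r \<in> R" "r' \<in> R" for r r'
  proof -
    have "r \<otimes>\<^bsub>Perm G\<^esub> r' = (\<lambda>x\<in>carrier G. r (r' x))"
      using that RBij by (intro Perm_mult) auto
    then show ?thesis
      using R.m_closed[OF that] by (intro bexI[of _ "r \<otimes>\<^bsub>Perm G\<^esub> r'"]) auto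
  qed
  have eq1: "r = r'" if "r \<in> R" "r' \<in> R" "r \<one> = r' \<one>" for r r'
    using bij that by (auto simp: bij_betw_def inj_on_def)
  define e where "e = inv_into R (\<lambda>r. r \<one>)"
  have eR [simp]: "e s \<in> R" if "s \<in> carrier G" for s
    using bij that by (auto simp: e_def bij_betw_def inv_into_into)
  have e1 [simp]: "e s \<one> = s" if "s \<in> carrier G" for s
    using bij_betw_inv_into_right[OF bij that] by (simp add: e_def)
  have free: "r = r'" if R: "r \<in> R" "r' \<in> R" and x: "x \<in> carrier G" and eq: "r x = r' x" for r r' x
  proof -
    obtain q where q: "q \<in> R" "\<forall>z\<in>carrier G. q z = r (e x z)" using comp[of r "e x"] R x by auto
    obtain q' where q': "q' \<in> R" "\<forall>z\<in>carrier G. q' z = r' (e x z)" using comp[of r' "e x"] R x by auto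
    have "q = q'" using q q' eq x by (intro eq1) auto
    have "r z = r' z" if "z \<in> carrier G" for z
    proof -
      have "e x \<in> Bij (carrier G)" using RBij eR[OF x] by auto
      then have "z \<in> e x ` carrier G" using that by (simp add: Bij_def bij_betw_def)
      then show ?thesis using q q' \<open>q = q'\<close> by auto
    qed
    then show ?thesis
      using R RBij by (intro extensionalityI[of _ "carrier G"]) (auto dest: Bij_imp_extensional)
  qed
  define d where "d s = inv\<^bsub>Perm G\<^esub> (e s)" for s
  have dR [simp]: "d s \<in> R" if "s \<in> carrier G" for s
    unfolding d_def by (rule R.m_inv_closed[OF eR[OF that]])
  have ecl [simp]: "e s x \<in> carrier G" and dcl [simp]: "d s x \<in> carrier G"
    if "s \<in> carrier G" "x \<in> carrier G" for s x
    using that by (auto intro: cl)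
  have de: "d s (e s x) = x" "e s (d s x) = x" if "s \<in> carrier G" "x \<in> carrier G" for s x
  proof -
    have B: "e s \<in> Bij (carrier G)" "d s \<in> Bij (carrier G)"
      using RBij that(1) eR dR by blast+
    have "d s \<otimes>\<^bsub>Perm G\<^esub> e s = \<one>\<^bsub>Perm G\<^esub>" "e s \<otimes>\<^bsub>Perm G\<^esub> d s = \<one>\<^bsub>Perm G\<^esub>"
      using R.subset eR[OF that(1)] by (auto simp: d_def intro: P.l_inv P.r_inv)
    then have "(\<lambda>x\<in>carrier G. d s (e s x)) x = (\<lambda>x\<in>carrier G. x) x"
      "(\<lambda>x\<in>carrier G. e s (d s x)) x = (\<lambda>x\<in>carrier G. x) x"
      unfolding Perm_mult[OF B] Perm_mult[OF B(2,1)] by (simp_all add: BijGroup_def)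
    then show "d s (e s x) = x" "e s (d s x) = x" using that by simp_all
  qed
  define t where "t s x = d s (s \<otimes> x)" for s x
  have tcl [simp]: "t s x \<in> carrier G" if "s \<in> carrier G" "x \<in> carrier G" for s x
    using that by (simp add: t_def)
  have t1 [simp]: "t s \<one> = \<one>" if "s \<in> carrier G" for s
    using de(1)[of s \<one>] that by (simp add: t_def)
  have key: "r (w \<otimes> x) = r' (w \<otimes> x)"
    if "r \<in> R" "r' \<in> R" "w \<in> carrier G" "z \<in> carrier G" "r (w \<otimes> z) = r' (w \<otimes> z)" for r r' w z x
    using free[of r r' "w \<otimes> z"] that by simp
  have push: "\<exists>q\<in>R. \<forall>x\<in>carrier G. s \<otimes> r x = q (s \<otimes> x)" if s: "s \<in> carrier G" and r: "r \<in> R" for s r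
  proof -
    obtain q where "q \<in> R" "\<forall>x\<in>carrier G. q x = s \<otimes> r (inv s \<otimes> x)" using conj s r by blast
    then show ?thesis using s by (intro bexI[of _ q]) (auto simp: m_assoc [symmetric])
  qed
  have tm: "t (r \<otimes> s) x = t r (t s x)"
    if [simp]: "r \<in> carrier G" "s \<in> carrier G" "x \<in> carrier G" for r s x
  proof -
    obtain q where q: "q \<in> R" "\<forall>x\<in>carrier G. r \<otimes> d s x = q (r \<otimes> x)" using push[of r "d s"] by auto
    obtain p where p: "p \<in> R" "\<forall>x\<in>carrier G. p x = d r (q x)" using comp[of "d r" q] q by auto
    have tt: "t r (t s z) = p (r \<otimes> s \<otimes> z)" if z: "z \<in> carrier G" for z
    proof -
      have "r \<otimes> d s (s \<otimes> z) = q (r \<otimes> s \<otimes> z)"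
        using bspec[OF q(2), of "s \<otimes> z"] z by (simp add: m_assoc)
      moreover have "p (r \<otimes> s \<otimes> z) = d r (q (r \<otimes> s \<otimes> z))"
        using bspec[OF p(2), of "r \<otimes> s \<otimes> z"] z by simp
      ultimately show ?thesis
        by (simp add: t_def)
    qed
    have "t (r \<otimes> s) \<one> = p (r \<otimes> s \<otimes> \<one>)"
      by (subst tt [symmetric]) simp_all
    then have "d (r \<otimes> s) (r \<otimes> s \<otimes> \<one>) = p (r \<otimes> s \<otimes> \<one>)"
      by (simp only: t_def)
    then have "d (r \<otimes> s) (r \<otimes> s \<otimes> x) = p (r \<otimes> s \<otimes> x)"
      by (rule key[rotated -1]) (use p(1) in simp_all)
    then show ?thesis using tt[of x] by (simp add: t_def)
  qed
  have tb: "t s (x \<otimes> y) = t s x \<otimes> t (inv (t s x) \<otimes> s \<otimes> x) y"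
    if [simp]: "s \<in> carrier G" "x \<in> carrier G" "y \<in> carrier G" for s x y
  proof -
    define v where "v = t s x"
    define w where "w = inv v \<otimes> s \<otimes> x"
    have [simp]: "v \<in> carrier G" "w \<in> carrier G" by (simp_all add: v_def w_def)
    have vw: "v \<otimes> w = s \<otimes> x" by (simp add: w_def m_assoc [symmetric])
    obtain q where q: "q \<in> R" "\<forall>x\<in>carrier G. v \<otimes> d w x = q (v \<otimes> x)" using push[of v "d w"] by auto
    have rhs: "v \<otimes> t w z = q (s \<otimes> x \<otimes> z)" if z: "z \<in> carrier G" for z
    proof -
      have "v \<otimes> d w (w \<otimes> z) = q (v \<otimes> (w \<otimes> z))"
        using bspec[OF q(2), of "w \<otimes> z"] z by simp
      then show ?thesis
        using z by (simp add: t_def vw m_assoc [symmetric])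
    qed
    have "d s (s \<otimes> x \<otimes> \<one>) = q (s \<otimes> x \<otimes> \<one>)"
    proof -
      have "q (s \<otimes> x \<otimes> \<one>) = v"
        by (subst rhs [symmetric]) simp_all
      then show ?thesis
        by (simp add: v_def t_def)
    qed
    then have "d s (s \<otimes> x \<otimes> y) = q (s \<otimes> x \<otimes> y)"
      by (rule key[rotated -1]) (use q(1) in simp_all)
    then show ?thesis
      using rhs[of y] by (simp add: t_def m_assoc v_def w_def)
  qed
  have t_one: "t \<one> x = x" if "x \<in> carrier G" for x
  proof -
    have "t \<one> (t \<one> x) = t \<one> x" using tm[of \<one> \<one> x] that by simp
    then have "e \<one> (t \<one> (t \<one> x)) = e \<one> (t \<one> x)" by simp
    then show ?thesis using that by (simp add: t_def de)
  qed
  have "braided G t"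
    unfolding braided_def using tm tb t_one by simp
  moreover have "star_translation G t s = e s" if [simp]: "s \<in> carrier G" for s
  proof -
    obtain q where q: "q \<in> R" "\<forall>x\<in>carrier G. s \<otimes> d (inv s) x = q (s \<otimes> x)"
      using push[of s "d (inv s)"] by auto
    have tr: "star_translation G t s x = q x" if "x \<in> carrier G" for x
      using that q by (simp add: star_translation_def star_mult_def t_def m_assoc [symmetric])
    have "q = e s"
    proof (rule eq1)
      have "q \<one> = star_translation G t s \<one>" by (rule tr [symmetric]) simp
      also have "\<dots> = s" by (simp add: star_translation_def star_mult_def)
      finally show "q \<one> = e s \<one>" by simp
    qed (use q in simp_all)
    moreover have "e s \<in> extensional (carrier G)"
      using RBij eR[OF that] by (blast intro: Bij_imp_extensional)
    ultimately show ?thesis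
      using tr by (intro extensionalityI[of _ "carrier G"]) (auto simp: star_translation_def)
  qed
  then have "star_translations G t = e ` carrier G" by (simp add: star_translations_def)
  moreover have "e ` carrier G = R"
  proof
    show "R \<subseteq> e ` carrier G"
    proof
      fix r assume r: "r \<in> R"
      then have "r = e (r \<one>)"
        using cl[OF r one_closed] by (intro eq1) auto
      then show "r \<in> e ` carrier G" using cl[OF r one_closed] by (rule image_eqI)
    qed
  qed auto
  ultimately show ?thesis by auto
qed

end

text \<open>
  Used twice: for the isomorphism from a computable copy of the symmetric group, and for its inner
  automorphisms, which act on the set of all braided actions.
\<close>

lemma braided_transport:
  assumes H: "group H" and G: "group G" and h: "h \<in> iso H G"
    and k: "\<And>x. x \<in> carrier H \<Longrightarrow> k (h x) = x" and t: "braided H t"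
  shows "braided G (\<lambda>s x. h (t (k s) (k x)))"
    and "star_group H t \<cong> star_group G (\<lambda>s x. h (t (k s) (k x)))"
proof -
  interpret H: group H by (rule H)
  interpret G: group G by (rule G)
  interpret h: group_hom H G h
    using h by unfold_locales (simp add: iso_def)
  have im: "h ` carrier H = carrier G" using h by (simp add: iso_def bij_betw_def)
  have k_closed [simp]: "k y \<in> carrier H" and h_k [simp]: "h (k y) = y" if "y \<in> carrier G" for y
  proof -
    have "y \<in> h ` carrier H" using that im by simp
    then show "k y \<in> carrier H" "h (k y) = y" using k by auto
  qed
  have k_mult [simp]: "k (x \<otimes>\<^bsub>G\<^esub> y) = k x \<otimes>\<^bsub>H\<^esub> k y" if "x \<in> carrier G" "y \<in> carrier G" for x y
    using that k[of "k x \<otimes>\<^bsub>H\<^esub> k y"] by simp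
  have k_one [simp]: "k \<one>\<^bsub>G\<^esub> = \<one>\<^bsub>H\<^esub>"
    using k[of "\<one>\<^bsub>H\<^esub>"] by simp
  have k_inv [simp]: "k (inv\<^bsub>G\<^esub> x) = inv\<^bsub>H\<^esub> k x" if "x \<in> carrier G" for x
    using that k[of "inv\<^bsub>H\<^esub> k x"] by simp
  note [simp] = k H.act_closed[OF t] H.act_one[OF t] H.act_fix[OF t]
  show "braided G (\<lambda>s x. h (t (k s) (k x)))"
    unfolding braided_def by (simp add: H.act_mult[OF t] H.act_braid[OF t])
  have "h \<in> iso (star_group H t) (star_group G (\<lambda>s x. h (t (k s) (k x))))"
    using h by (auto simp: iso_def hom_def star_group_def star_mult_def)
  then show "star_group H t \<cong> star_group G (\<lambda>s x. h (t (k s) (k x)))"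
    by (rule is_isoI)
qed

text \<open>
  An isomorphism invariant that separates the four types of groups in the theorem.
\<close>

definition power_count :: "nat \<Rightarrow> ('a, 'm) monoid_scheme \<Rightarrow> nat" where
  "power_count k G = card {x \<in> carrier G. x [^]\<^bsub>G\<^esub> k = \<one>\<^bsub>G\<^esub>}"

lemma power_count_iso:
  assumes "group G" "group K" "G \<cong> K"
  shows "power_count k G = power_count k K"
proof -
  obtain h where h: "h \<in> iso G K" using assms(3) by (auto simp: is_iso_def)
  interpret G: group G by (rule assms(1))
  interpret group_hom G K h
    using h assms by (simp add: group_hom_def group_hom_axioms_def iso_def)
  have bij: "bij_betw h (carrier G) (carrier K)" using h by (simp add: iso_def)
  have "x [^]\<^bsub>G\<^esub> k = \<one>\<^bsub>G\<^esub> \<longleftrightarrow> h x [^]\<^bsub>K\<^esub> k = \<one>\<^bsub>K\<^esub>" if "x \<in> carrier G" for x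
    using that bij hom_nat_pow[OF that, of k]
    by (metis G.nat_pow_closed G.one_closed bij_betw_def hom_one inj_onD)
  then have "bij_betw h {x \<in> carrier G. x [^]\<^bsub>G\<^esub> k = \<one>\<^bsub>G\<^esub>} {y \<in> carrier K. y [^]\<^bsub>K\<^esub> k = \<one>\<^bsub>K\<^esub>}"
    using bij by (auto simp: bij_betw_def inj_on_def image_iff) (metis imageE)
  then show ?thesis
    unfolding power_count_def by (rule bij_betw_same_card)
qed

section \<open>A computable copy of the symmetric group of degree four\<close>

text \<open>
  Elements are constants, so that the rewriting engine decides equality and multiplies in a few steps.
  The name of an element lists its values: \<open>p2341\<close> maps 1, 2, 3, 4 to 2, 3, 4, 1. The elements are listed in
  lexicographic order, and all tables below follow this order.
\<close>

datatype point = P1 | P2 | P3 | P4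

datatype s4 =
  p1234 | p1243 | p1324 | p1342 | p1423 | p1432 | p2134 | p2143 | p2314 | p2341 | p2413 | p2431
  | p3124 | p3142 | p3214 | p3241 | p3412 | p3421 | p4123 | p4132 | p4213 | p4231 | p4312
  | p4321

primrec act :: "s4 \<Rightarrow> point \<Rightarrow> point" where
  "act p1234 = case_point P1 P2 P3 P4"
| "act p1243 = case_point P1 P2 P4 P3"
| "act p1324 = case_point P1 P3 P2 P4"
| "act p1342 = case_point P1 P3 P4 P2"
| "act p1423 = case_point P1 P4 P2 P3"
| "act p1432 = case_point P1 P4 P3 P2"
| "act p2134 = case_point P2 P1 P3 P4"
| "act p2143 = case_point P2 P1 P4 P3"
| "act p2314 = case_point P2 P3 P1 P4"
| "act p2341 = case_point P2 P3 P4 P1"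
| "act p2413 = case_point P2 P4 P1 P3"
| "act p2431 = case_point P2 P4 P3 P1"
| "act p3124 = case_point P3 P1 P2 P4"
| "act p3142 = case_point P3 P1 P4 P2"
| "act p3214 = case_point P3 P2 P1 P4"
| "act p3241 = case_point P3 P2 P4 P1"
| "act p3412 = case_point P3 P4 P1 P2"
| "act p3421 = case_point P3 P4 P2 P1"
| "act p4123 = case_point P4 P1 P2 P3"
| "act p4132 = case_point P4 P1 P3 P2"
| "act p4213 = case_point P4 P2 P1 P3"
| "act p4231 = case_point P4 P2 P3 P1"
| "act p4312 = case_point P4 P3 P1 P2"
| "act p4321 = case_point P4 P3 P2 P1"

definition perm_of :: "point \<Rightarrow> point \<Rightarrow> point \<Rightarrow> s4" where
  "perm_of a b c = (THE x. act x P1 = a \<and> act x P2 = b \<and> act x P3 = c)"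

lemma act_inject: "act x P1 = act y P1 \<Longrightarrow> act x P2 = act y P2 \<Longrightarrow> act x P3 = act y P3 \<Longrightarrow> x = y"
  by (cases x; cases y; simp)

text \<open>
  Instantiated at the 24 elements, this turns the description in \<open>perm_of_def\<close> into rewrite rules.
\<close>

lemma perm_of_act: "perm_of (act x P1) (act x P2) (act x P3) = x"
  unfolding perm_of_def using act_inject by blast

lemmas perm_of_elements =
  perm_of_act[of p1234] perm_of_act[of p1243] perm_of_act[of p1324] perm_of_act[of p1342]
  perm_of_act[of p1423] perm_of_act[of p1432] perm_of_act[of p2134] perm_of_act[of p2143]
  perm_of_act[of p2314] perm_of_act[of p2341] perm_of_act[of p2413] perm_of_act[of p2431]
  perm_of_act[of p3124] perm_of_act[of p3142] perm_of_act[of p3214] perm_of_act[of p3241]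
  perm_of_act[of p3412] perm_of_act[of p3421] perm_of_act[of p4123] perm_of_act[of p4132]
  perm_of_act[of p4213] perm_of_act[of p4231] perm_of_act[of p4312] perm_of_act[of p4321]

lemmas perm_of_simps = perm_of_elements[unfolded act.simps point.case]

definition s4_mult :: "s4 \<Rightarrow> s4 \<Rightarrow> s4" (infixl "\<cdot>" 70) where
  "x \<cdot> y = perm_of (act x (act y P1)) (act x (act y P2)) (act x (act y P3))"

primrec s4_inv :: "s4 \<Rightarrow> s4" where
  "s4_inv p1234 = p1234" | "s4_inv p1243 = p1243" | "s4_inv p1324 = p1324" | "s4_inv p1342 = p1423"
  | "s4_inv p1423 = p1342" | "s4_inv p1432 = p1432" | "s4_inv p2134 = p2134" | "s4_inv p2143 = p2143"
  | "s4_inv p2314 = p3124" | "s4_inv p2341 = p4123" | "s4_inv p2413 = p3142" | "s4_inv p2431 = p4132"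
  | "s4_inv p3124 = p2314" | "s4_inv p3142 = p2413" | "s4_inv p3214 = p3214" | "s4_inv p3241 = p4213"
  | "s4_inv p3412 = p3412" | "s4_inv p3421 = p4312" | "s4_inv p4123 = p2341" | "s4_inv p4132 = p2431"
  | "s4_inv p4213 = p3241" | "s4_inv p4231 = p4231" | "s4_inv p4312 = p3421" | "s4_inv p4321 = p4321"

definition elems :: "s4 list" where
  "elems =
    [p1234, p1243, p1324, p1342, p1423, p1432, p2134, p2143, p2314, p2341, p2413, p2431, p3124,
    p3142, p3214, p3241, p3412, p3421, p4123, p4132, p4213, p4231, p4312, p4321]"

lemma set_elems: "set elems = UNIV"
proof -
  have "x \<in> set elems" for x
    by (cases x) (simp_all add: elems_def)
  then show ?thesis by blast
qed

text \<open>
  Turns a universally quantified statement into 24 instances that can be evaluated.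
\<close>

lemma all_s4: "(\<forall>x. P x) \<longleftrightarrow> list_all P elems"
  by (simp add: list_all_iff set_elems)

lemmas s4_eval = s4_mult_def act.simps point.case perm_of_simps s4_inv.simps
lemmas all_eval = all_s4 elems_def list.pred_inject simp_thms s4.distinct

lemma mul_assoc: "x \<cdot> y \<cdot> z = x \<cdot> (y \<cdot> z)"
proof -
  have "\<forall>z. x \<cdot> y \<cdot> z = x \<cdot> (y \<cdot> z)"
    by (cases x; cases y) (simp_all only: s4_eval all_eval)
  then show ?thesis by blast
qed

lemma mul_one [simp]: "p1234 \<cdot> x = x" "x \<cdot> p1234 = x"
  by (cases x; simp only: s4_eval)+

lemma mul_inv [simp]: "s4_inv x \<cdot> x = p1234" "x \<cdot> s4_inv x = p1234"
  by (cases x; simp only: s4_eval)+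

lemma mul_inv_assoc [simp]: "s4_inv x \<cdot> (x \<cdot> y) = y" "x \<cdot> (s4_inv x \<cdot> y) = y"
  by (simp_all flip: mul_assoc)

lemma mul_cancel [simp]: "x \<cdot> y = x \<cdot> z \<longleftrightarrow> y = z" "y \<cdot> x = z \<cdot> x \<longleftrightarrow> y = z"
  by (metis mul_inv_assoc(1), metis mul_assoc mul_inv(2) mul_one(2))

lemma s4_inv_unique: "y \<cdot> x = p1234 \<Longrightarrow> s4_inv x = y"
  by (metis mul_cancel(2) mul_inv(1))

lemma s4_inv_inv [simp]: "s4_inv (s4_inv x) = x" and s4_inv_one: "s4_inv p1234 = p1234"
  and s4_inv_mul: "s4_inv (x \<cdot> y) = s4_inv y \<cdot> s4_inv x"
  by (rule s4_inv_unique, simp add: mul_assoc)+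

definition S4 :: "s4 monoid" where
  "S4 = \<lparr>carrier = UNIV, monoid.mult = (\<cdot>), one = p1234\<rparr>"

lemma S4_simps [simp]:
  "carrier S4 = UNIV" "monoid.mult S4 = (\<cdot>)" "one S4 = p1234"
  by (simp_all add: S4_def)

lemma group_S4: "group S4"
  by (rule groupI) (auto simp: mul_assoc intro: mul_inv)

lemma inv_S4 [simp]: "inv\<^bsub>S4\<^esub> x = s4_inv x"
  by (rule group.inv_equality[OF group_S4]) simp_all

lemma braided_S4_iff: "braided S4 T \<longleftrightarrow>
  (\<forall>x. T p1234 x = x) \<and> (\<forall>s. T s p1234 = p1234) \<and> (\<forall>r s x. T (r \<cdot> s) x = T r (T s x)) \<and>
  (\<forall>s x y. T s (x \<cdot> y) = T s x \<cdot> T (s4_inv (T s x) \<cdot> s \<cdot> x) y)"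
  by (simp add: braided_def)

text \<open>
  The words express every element in the generators \<open>p2134\<close>, a transposition, and \<open>p2341\<close>, a
  four-cycle. Reading \<open>r\<close> and \<open>q\<close> as the actions of these two gives the action of any element.
\<close>

primrec on_generators :: "s4 \<Rightarrow> ('a \<Rightarrow> 'a) \<Rightarrow> ('a \<Rightarrow> 'a) \<Rightarrow> 'a \<Rightarrow> 'a" where
  "on_generators p1234 r q = id"
| "on_generators p1243 r q = q \<circ> q \<circ> r \<circ> q \<circ> q"
| "on_generators p1324 r q = q \<circ> q \<circ> r \<circ> q \<circ> r"
| "on_generators p1342 r q = r \<circ> q"
| "on_generators p1423 r q = q \<circ> q \<circ> q \<circ> r"
| "on_generators p1432 r q = q \<circ> r \<circ> q \<circ> q \<circ> r"
| "on_generators p2134 r q = r"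
| "on_generators p2143 r q = q \<circ> q \<circ> r \<circ> q \<circ> q \<circ> r"
| "on_generators p2314 r q = r \<circ> q \<circ> q \<circ> r \<circ> q \<circ> r"
| "on_generators p2341 r q = q"
| "on_generators p2413 r q = q \<circ> r \<circ> q"
| "on_generators p2431 r q = q \<circ> q \<circ> q \<circ> r \<circ> q \<circ> r"
| "on_generators p3124 r q = q \<circ> q \<circ> r \<circ> q"
| "on_generators p3142 r q = r \<circ> q \<circ> r"
| "on_generators p3214 r q = r \<circ> q \<circ> q \<circ> r \<circ> q"
| "on_generators p3241 r q = q \<circ> r"
| "on_generators p3412 r q = q \<circ> q"
| "on_generators p3421 r q = r \<circ> q \<circ> q"
| "on_generators p4123 r q = q \<circ> q \<circ> q"
| "on_generators p4132 r q = q \<circ> r \<circ> q \<circ> q"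
| "on_generators p4213 r q = q \<circ> r \<circ> q \<circ> r"
| "on_generators p4231 r q = q \<circ> q \<circ> q \<circ> r \<circ> q"
| "on_generators p4312 r q = q \<circ> q \<circ> r"
| "on_generators p4321 r q = r \<circ> q \<circ> q \<circ> r"

lemmas on_generators_eval = on_generators.simps comp_apply id_apply

lemma on_generators_mult: "on_generators x ((\<cdot>) p2134) ((\<cdot>) p2341) p1234 = x"
  by (cases x; simp only: on_generators_eval s4_eval)

lemma on_generators_induct:
  assumes "P x" "\<And>x. P x \<Longrightarrow> P (r x)" "\<And>x. P x \<Longrightarrow> P (q x)"
  shows "P (on_generators s r q x)"
  by (cases s) (simp_all add: assms)

lemma generated_induct [case_names one step]:
  assumes "P p1234" "\<And>x. P x \<Longrightarrow> P (p2134 \<cdot> x) \<and> P (p2341 \<cdot> x)"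
  shows "P x"
  using on_generators_induct[of P p1234 "(\<cdot>) p2134" "(\<cdot>) p2341" x] assms by (simp add: on_generators_mult)

lemma braided_on_generators:
  assumes "braided S4 T"
  shows "T s = on_generators s (T p2134) (T p2341)"
proof (rule ext)
  have one: "T p1234 x = x" and m: "T r (T u x) = T (r \<cdot> u) x" for r u x
    using assms by (simp_all add: braided_S4_iff)
  show "T s x = on_generators s (T p2134) (T p2341) x" for x
    by (cases s) (simp_all only: on_generators_eval m one s4_eval)
qed

text \<open>
  A finite test for the braided action that maps the two generators to \<open>r\<close> and \<open>q\<close>. It is enough
  to test the action law when the left factor, and the braiding law when the first factor of the argument,
  is a generator: the other instances follow by induction on words. The bindings make the rewriting engine
  compute \<open>y\<close> and \<open>u\<close> once for all \<open>x\<close>.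
\<close>

definition generates_braided :: "(s4 \<Rightarrow> s4) \<Rightarrow> (s4 \<Rightarrow> s4) \<Rightarrow> bool" where
  "generates_braided r q \<longleftrightarrow> (let T = (\<lambda>s. on_generators s r q) in
    (\<forall>s. T s p1234 = p1234) \<and>
    (\<forall>s x. T (p2134 \<cdot> s) x = r (T s x) \<and> T (p2341 \<cdot> s) x = q (T s x)) \<and>
    (\<forall>s. let y = T s p2134; u = s4_inv y \<cdot> s \<cdot> p2134 in \<forall>x. T s (p2134 \<cdot> x) = y \<cdot> T u x) \<and>
    (\<forall>s. let y = T s p2341; u = s4_inv y \<cdot> s \<cdot> p2341 in \<forall>x. T s (p2341 \<cdot> x) = y \<cdot> T u x))"

lemma braided_generated:
  assumes "generates_braided r q"
  shows "braided S4 (\<lambda>s. on_generators s r q)"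
proof -
  define T where "T = (\<lambda>s. on_generators s r q)"
  have fix1: "T s p1234 = p1234"
    and mr: "T (p2134 \<cdot> s) x = r (T s x)" and mq: "T (p2341 \<cdot> s) x = q (T s x)"
    and br: "T s (p2134 \<cdot> x) = T s p2134 \<cdot> T (s4_inv (T s p2134) \<cdot> s \<cdot> p2134) x"
    and bq: "T s (p2341 \<cdot> x) = T s p2341 \<cdot> T (s4_inv (T s p2341) \<cdot> s \<cdot> p2341) x" for s x
    using assms by (simp_all add: generates_braided_def Let_def T_def)
  have one: "T p1234 x = x" for x by (simp add: T_def)
  have m: "T (s \<cdot> u) x = T s (T u x)" for s u x
    by (induction s rule: generated_induct) (simp_all add: one mul_assoc mr mq)
  have "T s (x \<cdot> y) = T s x \<cdot> T (s4_inv (T s x) \<cdot> s \<cdot> x) y" for s x y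
  proof (induction x arbitrary: s rule: generated_induct)
    case one then show ?case by (simp add: fix1 s4_inv_one)
  next
    case (step x)
    have *: "T s (g \<cdot> x \<cdot> y) = T s (g \<cdot> x) \<cdot> T (s4_inv (T s (g \<cdot> x)) \<cdot> s \<cdot> (g \<cdot> x)) y"
      if g: "\<And>s z. T s (g \<cdot> z) = T s g \<cdot> T (s4_inv (T s g) \<cdot> s \<cdot> g) z" for g s
    proof -
      define w where "w = s4_inv (T s g) \<cdot> s \<cdot> g"
      have gx: "T s (g \<cdot> x) = T s g \<cdot> T w x"
        using g[of s x] by (simp only: w_def)
      have u: "s4_inv (T w x) \<cdot> w \<cdot> x = s4_inv (T s (g \<cdot> x)) \<cdot> s \<cdot> (g \<cdot> x)"
        by (simp only: gx s4_inv_mul mul_assoc) (simp only: w_def mul_assoc)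
      have "T s (g \<cdot> x \<cdot> y) = T s g \<cdot> T w (x \<cdot> y)"
        using g[of s "x \<cdot> y"] by (simp only: w_def mul_assoc)
      also have "\<dots> = T s (g \<cdot> x) \<cdot> T (s4_inv (T w x) \<cdot> w \<cdot> x) y"
        by (simp only: step.IH[of w] gx mul_assoc)
      finally show ?thesis by (simp only: u)
    qed
    show ?case using *[OF br] *[OF bq] by simp
  qed
  then show ?thesis
    using fix1 one m by (simp add: braided_S4_iff T_def)
qed

section \<open>Fifteen braided actions\<close>

definition s4_conj :: "s4 \<Rightarrow> s4 \<Rightarrow> s4" where
  "s4_conj g x = g \<cdot> x \<cdot> s4_inv g"

definition conj_action :: "s4 \<Rightarrow> (s4 \<Rightarrow> s4 \<Rightarrow> s4) \<Rightarrow> s4 \<Rightarrow> s4 \<Rightarrow> s4" where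
  "conj_action g T s x = s4_conj g (T (s4_conj (s4_inv g) s) (s4_conj (s4_inv g) x))"

lemma s4_conj_inv [simp]: "s4_conj (s4_inv g) (s4_conj g x) = x" "s4_conj g (s4_conj (s4_inv g) x) = x"
  by (simp_all add: s4_conj_def mul_assoc)

lemma s4_conj_iso: "s4_conj g \<in> iso S4 S4"
proof -
  have "bij_betw (s4_conj g) UNIV UNIV"
    by (rule bij_betw_byWitness[where f' = "s4_conj (s4_inv g)"]) simp_all
  then show ?thesis
    by (auto simp: iso_def hom_def s4_conj_def mul_assoc)
qed

lemma conj_action_compose: "conj_action g (conj_action h T) = conj_action (g \<cdot> h) T"
  by (simp add: fun_eq_iff conj_action_def s4_conj_def s4_inv_mul mul_assoc)

lemma conj_action_one: "conj_action p1234 T = T"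
  by (simp add: fun_eq_iff conj_action_def s4_conj_def s4_inv_one)

lemma
  assumes "braided S4 T"
  shows braided_conj_action: "braided S4 (conj_action g T)"
    and star_group_conj_action: "star_group S4 T \<cong> star_group S4 (conj_action g T)"
  using braided_transport[OF group_S4 group_S4 s4_conj_iso[of g] _ assms, of "s4_conj (s4_inv g)"]
  by (simp_all add: conj_action_def[abs_def])

text \<open>
  Representatives of the fifteen conjugacy classes of braided actions, found by computer search. Each is
  given by the actions \<open>r\<close> and \<open>q\<close> of the two generators, as a list of values. The names anticipate the types of
  the corresponding regular subgroups.
\<close>

definition action_A4C2_1_r :: "s4 \<Rightarrow> s4" where
  "action_A4C2_1_r =
    (case_s4 p1234 p1324 p1243 p1423 p1342 p1432 p3142 p3412 p3124 p3214 p3421 p3241 p2314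
    p2134 p2341 p2431 p2143 p2413 p4123 p4213 p4132 p4312 p4231 p4321)"

definition action_A4C2_1_q :: "s4 \<Rightarrow> s4" where
  "action_A4C2_1_q =
    (case_s4 p1234 p1324 p1243 p1423 p1342 p1432 p4231 p4321 p4213 p4123 p4312 p4132 p3241
    p3421 p3214 p3124 p3412 p3142 p2341 p2431 p2314 p2134 p2413 p2143)"

definition action_A4C2_1 :: "s4 \<Rightarrow> s4 \<Rightarrow> s4" where
  "action_A4C2_1 s = on_generators s action_A4C2_1_r action_A4C2_1_q"

definition action_A4C2_2_r :: "s4 \<Rightarrow> s4" where
  "action_A4C2_2_r =
    (case_s4 p1234 p1324 p1243 p1423 p1342 p1432 p4231 p4321 p4213 p4123 p4312 p4132 p3241
    p3421 p3214 p3124 p3412 p3142 p2341 p2431 p2314 p2134 p2413 p2143)"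

definition action_A4C2_2_q :: "s4 \<Rightarrow> s4" where
  "action_A4C2_2_q =
    (case_s4 p1234 p1324 p1243 p1423 p1342 p1432 p4231 p4321 p4213 p4123 p4312 p4132 p3241
    p3421 p3214 p3124 p3412 p3142 p2341 p2431 p2314 p2134 p2413 p2143)"

definition action_A4C2_2 :: "s4 \<Rightarrow> s4 \<Rightarrow> s4" where
  "action_A4C2_2 s = on_generators s action_A4C2_2_r action_A4C2_2_q"

definition action_C6C2C2_1_r :: "s4 \<Rightarrow> s4" where
  "action_C6C2C2_1_r =
    (case_s4 p1234 p1324 p1243 p1423 p1342 p1432 p2413 p2143 p2431 p2341 p2134 p2314 p4231
    p4213 p4321 p4312 p4123 p4132 p3412 p3421 p3142 p3124 p3241 p3214)"

definition action_C6C2C2_1_q :: "s4 \<Rightarrow> s4" where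
  "action_C6C2C2_1_q =
    (case_s4 p1234 p1324 p1243 p1423 p1342 p1432 p4132 p4123 p4312 p4321 p4213 p4231 p3142
    p3124 p3412 p3421 p3214 p3241 p2341 p2431 p2314 p2134 p2413 p2143)"

definition action_C6C2C2_1 :: "s4 \<Rightarrow> s4 \<Rightarrow> s4" where
  "action_C6C2C2_1 s = on_generators s action_C6C2C2_1_r action_C6C2C2_1_q"

definition action_C6C2C2_2_r :: "s4 \<Rightarrow> s4" where
  "action_C6C2C2_2_r =
    (case_s4 p1234 p1324 p1243 p1423 p1342 p1432 p2413 p2143 p2431 p2341 p2134 p2314 p4132
    p4312 p4123 p4213 p4321 p4231 p3214 p3124 p3241 p3421 p3142 p3412)"

definition action_C6C2C2_2_q :: "s4 \<Rightarrow> s4" where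
  "action_C6C2C2_2_q =
    (case_s4 p1234 p1324 p1243 p1423 p1342 p1432 p4231 p4321 p4213 p4123 p4312 p4132 p3241
    p3421 p3214 p3124 p3412 p3142 p2341 p2431 p2314 p2134 p2413 p2143)"

definition action_C6C2C2_2 :: "s4 \<Rightarrow> s4 \<Rightarrow> s4" where
  "action_C6C2C2_2 s = on_generators s action_C6C2C2_2_r action_C6C2C2_2_q"

definition action_S4_1_r :: "s4 \<Rightarrow> s4" where
  "action_S4_1_r =
    (case_s4 p1234 p2134 p1324 p3124 p2314 p3214 p1243 p2143 p1423 p4123 p2413 p4213 p1342
    p3142 p1432 p4132 p3412 p4312 p2341 p3241 p2431 p4231 p3421 p4321)"

definition action_S4_1_q :: "s4 \<Rightarrow> s4" where
  "action_S4_1_q =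
    (case_s4 p1234 p2134 p1324 p3124 p2314 p3214 p1243 p2143 p1423 p4123 p2413 p4213 p1342
    p3142 p1432 p4132 p3412 p4312 p2341 p3241 p2431 p4231 p3421 p4321)"

definition action_S4_1 :: "s4 \<Rightarrow> s4 \<Rightarrow> s4" where
  "action_S4_1 s = on_generators s action_S4_1_r action_S4_1_q"

definition action_S3C2C2_1_r :: "s4 \<Rightarrow> s4" where
  "action_S3C2C2_1_r =
    (case_s4 p1234 p1243 p1324 p1342 p1423 p1432 p2134 p2143 p2314 p2341 p2413 p2431 p4213
    p4231 p4123 p4132 p4321 p4312 p3214 p3241 p3124 p3142 p3421 p3412)"

definition action_S3C2C2_1_q :: "s4 \<Rightarrow> s4" where
  "action_S3C2C2_1_q =
    (case_s4 p1234 p1243 p1324 p1342 p1423 p1432 p4312 p4321 p4132 p4123 p4231 p4213 p3124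
    p3142 p3214 p3241 p3412 p3421 p2341 p2314 p2431 p2413 p2134 p2143)"

definition action_S3C2C2_1 :: "s4 \<Rightarrow> s4 \<Rightarrow> s4" where
  "action_S3C2C2_1 s = on_generators s action_S3C2C2_1_r action_S3C2C2_1_q"

definition action_A4C2_3_r :: "s4 \<Rightarrow> s4" where
  "action_A4C2_3_r =
    (case_s4 p1234 p1243 p4123 p4132 p3124 p3142 p2134 p2143 p4213 p4231 p3214 p3241 p1423
    p1432 p2413 p2431 p4321 p4312 p1324 p1342 p2314 p2341 p3421 p3412)"

definition action_A4C2_3_q :: "s4 \<Rightarrow> s4" where
  "action_A4C2_3_q =
    (case_s4 p1234 p1243 p4123 p4132 p3124 p3142 p4312 p4321 p2431 p2413 p1432 p1423 p2314
    p2341 p1324 p1342 p3412 p3421 p4231 p4213 p3241 p3214 p2134 p2143)"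

definition action_A4C2_3 :: "s4 \<Rightarrow> s4 \<Rightarrow> s4" where
  "action_A4C2_3 s = on_generators s action_A4C2_3_r action_A4C2_3_q"

definition action_S4_2_r :: "s4 \<Rightarrow> s4" where
  "action_S4_2_r =
    (case_s4 p1234 p1243 p1324 p1342 p1423 p1432 p2134 p2143 p2314 p2341 p2413 p2431 p3124
    p3142 p3214 p3241 p3412 p3421 p4123 p4132 p4213 p4231 p4312 p4321)"

definition action_S4_2_q :: "s4 \<Rightarrow> s4" where
  "action_S4_2_q =
    (case_s4 p1234 p1243 p1324 p1342 p1423 p1432 p2134 p2143 p2314 p2341 p2413 p2431 p3124
    p3142 p3214 p3241 p3412 p3421 p4123 p4132 p4213 p4231 p4312 p4321)"

definition action_S4_2 :: "s4 \<Rightarrow> s4 \<Rightarrow> s4" where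
  "action_S4_2 s = on_generators s action_S4_2_r action_S4_2_q"

definition action_A4C2_4_r :: "s4 \<Rightarrow> s4" where
  "action_A4C2_4_r =
    (case_s4 p1234 p1243 p3214 p3241 p4213 p4231 p2134 p2143 p3124 p3142 p4123 p4132 p2314
    p2341 p1324 p1342 p4321 p4312 p2413 p2431 p1423 p1432 p3421 p3412)"

definition action_A4C2_4_q :: "s4 \<Rightarrow> s4" where
  "action_A4C2_4_q =
    (case_s4 p1234 p1243 p3214 p3241 p4213 p4231 p4312 p4321 p1342 p1324 p2341 p2314 p1423
    p1432 p2413 p2431 p3412 p3421 p3142 p3124 p4132 p4123 p2134 p2143)"

definition action_A4C2_4 :: "s4 \<Rightarrow> s4 \<Rightarrow> s4" where
  "action_A4C2_4 s = on_generators s action_A4C2_4_r action_A4C2_4_q"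

definition action_C6C2C2_3_r :: "s4 \<Rightarrow> s4" where
  "action_C6C2C2_3_r =
    (case_s4 p1234 p3214 p3142 p1423 p1342 p3421 p2341 p3412 p3124 p2134 p2413 p3241 p2314
    p1324 p1243 p2431 p2143 p1432 p4312 p4213 p4132 p4231 p4123 p4321)"

definition action_C6C2C2_3_q :: "s4 \<Rightarrow> s4" where
  "action_C6C2C2_3_q =
    (case_s4 p1234 p3214 p3142 p1423 p1342 p3421 p1432 p2143 p2431 p1243 p1324 p2314 p4132
    p4231 p4312 p4213 p4321 p4123 p2134 p3124 p3241 p2413 p2341 p3412)"

definition action_C6C2C2_3 :: "s4 \<Rightarrow> s4 \<Rightarrow> s4" where
  "action_C6C2C2_3 s = on_generators s action_C6C2C2_3_r action_C6C2C2_3_q"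

definition action_S3C2C2_2_r :: "s4 \<Rightarrow> s4" where
  "action_S3C2C2_2_r =
    (case_s4 p1234 p3421 p3214 p1423 p1342 p3142 p2134 p3412 p3124 p2413 p2341 p3241 p2314
    p1432 p1324 p2431 p2143 p1243 p4231 p4213 p4132 p4123 p4312 p4321)"

definition action_S3C2C2_2_q :: "s4 \<Rightarrow> s4" where
  "action_S3C2C2_2_q =
    (case_s4 p1234 p3142 p3421 p1423 p1342 p3214 p1324 p2143 p2431 p1432 p1243 p2314 p4132
    p4312 p4123 p4213 p4321 p4231 p2341 p3124 p3241 p2134 p2413 p3412)"

definition action_S3C2C2_2 :: "s4 \<Rightarrow> s4 \<Rightarrow> s4" where
  "action_S3C2C2_2 s = on_generators s action_S3C2C2_2_r action_S3C2C2_2_q"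

definition action_S3C2C2_3_r :: "s4 \<Rightarrow> s4" where
  "action_S3C2C2_3_r =
    (case_s4 p1234 p3421 p3142 p1342 p1423 p3214 p2134 p3412 p3241 p2341 p2413 p3124 p2431
    p1324 p1432 p2314 p2143 p1243 p4123 p4132 p4213 p4231 p4312 p4321)"

definition action_S3C2C2_3_q :: "s4 \<Rightarrow> s4" where
  "action_S3C2C2_3_q =
    (case_s4 p1234 p3421 p3142 p1342 p1423 p3214 p1243 p2143 p2314 p1432 p1324 p2431 p4213
    p4231 p4123 p4132 p4321 p4312 p2341 p3241 p3124 p2413 p2134 p3412)"

definition action_S3C2C2_3 :: "s4 \<Rightarrow> s4 \<Rightarrow> s4" where
  "action_S3C2C2_3 s = on_generators s action_S3C2C2_3_r action_S3C2C2_3_q"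

definition action_S3C2C2_4_r :: "s4 \<Rightarrow> s4" where
  "action_S3C2C2_4_r =
    (case_s4 p1234 p1243 p1432 p1423 p1342 p1324 p2134 p2143 p2431 p2413 p2341 p2314 p4132
    p4123 p4231 p4213 p4321 p4312 p3142 p3124 p3241 p3214 p3421 p3412)"

definition action_S3C2C2_4_q :: "s4 \<Rightarrow> s4" where
  "action_S3C2C2_4_q =
    (case_s4 p1234 p1324 p1243 p1423 p1342 p1432 p4231 p4321 p4213 p4123 p4312 p4132 p3241
    p3421 p3214 p3124 p3412 p3142 p2341 p2431 p2314 p2134 p2413 p2143)"

definition action_S3C2C2_4 :: "s4 \<Rightarrow> s4 \<Rightarrow> s4" where
  "action_S3C2C2_4 s = on_generators s action_S3C2C2_4_r action_S3C2C2_4_q"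

definition action_S4_3_r :: "s4 \<Rightarrow> s4" where
  "action_S4_3_r =
    (case_s4 p1234 p1243 p3214 p3241 p4213 p4231 p2134 p2143 p3124 p3142 p4123 p4132 p2314
    p2341 p1324 p1342 p4321 p4312 p2413 p2431 p1423 p1432 p3421 p3412)"

definition action_S4_3_q :: "s4 \<Rightarrow> s4" where
  "action_S4_3_q =
    (case_s4 p1234 p4231 p1243 p3241 p4213 p3214 p1324 p4321 p1342 p2341 p4312 p2314 p1423
    p3421 p1432 p2431 p3412 p2413 p4123 p3124 p4132 p2134 p3142 p2143)"

definition action_S4_3 :: "s4 \<Rightarrow> s4 \<Rightarrow> s4" where
  "action_S4_3 s = on_generators s action_S4_3_r action_S4_3_q"

definition action_S4_4_r :: "s4 \<Rightarrow> s4" where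
  "action_S4_4_r =
    (case_s4 p1234 p2134 p2341 p3241 p4213 p2413 p1243 p2143 p3124 p1324 p1432 p4132 p2314
    p3214 p3142 p1342 p4321 p3421 p4231 p2431 p1423 p4123 p4312 p3412)"

definition action_S4_4_q :: "s4 \<Rightarrow> s4" where
  "action_S4_4_q =
    (case_s4 p1234 p4231 p1243 p3241 p4213 p3214 p1324 p4321 p1342 p2341 p4312 p2314 p1423
    p3421 p1432 p2431 p3412 p2413 p4123 p3124 p4132 p2134 p3142 p2143)"

definition action_S4_4 :: "s4 \<Rightarrow> s4 \<Rightarrow> s4" where
  "action_S4_4 s = on_generators s action_S4_4_r action_S4_4_q"

text \<open>
  Rewriting with the 24 entries of a named table spares the rewriting engine from traversing the
  table at every access.
\<close>

lemma case_s4_rows: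
  assumes "f = case_s4 a1 a2 a3 a4 a5 a6 a7 a8 a9 a10 a11 a12 a13 a14 a15 a16 a17 a18 a19
    a20 a21 a22 a23 a24"
  shows
    "f p1234 = a1" "f p1243 = a2" "f p1324 = a3" "f p1342 = a4" "f p1423 = a5" "f p1432 = a6"
    "f p2134 = a7" "f p2143 = a8" "f p2314 = a9" "f p2341 = a10" "f p2413 = a11" "f p2431 = a12"
    "f p3124 = a13" "f p3142 = a14" "f p3214 = a15" "f p3241 = a16" "f p3412 = a17"
    "f p3421 = a18" "f p4123 = a19" "f p4132 = a20" "f p4213 = a21" "f p4231 = a22"
    "f p4312 = a23" "f p4321 = a24"
  unfolding assms by (rule s4.case)+

lemmas action_rows =
  case_s4_rows[OF action_A4C2_1_r_def] case_s4_rows[OF action_A4C2_1_q_def]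
  case_s4_rows[OF action_A4C2_2_r_def] case_s4_rows[OF action_A4C2_2_q_def]
  case_s4_rows[OF action_C6C2C2_1_r_def] case_s4_rows[OF action_C6C2C2_1_q_def]
  case_s4_rows[OF action_C6C2C2_2_r_def] case_s4_rows[OF action_C6C2C2_2_q_def]
  case_s4_rows[OF action_S4_1_r_def] case_s4_rows[OF action_S4_1_q_def]
  case_s4_rows[OF action_S3C2C2_1_r_def] case_s4_rows[OF action_S3C2C2_1_q_def]
  case_s4_rows[OF action_A4C2_3_r_def] case_s4_rows[OF action_A4C2_3_q_def]
  case_s4_rows[OF action_S4_2_r_def] case_s4_rows[OF action_S4_2_q_def]
  case_s4_rows[OF action_A4C2_4_r_def] case_s4_rows[OF action_A4C2_4_q_def]
  case_s4_rows[OF action_C6C2C2_3_r_def] case_s4_rows[OF action_C6C2C2_3_q_def]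
  case_s4_rows[OF action_S3C2C2_2_r_def] case_s4_rows[OF action_S3C2C2_2_q_def]
  case_s4_rows[OF action_S3C2C2_3_r_def] case_s4_rows[OF action_S3C2C2_3_q_def]
  case_s4_rows[OF action_S3C2C2_4_r_def] case_s4_rows[OF action_S3C2C2_4_q_def]
  case_s4_rows[OF action_S4_3_r_def] case_s4_rows[OF action_S4_3_q_def]
  case_s4_rows[OF action_S4_4_r_def] case_s4_rows[OF action_S4_4_q_def]

definition actions_S4 :: "(s4 \<Rightarrow> s4 \<Rightarrow> s4) list" where
  "actions_S4 = [action_S4_1, action_S4_2, action_S4_3, action_S4_4]"

definition actions_A4C2 :: "(s4 \<Rightarrow> s4 \<Rightarrow> s4) list" where
  "actions_A4C2 = [action_A4C2_1, action_A4C2_2, action_A4C2_3, action_A4C2_4]"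

definition actions_S3C2C2 :: "(s4 \<Rightarrow> s4 \<Rightarrow> s4) list" where
  "actions_S3C2C2 = [action_S3C2C2_1, action_S3C2C2_2, action_S3C2C2_3, action_S3C2C2_4]"

definition actions_C6C2C2 :: "(s4 \<Rightarrow> s4 \<Rightarrow> s4) list" where
  "actions_C6C2C2 = [action_C6C2C2_1, action_C6C2C2_2, action_C6C2C2_3]"

lemmas braided_eval = generates_braided_def Let_def on_generators_eval s4_eval action_rows all_eval

lemmas action_defs =
  action_A4C2_1_def action_A4C2_2_def action_C6C2C2_1_def action_C6C2C2_2_def action_S4_1_def
  action_S3C2C2_1_def action_A4C2_3_def action_S4_2_def action_A4C2_4_def action_C6C2C2_3_def
  action_S3C2C2_2_def action_S3C2C2_3_def action_S3C2C2_4_def action_S4_3_def action_S4_4_def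

definition actions :: "(s4 \<Rightarrow> s4 \<Rightarrow> s4) list" where
  "actions = actions_S4 @ actions_A4C2 @ actions_S3C2C2 @ actions_C6C2C2"

lemmas actions_eval = actions_def actions_S4_def actions_A4C2_def actions_S3C2C2_def actions_C6C2C2_def

definition orbit_of :: "(s4 \<Rightarrow> s4 \<Rightarrow> s4) list \<Rightarrow> (s4 \<Rightarrow> s4 \<Rightarrow> s4) set" where
  "orbit_of Ss = {conj_action g S | g S. S \<in> set Ss}"

abbreviation known_actions :: "(s4 \<Rightarrow> s4 \<Rightarrow> s4) set" where
  "known_actions \<equiv> orbit_of actions"

lemma action_known: "S \<in> set actions \<Longrightarrow> S \<in> known_actions"
  unfolding orbit_of_def using conj_action_one by (metis (mono_tags, lifting) mem_Collect_eq)

lemma braided_action_A4C2_1: "braided S4 action_A4C2_1"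
  unfolding action_A4C2_1_def[abs_def] by (rule braided_generated) (simp only: braided_eval)

lemma braided_action_A4C2_2: "braided S4 action_A4C2_2"
  unfolding action_A4C2_2_def[abs_def] by (rule braided_generated) (simp only: braided_eval)

lemma braided_action_C6C2C2_1: "braided S4 action_C6C2C2_1"
  unfolding action_C6C2C2_1_def[abs_def] by (rule braided_generated) (simp only: braided_eval)

lemma braided_action_C6C2C2_2: "braided S4 action_C6C2C2_2"
  unfolding action_C6C2C2_2_def[abs_def] by (rule braided_generated) (simp only: braided_eval)

lemma braided_action_S4_1: "braided S4 action_S4_1"
  unfolding action_S4_1_def[abs_def] by (rule braided_generated) (simp only: braided_eval)

lemma braided_action_S3C2C2_1: "braided S4 action_S3C2C2_1"
  unfolding action_S3C2C2_1_def[abs_def] by (rule braided_generated) (simp only: braided_eval)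

lemma braided_action_A4C2_3: "braided S4 action_A4C2_3"
  unfolding action_A4C2_3_def[abs_def] by (rule braided_generated) (simp only: braided_eval)

lemma braided_action_S4_2: "braided S4 action_S4_2"
  unfolding action_S4_2_def[abs_def] by (rule braided_generated) (simp only: braided_eval)

lemma braided_action_A4C2_4: "braided S4 action_A4C2_4"
  unfolding action_A4C2_4_def[abs_def] by (rule braided_generated) (simp only: braided_eval)

lemma braided_action_C6C2C2_3: "braided S4 action_C6C2C2_3"
  unfolding action_C6C2C2_3_def[abs_def] by (rule braided_generated) (simp only: braided_eval)

lemma braided_action_S3C2C2_2: "braided S4 action_S3C2C2_2"
  unfolding action_S3C2C2_2_def[abs_def] by (rule braided_generated) (simp only: braided_eval)

lemma braided_action_S3C2C2_3: "braided S4 action_S3C2C2_3"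
  unfolding action_S3C2C2_3_def[abs_def] by (rule braided_generated) (simp only: braided_eval)

lemma braided_action_S3C2C2_4: "braided S4 action_S3C2C2_4"
  unfolding action_S3C2C2_4_def[abs_def] by (rule braided_generated) (simp only: braided_eval)

lemma braided_action_S4_3: "braided S4 action_S4_3"
  unfolding action_S4_3_def[abs_def] by (rule braided_generated) (simp only: braided_eval)

lemma braided_action_S4_4: "braided S4 action_S4_4"
  unfolding action_S4_4_def[abs_def] by (rule braided_generated) (simp only: braided_eval)

lemma braided_actions: "S \<in> set actions \<Longrightarrow> braided S4 S"
  unfolding actions_eval using
    braided_action_A4C2_1 braided_action_A4C2_2 braided_action_C6C2C2_1 braided_action_C6C2C2_2
    braided_action_S4_1 braided_action_S3C2C2_1 braided_action_A4C2_3 braided_action_S4_2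
    braided_action_A4C2_4 braided_action_C6C2C2_3 braided_action_S3C2C2_2 braided_action_S3C2C2_3
    braided_action_S3C2C2_4 braided_action_S4_3 braided_action_S4_4
  by auto

lemma known_actions_conj: "conj_action g T \<in> known_actions \<longleftrightarrow> T \<in> known_actions"
proof -
  have *: "conj_action g T \<in> known_actions" if "T \<in> known_actions" for g T
    using that unfolding orbit_of_def by (auto simp: conj_action_compose) blast
  show ?thesis
    using *[of T g] *[of "conj_action g T" "s4_inv g"] by (auto simp: conj_action_compose conj_action_one)
qed

section \<open>Squares and their pasting\<close>

text \<open>
  \<open>Sq s x y u\<close> has vertical sides \<open>s\<close>, \<open>u\<close> and horizontal sides \<open>x\<close>, \<open>y\<close>. Holding for \<open>T\<close> means \<open>T s x = y\<close>, while
  \<open>s \<cdot> x = y \<cdot> u\<close> determines the fourth side. It is stored because reflections and pastings need it.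
\<close>

datatype square = Sq s4 s4 s4 s4

definition square_at :: "s4 \<Rightarrow> s4 \<Rightarrow> s4 \<Rightarrow> square" where
  "square_at s x y = Sq s x y (s4_inv y \<cdot> s \<cdot> x)"

primrec holds :: "(s4 \<Rightarrow> s4 \<Rightarrow> s4) \<Rightarrow> square \<Rightarrow> bool" where
  "holds T (Sq s x y u) \<longleftrightarrow> T s x = y \<and> s \<cdot> x = y \<cdot> u"

lemma holds_square_at: "holds T (square_at s x y) \<longleftrightarrow> T s x = y"
  by (simp add: square_at_def mul_assoc)

primrec vflip :: "square \<Rightarrow> square" where
  "vflip (Sq s x y u) = Sq (s4_inv s) y x (s4_inv u)"

primrec hflip :: "square \<Rightarrow> square" where
  "hflip (Sq s x y u) = Sq u (s4_inv x) (s4_inv y) s"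

text \<open>
  This square holds for every braided action. Pasting squares whose sides do not match returns it, so that
  pasting is a total operation that preserves holding.
\<close>

abbreviation trivial_square :: square where
  "trivial_square \<equiv> Sq p1234 p1234 p1234 p1234"

fun vpaste :: "square \<Rightarrow> square \<Rightarrow> square" where
  "vpaste (Sq s x y u) (Sq s' x' y' u') =
    (if x' = y then Sq (s' \<cdot> s) x y' (u' \<cdot> u) else trivial_square)"

fun hpaste :: "square \<Rightarrow> square \<Rightarrow> square" where
  "hpaste (Sq s x y u) (Sq s' x' y' u') =
    (if s' = u then Sq s (x \<cdot> x') (y \<cdot> y') u' else trivial_square)"

context
  fixes T assumes T: "braided S4 T"
begin

lemma braided_T:
  "T p1234 x = x" "T s p1234 = p1234" "T (r \<cdot> s) x = T r (T s x)"
  "T s (x \<cdot> y) = T s x \<cdot> T (s4_inv (T s x) \<cdot> s \<cdot> x) y"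
  using T by (simp_all add: braided_S4_iff)

lemma holds_braid:
  assumes "holds T (Sq s x y u)"
  shows "T s (x \<cdot> z) = y \<cdot> T u z"
proof -
  have y: "T s x = y" and u: "u = s4_inv y \<cdot> s \<cdot> x"
    using assms by (auto simp: mul_assoc)
  show ?thesis
    unfolding u braided_T(4)[of s x z] y ..
qed

lemma holds_vflip: "holds T t \<Longrightarrow> holds T (vflip t)"
proof (cases t)
  case (Sq s x y u)
  assume "holds T t"
  then have y: "T s x = y" and u: "s \<cdot> x = y \<cdot> u" using Sq by auto
  have "T (s4_inv s) y = x"
    using braided_T(3)[of "s4_inv s" s x] y by (simp add: braided_T(1))
  moreover have "s4_inv s \<cdot> y = x \<cdot> s4_inv u"
    by (metis u mul_assoc mul_inv_assoc(1) mul_inv(2) mul_one(2))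
  ultimately show ?thesis using Sq by simp
qed

text \<open>
  The braiding law for \<open>T s (x \<cdot> s4_inv x) = p1234\<close> gives the value of \<open>T u\<close> at \<open>s4_inv x\<close>.
\<close>

lemma holds_hflip: "holds T t \<Longrightarrow> holds T (hflip t)"
proof (cases t)
  case (Sq s x y u)
  assume t: "holds T t"
  then have "y \<cdot> T u (s4_inv x) = p1234"
    using holds_braid[of s x y u "s4_inv x"] Sq by (simp add: braided_T(2))
  then have "T u (s4_inv x) = s4_inv y"
    by (metis mul_inv_assoc(1) mul_one(2))
  moreover have "u \<cdot> s4_inv x = s4_inv y \<cdot> s"
    using t Sq by (metis holds.simps mul_assoc mul_inv(2) mul_inv_assoc(1) mul_one(2))
  ultimately show ?thesis using Sq by simp
qed

lemma holds_trivial: "holds T trivial_square"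
  by (simp add: braided_T)

lemma holds_vpaste: "holds T t \<Longrightarrow> holds T t' \<Longrightarrow> holds T (vpaste t t')"
  by (cases t; cases t') (auto simp: braided_T mul_assoc, metis mul_assoc)

lemma holds_hpaste: "holds T t \<Longrightarrow> holds T t' \<Longrightarrow> holds T (hpaste t t')"
proof (cases t; cases t')
  fix s x y u s' x' y' u'
  assume t: "holds T t" "holds T t'" and Sq: "t = Sq s x y u" "t' = Sq s' x' y' u'"
  show ?thesis
  proof (cases "s' = u")
    case True
    have "T s (x \<cdot> x') = y \<cdot> y'"
      using holds_braid[of s x y u x'] t Sq True by simp
    moreover have "s \<cdot> (x \<cdot> x') = y \<cdot> y' \<cdot> u'"
      using t Sq True by (metis holds.simps mul_assoc)
    ultimately show ?thesis using Sq True by simp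
  qed (use Sq holds_trivial in simp)
qed

end

section \<open>Certificates for cases\<close>

text \<open>
  Terms that describe how a square is obtained from a list of squares: \<open>$i\<close> is entry \<open>i\<close> of the list,
  counted from 0, \<open>V\<close> and \<open>H\<close> reflect in the vertical and in the horizontal direction, \<open>--\<close> and \<open>||\<close> paste
  along a horizontal and along a vertical side.
\<close>

datatype pasting =
    Ref nat ("$_" [1000] 1000)
  | V pasting | H pasting
  | VP pasting pasting (infixl "--" 65)
  | HP pasting pasting (infixl "||" 65)

abbreviation W :: "pasting \<Rightarrow> pasting" where "W d \<equiv> V (H d)"

primrec look :: "square list \<Rightarrow> nat \<Rightarrow> square" where
  "look [] i = trivial_square"
| "look (t # ts) i = (case i of 0 \<Rightarrow> t | Suc j \<Rightarrow> look ts j)"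

primrec realize :: "square list \<Rightarrow> pasting \<Rightarrow> square" where
  "realize ts ($i) = look ts i"
| "realize ts (V d) = vflip (realize ts d)"
| "realize ts (H d) = hflip (realize ts d)"
| "realize ts (d -- d') = vpaste (realize ts d) (realize ts d')"
| "realize ts (d || d') = hpaste (realize ts d) (realize ts d')"

lemma holds_realize:
  assumes "braided S4 T" "\<forall>t\<in>set ts. holds T t"
  shows "holds T (realize ts d)"
proof (induction d)
  case (Ref i)
  have "holds T (look ts i)"
    using assms(2) by (induction ts arbitrary: i)
      (use holds_trivial[OF assms(1)] in \<open>auto split: nat.split\<close>)
  then show ?case by simp
qed (simp_all add: assms holds_vflip holds_hflip holds_vpaste holds_hpaste)

text \<open>
  A square is determined by any vertical side together with any horizontal side. Two squares clash if they
  share a vertical side and exactly one of the two horizontal sides. This relation is invariant under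
  reflection of both squares.
\<close>

fun clash :: "square \<Rightarrow> square \<Rightarrow> bool" where
  "clash (Sq s x y u) (Sq s' x' y' u') \<longleftrightarrow> (s = s' \<or> u = u') \<and> (x = x') \<noteq> (y = y')"

lemma holds_clash:
  assumes T: "braided S4 T" and holds: "holds T t" "holds T t'"
  shows "\<not> clash t t'"
proof (cases t; cases t')
  fix s x y u s' x' y' u'
  assume Sq: "t = Sq s x y u" "t' = Sq s' x' y' u'"
  have "T (s4_inv s) (T s z) = z" for s z
    by (simp add: braided_T(1)[OF T] flip: braided_T(3)[OF T])
  then have inj: "T s z = T s z' \<longleftrightarrow> z = z'" for s z z'
    by metis
  have "x = x' \<longleftrightarrow> y = y'" if "s = s'"
    using holds Sq inj that by auto
  moreover have "T u (s4_inv x) = s4_inv y" "T u' (s4_inv x') = s4_inv y'"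
    using holds_hflip[OF T holds(1)] holds_hflip[OF T holds(2)] Sq by simp_all
  then have "s4_inv x = s4_inv x' \<longleftrightarrow> s4_inv y = s4_inv y'" if "u = u'"
    using inj[of u "s4_inv x" "s4_inv x'"] that by simp
  then have "x = x' \<longleftrightarrow> y = y'" if "u = u'"
    using that by (metis s4_inv_inv)
  ultimately show ?thesis
    using Sq by auto
qed

fun absurd :: "square \<Rightarrow> bool" where
  "absurd (Sq s x y u) \<longleftrightarrow>
    (x = p1234) \<noteq> (y = p1234) \<or> s = p1234 \<and> x \<noteq> y \<or> u = p1234 \<and> x \<noteq> y"

lemma holds_absurd:
  assumes "braided S4 T" "holds T t"
  shows "\<not> absurd t"
proof (cases t)
  case (Sq s x y u)
  have "\<not> clash t (Sq s p1234 p1234 s)"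
    using assms braided_T(2)[OF assms(1)] by (intro holds_clash[OF assms]) simp
  moreover have "x = y" if "u = p1234"
  proof -
    have "T u (s4_inv x) = s4_inv y"
      using holds_hflip[OF assms] Sq by simp
    then have "s4_inv x = s4_inv y"
      by (simp only: that braided_T(1)[OF assms(1)])
    then show ?thesis
      by (metis s4_inv_inv)
  qed
  ultimately show ?thesis
    using Sq assms(2) braided_T(1)[OF assms(1)] by auto
qed

definition refuted :: "square list \<Rightarrow> square \<Rightarrow> bool" where
  "refuted ts t \<longleftrightarrow> absurd t \<or> list_ex (clash t) ts \<or> list_ex (clash (vflip t)) ts \<or>
    list_ex (clash (hflip t)) ts \<or> list_ex (clash (vflip (hflip t))) ts"

lemma holds_refuted:
  assumes "braided S4 T" "\<forall>t\<in>set ts. holds T t" "holds T t"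
  shows "\<not> refuted ts t"
  using assms holds_clash holds_absurd holds_vflip holds_hflip
  by (fastforce simp: refuted_def list_ex_iff)

primrec corner :: "square \<Rightarrow> s4 \<times> s4 \<times> s4" where
  "corner (Sq s x y u) = (s, x, y)"

text \<open>
  A list of values of an action is covered if the classification is known for all braided actions that have these
  values; in particular, if there are no such actions.
\<close>

definition covered :: "(s4 \<times> s4 \<times> s4) list \<Rightarrow> bool" where
  "covered fs \<longleftrightarrow> (\<forall>T. braided S4 T \<and> (\<forall>(s, x, y)\<in>set fs. T s x = y) \<longrightarrow> T \<in> known_actions)"

fun conj_fact :: "s4 \<Rightarrow> s4 \<times> s4 \<times> s4 \<Rightarrow> s4 \<times> s4 \<times> s4" where
  "conj_fact g (s, x, y) = (s4_conj g s, s4_conj g x, s4_conj g y)"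

lemma covered_conj: "covered (map (conj_fact g) fs) \<Longrightarrow> covered fs"
  unfolding covered_def
proof (intro allI impI, elim conjE)
  fix T assume v: "\<forall>T. braided S4 T \<and> (\<forall>(s, x, y)\<in>set (map (conj_fact g) fs). T s x = y) \<longrightarrow> T \<in> known_actions"
    and T: "braided S4 T" and fs: "\<forall>(s, x, y)\<in>set fs. T s x = y"
  have "conj_action g T \<in> known_actions"
    using v braided_conj_action[OF T, of g] fs by (force simp: conj_action_def)
  then show "T \<in> known_actions" by (simp add: known_actions_conj)
qed

text \<open>
  A certificate proves that a list of squares can hold for a braided action only if the action is in
  \<open>known_actions\<close>. \<open>d ;; c\<close> adds the square \<open>d\<close> to the front of the list. \<open>d >< d'\<close> ends a branch by a
  contradiction between two squares, and \<open>Stop d\<close> by one between \<open>d\<close> and a listed or trivially true square.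
  \<open>Use g ds\<close> ends a branch because the conjugates by \<open>g\<close> of the values given by \<open>ds\<close> form a case covered before,
  and \<open>Done S ds\<close> because \<open>ds\<close> gives the values of \<open>S\<close> for the two generators at all nontrivial elements.
  \<open>Cell s x k\<close> branches on the value of \<open>T s x\<close>, and \<open>Fix k\<close> on a nontrivial element that is fixed by the
  three-cycle \<open>p2314\<close>; the new square is put at the front of the list.
\<close>

datatype cert =
    Note pasting cert (infixr ";;" 60)
  | Clash pasting pasting (infix "><" 62)
  | Stop pasting
  | Use s4 "pasting list"
  | Done "s4 \<Rightarrow> s4 \<Rightarrow> s4" "pasting list"
  | Cell s4 s4 "s4 \<Rightarrow> cert"
  | Fix "s4 \<Rightarrow> cert"

primrec check :: "cert \<Rightarrow> square list \<Rightarrow> bool" where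
  "check (d;; c) = (\<lambda>ts. check c (realize ts d # ts))"
| "check (d >< d') = (\<lambda>ts. clash (realize ts d) (realize ts d'))"
| "check (Stop d) = (\<lambda>ts. refuted ts (realize ts d))"
| "check (Use g ds) = (\<lambda>ts. covered (map (\<lambda>d. conj_fact g (corner (realize ts d))) ds))"
| "check (Done S ds) = (\<lambda>ts. S \<in> set actions \<and> map (\<lambda>d. corner (realize ts d)) ds =
    map (\<lambda>x. (p2134, x, S p2134 x)) (tl elems) @ map (\<lambda>x. (p2341, x, S p2341 x)) (tl elems))"
| "check (Cell s x k) = (\<lambda>ts. \<forall>y. check (k y) (square_at s x y # ts))"
| "check (Fix k) = (\<lambda>ts. \<forall>y. y \<noteq> p1234 \<longrightarrow> check (k y) (square_at p2314 y y # ts))"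

lemma order_three_fixed_point:
  assumes "finite A" and "\<And>x. x \<in> A \<Longrightarrow> f x \<in> A" and "\<And>x. x \<in> A \<Longrightarrow> f (f (f x)) = x"
    and "\<And>x. x \<in> A \<Longrightarrow> f x \<noteq> x"
  shows "3 dvd card A"
  using assms
proof (induction A rule: finite_psubset_induct)
  case (psubset A)
  note cl = psubset.prems(1) and f3 = psubset.prems(2) and nf = psubset.prems(3)
  show ?case
  proof (cases "A = {}")
    case False
    then obtain x where x: "x \<in> A" by blast
    define B where "B = {x, f x, f (f x)}"
    have "f (f x) \<noteq> x" using nf[OF x] f3[OF x] by metis
    then have B: "card B = 3" "B \<subseteq> A"
      using x cl nf[OF x] nf[of "f x"] by (auto simp: B_def)
    have "3 dvd card (A - B)"
    proof (rule psubset.IH)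
      show "A - B \<subset> A" using x by (auto simp: B_def)
      show "f y \<in> A - B" if "y \<in> A - B" for y
      proof -
        have "f (f (f y)) = y" using f3 that by blast
        then have "f y \<notin> B" using that f3[OF x] by (auto simp: B_def)
        then show ?thesis using cl that by blast
      qed
    qed (use f3 nf in auto)
    moreover have "card A = card (A - B) + 3"
      using B psubset.hyps card_mono[OF psubset.hyps B(2)] by (simp add: card_Diff_subset finite_subset)
    ultimately show ?thesis by simp
  qed simp
qed

text \<open>
  \<open>T p2314\<close> has order dividing three and permutes the 23 nontrivial elements.
\<close>

lemma fixed_by_three_cycle:
  assumes T: "braided S4 T"
  shows "\<exists>y. y \<noteq> p1234 \<and> T p2314 y = y"
proof (rule ccontr)
  assume *: "\<nexists>y. y \<noteq> p1234 \<and> T p2314 y = y"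
  have T3: "T p2314 (T p2314 (T p2314 x)) = x" for x
  proof -
    have "T p2314 (T p2314 (T p2314 x)) = T (p2314 \<cdot> (p2314 \<cdot> p2314)) x"
      by (simp only: braided_T(3)[OF T])
    also have "p2314 \<cdot> (p2314 \<cdot> p2314) = p1234" by (simp only: s4_eval)
    finally show ?thesis by (simp add: braided_T(1)[OF T])
  qed
  have fin: "finite (UNIV :: s4 set)" by (metis List.finite_set set_elems)
  have "3 dvd card (- {p1234})"
  proof (rule order_three_fixed_point)
    show "T p2314 x \<in> - {p1234}" if "x \<in> - {p1234}" for x
      using that T3[of x] braided_T(2)[OF T] by auto
  qed (use * T3 fin in \<open>auto intro: finite_subset\<close>)
  moreover have "- {p1234} = set (tl elems)"
    using set_elems by (auto simp: elems_def)
  then have "card (- {p1234}) = 23"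
    by (simp add: elems_def)
  ultimately show False by simp
qed

text \<open>
  By induction on the certificate: in every branch the listed squares hold for \<open>T\<close>, and of the alternatives of a
  case distinction the one that is true of \<open>T\<close> is followed.
\<close>

lemma check_sound:
  assumes "check c ts" "braided S4 T" "\<forall>t\<in>set ts. holds T t"
  shows "T \<in> known_actions"
  using assms
proof (induction c arbitrary: ts)
  case (Note d c)
  show ?case
    by (rule Note.IH[of "realize ts d # ts"]) (use Note.prems holds_realize in auto)
next
  case (Clash d d')
  then show ?case using holds_clash holds_realize by auto
next
  case (Stop d)
  then show ?case using holds_refuted holds_realize by auto
next
  case (Use g ds)
  have "covered (map (\<lambda>d. corner (realize ts d)) ds)"
  proof (rule covered_conj)
    show "covered (map (conj_fact g) (map (\<lambda>d. corner (realize ts d)) ds))"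
      using Use.prems(1) by (simp add: comp_def)
  qed
  moreover have "case corner (realize ts d) of (s, x, y) \<Rightarrow> T s x = y" for d
    using holds_realize[OF Use.prems(2,3), of d] by (cases "realize ts d") simp
  ultimately show ?case
    using Use.prems(2) by (force simp: covered_def)
next
  case (Done S ds)
  then have S: "S \<in> set actions" by simp
  have "case corner (realize ts d) of (s, x, y) \<Rightarrow> T s x = y" for d
    using holds_realize[OF Done.prems(2,3), of d] by (cases "realize ts d") simp
  then have facts: "\<forall>(s, x, y)\<in>set (map (\<lambda>d. corner (realize ts d)) ds). T s x = y"
    by auto
  have rows: "map (\<lambda>d. corner (realize ts d)) ds =
      map (\<lambda>x. (p2134, x, S p2134 x)) (tl elems) @ map (\<lambda>x. (p2341, x, S p2341 x)) (tl elems)"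
    using Done.prems(1) by simp
  have *: "T p2134 x = S p2134 x \<and> T p2341 x = S p2341 x" if "x \<in> set (tl elems)" for x
    using facts that unfolding rows by (simp add: ball_Un)
  have S': "braided S4 S" using S by (rule braided_actions)
  have "T p2134 x = S p2134 x \<and> T p2341 x = S p2341 x" for x
  proof (cases "x = p1234")
    case True
    then show ?thesis
      by (simp add: braided_T(2)[OF Done.prems(2)] braided_T(2)[OF S'])
  next
    case False
    then have "x \<in> set (tl elems)"
      using set_elems by (auto simp: elems_def)
    then show ?thesis by (rule *)
  qed
  then have rq: "T p2134 = S p2134" "T p2341 = S p2341"
    by (simp_all add: fun_eq_iff)
  have "T = S"
  proof
    fix s
    show "T s = S s"
      unfolding braided_on_generators[OF Done.prems(2), of s] rq by (rule braided_on_generators[OF S', symmetric])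
  qed
  then show ?case using S action_known by simp
next
  case (Cell s x k)
  show ?case
    by (rule Cell.IH[of "k (T s x)" "square_at s x (T s x) # ts"]) (use Cell.prems holds_square_at in auto)
next
  case (Fix k)
  obtain y where "y \<noteq> p1234" "T p2314 y = y"
    using fixed_by_three_cycle[OF Fix.prems(2)] by blast
  then show ?case
    using Fix.prems by (intro Fix.IH[of "k y" "square_at p2314 y y # ts"]) (auto simp: holds_square_at)
qed

lemma covered_by: "check c (map (\<lambda>(s, x, y). square_at s x y) fs) \<Longrightarrow> covered fs"
  unfolding covered_def by (intro allI impI, elim conjE, rule check_sound) (assumption,
    assumption, fastforce simp: holds_square_at)

lemma look_eval:
  "look (t # ts) 0 = t" "look (t # ts) 1 = look ts 0" "look (t # ts) (numeral k) = look ts (pred_numeral k)"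
  by (simp_all add: numeral_eq_Suc)

lemma actions_member:
  "action_A4C2_1 \<in> set actions" "action_A4C2_2 \<in> set actions" "action_C6C2C2_1 \<in> set actions"
  "action_C6C2C2_2 \<in> set actions" "action_S4_1 \<in> set actions" "action_S3C2C2_1 \<in> set actions"
  "action_A4C2_3 \<in> set actions" "action_S4_2 \<in> set actions" "action_A4C2_4 \<in> set actions"
  "action_C6C2C2_3 \<in> set actions" "action_S3C2C2_2 \<in> set actions" "action_S3C2C2_3 \<in> set actions"
  "action_S3C2C2_4 \<in> set actions" "action_S4_3 \<in> set actions" "action_S4_4 \<in> set actions"
  by (simp_all add: actions_eval)

lemmas check_eval = check.simps realize.simps look_eval pred_numeral_simps BitM.simps numeral_One
  refuted_def list_ex_Nil_iff list_ex_Cons_iff vflip.simps hflip.simps vpaste.simps hpaste.simps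
  square_at_def clash.simps absurd.simps corner.simps
  conj_fact.simps s4_conj_def s4_eval s4.case all_eval list.map list.sel append.simps prod.case
  list.inject prod.inject if_True if_False refl actions_member action_defs on_generators_eval action_rows

section \<open>The case analysis\<close>

text \<open>
  Every statement lists the decisions on which its case rests; the last one starts from nothing. In each
  certificate, a sequence of squares is followed by the values at the two generators, or by the 24
  branches of a case distinction in lexicographic order of the value. A case that occurs in several branches,
  possibly after conjugation, is stated before all of them, so that the evaluation of \<open>Use\<close> finds it
  among the facts \<open>covered_cases\<close>. The first branch of \<open>Fix\<close>, for the identity, is a placeholder.
\<close>

named_theorems covered_cases

lemma covered_1 [covered_cases]: "covered
  [(p2314, p1243, p1243), (p2134, p1243, p1324)]"
  by (rule covered_by[of "
  H$0--$1;; V$0||$0;; $2--$3;; H$3--V$3;; W$4--$5;; V$5--$6;; H$6--$6;; $0--$8;;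
  Cell p1432 p4123 (case_s4 (Stop $0) (Stop $0) (Stop $0) (Stop $0) (Stop $0) (Stop ($7||V$8))
  ((V$8||$0)><($0||H$6)) (Stop $0) ((V$8||$0)><($0||V$5))
  ($10||W$1;; $5||V$2;; V$3--H$3;; $3||$3;; Cell p2134 p3412 (case_s4 (Stop $0) (Stop $0)
   (Stop $0) (Stop $0) (Stop $0) (Stop ($3||H$15)) ((H$0||V$0)><W(H$15||$0))
   ($9||H$4;; V$1||$7;; $6||H$2;; $0||$18;; $13||H$4;; H$5||V$5;; $0||W$10;; V$7--($8--$7);;
    H$7||($0||$19);; H$4||$1;; H$10--V$10;; $0||H$18;; H$19--$20;; H$16--$16;; $0--$26;;
    H$23||V$23;; $0||$3;; V$17--H$17;; $0||$25;; $14||$34;; $9--$21;; $0||$5;; $1||V$9;; $5||$9;;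
    $19--V$22;; $0--H(W$25||$40);; Done action_A4C2_1 [$41, V$41, V$30, $30, H$25, $24, V$26, $23,
    $22, W$21, H$19, V$23, V$24, V$22, W$19, $26, H$21, H$25||$18, $17, V$17, V$16, $16,
    ($33||$14)--V$20, H$34, V$13, W$11, $10, $9, H($7--($38||$31)), V($20--($6--H$26)), W$4,
    V((H$12||$7)--$31), H$3, W($2--($39||V$31)), W($11||V$5), $3, $9||V$5, $4, $5, $5||H$34,
    ($14||$2)--$31, $0||V$34, H(H$26||$30)--(($21||V$41)--V$23), ($20||W$35)--$1, $0,
    $20--($6--$26)])
   (($0||V(H$15||V$15))><W(H$0||V$0)) ((W$0||($0||$14))><H($0||V$2)) ((V$0--H$0)><(W$15||$0))
   (($1--$0)><($0--($13||V$5))) (Stop $0) ((V$0--H$0)><V(W$15||$0))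
   (((H$0--V$0)--$1)><W((H$0--V$0)--H$0)) (((V$0--H$0)--W($13||$5))><(H$15||($0||V$11)))
   ($11||H$0;; $2--H$1;; H$1||(H$2--$0);; H$3||$7;; W$3||($15||$0);; V$16||$1;; H$5||$0;;
    W$6||($6||V$22);; $8--$6;; $0||W$24;; H$9||V$9;; W$22||$10;; H$19--$20;; (H$16--$16)--$25;;
    H$22||V$22;; $0||$2;; H$16--$16;; $0--$18;; $0||W$26;; $1||$6;; $2||V$5;; $26--$15;;
    ($4--$5)||$30;; Done action_A4C2_2 [$38, V$38, V$27, $27, H($32||H$27), $20, $18, V$16, $15,
    H$13, V$12, W$11, W$22, H((V$34||H$34)||V$22), H$11, $23, H$22, V$15, $12, $16, V$20, W$13,
    V$18, H$31, V$10, W$9, $8, $7, $8||$4, V($10||$3), H$2, W$17--$1, W$3, V($10||$4), W($9||$5),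
    V$3, $7||$5, V$2, V$5, V$4, V($15--$1), V(W$31||$0), H(V($21||($27--V$26))--($14||W$26)),
    V($3||$5), H$0, H$31||$0])
   (Stop $0)
   ($9||H$4;; H$1||V$1;; $0--$7;; $0||V$6;; $1||$13;; V$8--$9;; $6||$0;; V$13--$15;; $8||$0;;
    $10--$9;; $0||$9;; V$11||($15--V$14);; $26||W$12;; H$20--$21;; H$22||V$22;; W$15||$19;;
    $14||H$30;; $31||$1;; H$18||$22;; V$33||$0;; H$20||$35;; V$8||H$8;; W$22||$37;; $10||$38;;
    Done action_C6C2C2_1 [$39, V$39, V$28, $28, H$23, V$20, $21||$23, $19, $21, $20, V$19, $17, $15,
    H$13, V$12, $24, W$11, V$24, H$11, V$15, V$17, $12, W$13, H$32, V$10, W((H$27--$27)--$36), $9,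
    $9||$10, H$8--$7, H($6--V$22), V((W$14||$5)--$4), H(V$22--(H$18||$3)), $2--W$5, W($4--$7),
    H$1--$2, H($0--V$7), H((H$16||$7)--V$14), V(($3--$11)--$12), V(W$32||($7--W$3)),
    W((V$22||$16)--$11), (H$5||$16)--H$24, V(W($14||V$33)--$0), V($1--W$5), $4--W$8,
    H(($14||$33)--H$5), V(H$6--($11||V$39))])
   ((V$0--($1--$0))><H((H$0||V$0)||W$3)) (($0||V((H$8||V$8)||(H$7--$8)))><V(W$15||$0))
   (((H$0||V$0)--H(W$15||$0))><H($0||$2)) (Stop (W$15||$0))
   ($9||H$4;; V$1||$1;; $0||$17;; $1||V$7;; V$4||$8;; V$5||$20;; $6||$10;; $0||H$16;; $8||$23;;
    H$16--$17;; H$18||V$18;; $12--$11;; V$0||(V$18--$20);; (H$28||$4)--V$13;; H$29||$8;;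
    W$10--((W$30||$6)--$8);; W$31||$9;; W$10||$8;; V$12--(H$9--V$9);; $11--$24;; $20--$6;;
    W$15--($9||H$35);; Done action_C6C2C2_2 [$37, V$37, V$26, $26, H$21, $19, $20, V$18, H($21||$20),
    V$19, $18, V$17, V$16, $14, $15, $22, $13, V$14, $17, V$15, V$13, $16, V$22, H$30, V$12,
    W((H$25--$25)--$34), $11, $11||$12, W($9--W$19), V($8--$7), $6, V(($27--$5)--W$4), H$3,
    W((($35||V$27)--$17)--W$18), V(($10||($26--V$25))--H$18), $3, $2--H$4, W$6, $1, $1||H$30,
    H$5--$2, V($0||$30), H(W$15--(V$10||(V$25--$26))), $9--(H$37||$17), V$0, V$10--$7])))
  (($0||$6)><(V$0||H$0)) (($0||$5)><W(H$0||V$0)) (Stop ($8||$0)) (($8||$0)><V($0||V$4))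
  (($8||$0)><V($0||H$3)) ((V$8||$0)><($0||H$9)) (Stop (H$0||V$0)) (($0||$1)><(V$8||$0))
  (($8||$0)><V($0||$3)) (Stop ($8||$0)) ((V$8||$0)><($0||$9)) (($0||H$1)><(V$8||$0))
  ((V$8||$0)><($0||H$4)) ((V$8||$0)><($0||$2)))"])
    (simp only: check_eval covered_cases)

lemma covered_2 [covered_cases]: "covered
  [(p2314, p1243, p1243), (p2134, p1243, p2134), (p2143, p3412, p3412), (p3124, p3412, p3412),
  (p3124, p1324, p1324), (p1432, p1324, p1324)]"
  by (rule covered_by[of "
  H$5--$5;; V$5--$6;; $1--W$0;; H$3--$4;; ($9--V$8)||W$0;; $10||H$6;; $1||V$0;; H$3||$1;;
  V$9||H$9;; W$5||$3;; $5||$4;; (H$12||V$12)||H$16;; $14--$15;; ((V$13--$14)||W$9)||$7;;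
  V$8||H$8;; $0--$2;; $17||$0;; $17--$18;; H$18--$18;; $0--$20;; $0||V$18;; ($20--H$26)||$3;;
  W$22--$23;; H$5||V$5;; ($22--$28)||$1;; $13--V($29||V$28);; $7--H$27;; $0||$25;; $13--$30;;
  Done action_S4_1 [$30, $26, W$22, H$23, H$21, V$30, $20, W$23, W$19, $20||$26, W$18, H$22,
  H($17--($28||$16)), W$21, W$15, H$13, V$12, H$19, H$15, H$18, H(W$24||$19), $12, H($13||$20),
  H$11, W$27, H$8, H$7, W$27||$8, W$6, $5, W$4, W$6||$4, $3, $3||$2, W$1,
  W((($27--H$34)||$31)--$17), V(H$27||$1), W(H($27||W$11)||$1), $0, $0||H$11, V(W$11||$7),
  H(W($27||H$6)||$8), $3||V$9, $0||$3, $0||W$6, $0||$5]"])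
    (simp only: check_eval covered_cases)

lemma covered_3 [covered_cases]: "covered
  [(p2314, p1243, p1243), (p2134, p1243, p2134)]"
  by (rule covered_by[of "
  H$1--V$1;; W$1--$2;; V$3--H$3;; V$3--H$3;; $4--$5;; H$5--V$5;; Cell p2143 p3412 (case_s4
  (Stop $0) (Stop $0) (($6||$0)><($0||V$5)) (($4||$0)><($0||$3)) (($4||$0)><($0||H$7))
  (($6||$0)><($0||W$5)) (Stop $0) (Stop ($4||$6)) (($4||$0)><($0||V$3)) (Stop (H$0||V$0))
  (($6||$0)><($0||W(V$7--$8))) (($4||$0)><($0||$7)) (($4||$0)><($0||W$7))
  (($6||$0)><($0||W(H$7--$8))) (($6||$0)><($0||W$2)) (($4||$0)><($0||V$7))
  (V$2--H$2;; $0||W$8;; W$4--$7;; V$8--H$8;; H$6||V$6;; $6--$7;; Cell p3124 p3412 (case_s4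
   (Stop $0) (Stop $0) (($0||(V$9--$10))><(W$14||$0)) (($0||((V$9--$12)||H($10--V$8)))><($5||$0))
   ((($7--$0)||$14)><H($0||W$4)) (((V$0--H$0)||W($0||V$12))><H(V$3||($0||($12||W$9)))) (Stop $0)
   (Stop $0) ((($7--$0)||W$14)><H($0||$4)) ((V$3||($0||$9))><H(H$0--(V$0||H$0)))
   (($5||$0)><($0||(H$15||V$15))) (Stop $0) (($0||($2--$2))><($5||$0))
   (($0||V($14--H$9))><(W$14||$0)) ((($0||(H$1||V$1))||W(W$14||$0))><(V($0||H$1)--(V$3||$0)))
   (($0||V$3)><H($0||$14))
   ($2--$5;; $4||V$1;; Cell p3124 p1324 (case_s4 (Stop $0) (Stop $0)
    (V$0||$3;; V$9||$0;; $2--$0;; Cell p1432 p1324 (case_s4 (Stop $0) (Stop $0)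
     (Use p1234 [$21, $22, $14, $7, $4, $0]) (Stop $0) (Stop (V$4--$2)) ((H$0||V$0)><W(W$8||$0))
     (Stop $0) (Stop ($12--$6)) (Stop $0) ((V$0--H$0)><V(H$21||(V$4||$5))) (($0||V$6)><W(V$4--$0))
     (Stop ($2--$4)) (Stop $0) ((V$0--H$0)><H(($12||$4)--V$3)) ((W$8||$0)><W(H$8||$0)) (Stop $0)
     (Stop $0) ((V$4--$0)><H($0--V$5)) ((V$0--H$0)><W(($11||H$7)||H($10||V$4))) (Stop $0)
     (Stop $0)
     (Use p1243 [H$21, $22, ($6--$6)||$14, V($12||$7), W$21||($4||$21), H((($10||$3)--(H$8||$0))||H$16)])
     ((V$0--H$0)><(H$5--($12||$5))) (Stop $0)))
    (($0--($0||H$4))><V($0||H($7--W$4))) (($0||$2)><(H$3||$0)) (($0||($5--$5))><(H$3||$0))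
    (Stop $0) (Stop $0) (($0||(V$18||H$18))><(H$3||$0)) (($8||$0)><($0||$10)) (Stop ($0||V$8))
    (((V$0--H$0)||V$4)><W(H$3||($0||W$4))) ((V$0||H$0)><(V$6||$0)) ((V$0--H$0)><(H$3||$0))
    (Stop $0) ((H$3||$0)><V(V$6||$0)) (Stop $0) (Stop $0) (($0||(V$8--H$8))><(H$3||$0))
    (($0||V$2)><(H$3||$0)) ((W$0||(V$6||$0))><H(H$1||$0)) (($0||W($8||$3))><W(V$0--H$0))
    (Stop ($7||H$3)) (Stop (W$8||(H$3--$3)))))
   ((H$0--(W$14||$0))><W($0||W($12--$11))) (((V$0--H$0)||(V$0--H$0))><H((W$14||$0)||W$1))
   (($0||V$6)><H($0||W$14)) (Stop $0) (($5||$0)><($0||(V$15||H$15)))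
   ((($0||H$12)--$0)><V($0||V$2)) (Stop (($0||H$5)--$0))))
  (Stop ($0||$8)) (Stop (H$0||V$0)) (($4||$0)><($0||V$1)) (($4||$0)><($0||$1))
  (($6||$0)><($0||V$2)) (Stop ($0||H$8)) (Stop $0))"])
    (simp only: check_eval covered_cases)

lemma covered_4 [covered_cases]: "covered
  [(p2314, p1243, p1243), (p2134, p1243, p1243), (p1243, p2143, p2143), (p2134, p2143, p2143),
  (p3412, p2143, p2134), (p2314, p2143, p4312)]"
  by (rule covered_by[of "
  W$4--$5;; H$1||$6;; W$1--$0;; $5--$7;; W$9--$0;; $9--$3;; H$6--V$6;; $9--$12;;
  Cell p2314 p1432 (case_s4 (Stop $0) (Stop $0) (((H$9||$0)||W$0)><(H$0--V$0))
  (($6||($0||H$13))><W((H$9||$0)--H$0)) (Stop (($0||($10--$9))--$0))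
  (Use p1324 [V$0, H((H$14||$0)||W(($12--$14)||V(V$9--H$9)))]) (Stop $0) (Stop $0)
  (($0||V($8||($9--$10)))><(H$14||$0)) (($0||V((V$13--$14)||V$2))><(H$14||$0)) (Stop $0)
  ((H$14||$0)><V($0||$11)) (($6||$0)><(V$0--H$0)) (($0||W((V$14--$5)--$7))><(V$3||$0))
  (($0||H(H$14||$4))><(V$3||$0)) (($0||$6)><(V$3||$0)) (Stop $0) (Stop ($3||V$14))
  (Stop ($0||V$14)) (($0||V$1)><W(H$9||$0)) (Stop (H$14||$0)) (($0||($2--H$9))><V(H$14||$0))
  (Stop $0) (Stop ($1||H$9)))"])
    (simp only: check_eval covered_cases)

lemma covered_5 [covered_cases]: "covered
  [(p2314, p1243, p1243), (p2134, p1243, p1243), (p1243, p2143, p2143), (p2134, p2143, p2143),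
  (p3412, p2143, p2143), (p2134, p3412, p4321), (p2143, p4321, p4321), (p3412, p4321, p4321),
  (p2341, p1324, p1324)]"
  by (rule covered_by[of "
  ($8--$8)--H$8;; $2--$1;; $1||$0;; $4||$2;; $7||$5;; $8||$4;; $11||$5;; $0||$5;; $13||$9;;
  $0||$6;; $1||$9;; (H$11--V$11)--$12;; (H$12--$12)--$13;; $0||W$21;; (V$22--(H$22--$22))||V$2;;
  $3||$23;; $23--($22--V$21);; $0||W$25;; V$26||$0;; ($23--$21)||W$27;; ($27--V$25)||H$28;;
  Done action_S3C2C2_1 [$22, $20, $18, $17, $17||$19, $16, $24, $16||$20, $16||$18, $15, $15||$19,
  $13, $14, $11, $10, $26, $12, V$11, V$10, V$13, V$14, V$12, V$26, H$9, $29, W$7, W$6, $29||$7,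
  W(V$5||$3), V$2, W($6||$2), W$7||$3, W$3, W(V$4||$7), W($8||$1), W$1, W$1||$7, W$7||($1||W$9),
  V(V$29||$1), H($5||V$1), H$0||$7, V(H$7||($0||H$9)), H(V$8||$0), H$0, H($5||$0), $29||$0]"])
    (simp only: check_eval covered_cases)

lemma covered_6 [covered_cases]: "covered
  [(p2314, p1243, p1243), (p2134, p1243, p1243), (p1243, p2143, p2143), (p2134, p2143, p2143),
  (p3412, p2143, p2143), (p2134, p3412, p4321), (p2143, p4321, p4321), (p3412, p4321, p4321),
  (p2341, p1324, p4123)]"
  by (rule covered_by[of "
  H$0--$0;; H$1--V$1;; $0--$3;; V$11||$0;; V$12--H$12;; V$1||$1;; $3||$14;; V$15||$0;;
  ($13--(($0--($11||$9))||(V$8--H$8)))||W$16;; $16||$8;; Cell p3412 p4123 (case_s4 (Stop $0)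
  (Stop $0) (Stop ($0--$19)) (Stop ($19--$0)) ((W$19||($19--$0))><H($6||V$11))
  ((($19--$0)||W$19)><(($5--$18)||$7)) (Stop ($15||$10)) (Stop $0) (Stop (V$6--$2)) (Stop $0)
  (($19--$0)><H($4||V$8)) (Stop ($19--$0)) (Stop $0) (Stop ($19--$2))
  ($19--$0;; $7--H$1;; $1--V$0;; $19||$15;; V$6--$2;; $1||$0;; $20||$18;; $0||$2;; $26||V$8;;
   (V$11--$15)--$0;; $22||$5;; $16||W$13;; $10--V$0;; $8||V($21--$22);; H$14--V$14;; W$17--$0;;
   Done action_A4C2_3 [$28, $13, V$10, $8, W$6, $9, $30, $5, H$3, $11, $2, V$8, H$6, V$11, V$2, $32,
   $12, V$13, $10, V$5, W$3, V$12, V$32, H$24, $35, V$23, H($0||W$19), V(W$18--$7), V$19, $21,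
   H($0||$24), H$23||$15, V$19||$20, H$23, V(H$18||$24), W$18, V$15, V($15||(H$24--$25)),
   $35||V$18, H($20||V$18), V($4--V$16), V(V$35||(H$35--$1)), V($19||V$18), $4, $17--$19,
   V($31--$21)])
  (((W$19||($19--$0))--H$0)><($9||(V$6--$0))) (Stop ($18||$15)) (Stop (($18--$17)||H$10))
  (Use p3124 [H(V(($16||$12)--$3)||(($0--$6)||H$11)), H(V$5||($19--$0))])
  (((H$1||$0)--H($19--$0))><V((V$6--$0)--$7)) (Stop $0) (Stop (((V$4||$4)--V($15--$13))||$6))
  (Stop $0) (Stop $0))"])
    (simp only: check_eval covered_cases)

lemma covered_7 [covered_cases]: "covered
  [(p2314, p1243, p1243)]"
  by (rule covered_by[of "
  H$0--V$0;; V$1--H$1;; H$2--$2;; Cell p2134 p1243 (case_s4 (Stop $0)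
  ($1--$0;; $0--$2;; $4--$2;; $7--$3;; $4--$8;; Cell p1243 p2143 (case_s4 (Stop $0) (Stop $0)
   (($4||$0)><($0||V$10)) (($4||$0)><($0||H$3)) (($4||$0)><($0||$3)) (($4||$0)><($0||W$10))
   (Stop $0)
   (Cell p2134 p2143 (case_s4 (Stop $0) (Stop $0) (($7||$0)><($0||V$10)) (($7||$0)><($0||H$3))
    (($7||$0)><($0||$3)) (($7||$0)><($0||$10))
    (Cell p3412 p2143 (case_s4 (Stop $0) (Stop $0) ((H$9||$0)><(W$1--$0)) ((H$9||$0)><(W$1--$0))
     ((H$9||$0)><(W$1--$0)) ((H$9||$0)><(W$1--$0)) (($0--V$1)><($2--$0)) (($0--$1)><V($0--$2))
     ((H$9||$0)><(W$1--$0)) ((H$9||$0)><(W$1--$0)) ((H$9||$0)><(W$1--$0)) ((H$9||$0)><(W$1--$0))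
     ((H$9||$0)><(W$1--$0)) ((H$9||$0)><(W$1--$0)) ((H$9||$0)><(W$1--$0)) ((H$9||$0)><(W$1--$0))
     (Stop $0) (Stop $0) ((H$9||$0)><(W$1--$0)) ((H$9||$0)><(W$1--$0)) ((H$9||$0)><(W$1--$0))
     ((H$9||$0)><(W$1--$0)) (Stop $0) (Stop $0)))
    ($1--$0;; Cell p3412 p2143 (case_s4 (Stop $0) (Stop $0) (($1--$0)><H(H$0--V$0))
     ((($2--$0)||W$6)><(V$8||($3--$0))) ((($2--$0)||H$4)><(V$8||($3--$0))) (Stop (H$0--V$0))
     ($1--$0;; Cell p2314 p2143 (case_s4 (Stop $0) (Stop $0)
      (((V$0--H$0)||(H$6||($4--$0)))><(H$6||(($4--$0)||$13))) (((V$0--H$0)||V($3--$0))><W($3--$0))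
      (Stop $0) (Stop $0) (Stop ($0--V$2)) (Stop ($0--$2)) (Stop $0) (Stop $0)
      (($0||H$8)><H(V$2--$0)) ((H$15||$0)><H(W$2--$0)) (($0||V$14)><H(V$2--$0))
      ((H$15||$0)><H(W$2--$0)) (Stop $0) (Stop $0) (Stop (V$2--$0)) (($0||$7)><H(W$2--$0))
      (Stop $0) (Stop $0) (((V$0--H$0)||H(W$2--$0))><(V$2--$0))
      (((V$0--($5--$0))||H($0||$6))><H(H$15||($0||$6))) (Use p1234 [$15, $11, $5, $4, $2, $0])
      (Use p2134 [V$15, $11, $5, $4, $1, H(H$2--($0||$15))])))
     ($9||$2;; Cell p2134 p3412 (case_s4 (Stop $0) (Stop $0) (($1||$0)><($0||H$15))
      (($1||$0)><($0||W$8)) ((V$0||H$0)><V($4||$0)) (($1||$0)><($0||$13)) (Stop $0) (Stop $0)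
      (($1||$0)><($0||V$8)) (($1||$0)><($0||$15)) (($1||$0)><($0||V$13)) (($1||$0)><($0||$6))
      (($1||$0)><($0||H$7)) (($1||$0)><($0||V$14)) (($1||$0)><($0||$14)) ((V$0||H$0)><V($4||$0))
      ($4--$2;; $5||$1;; Cell p2134 p1324 (case_s4 (Stop $0) (Stop $0)
       ($0||$9;; $15||$1;; $16||$1;; $7||$3;; $0||$13;; $12||$5;; $0||$15;; H$7||$1;; $0--H$11;;
        H$12--$0;; H$9||$7;; $0--$11;; $12--$0;; $3||$23;; $13||$4;; $14||$1;; $20||$17;;
        H$17--$17;; $7--V$0;; H$18||$17;; V($2||$38)--$0;; $13--(H$24--$24);; $0||H$33;;
        $26--$14;; H$24||$27;; $19--$0;; $0||V$42;; ($0||V$18)--H(H$36||$2);; W$39||$0;;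
        (($11--$17)||$35)--H$4;; H$30||$31;; H$0--$0;; $0||V$48;; $9||$44;; Done action_S4_2 [$48,
        $34, $33, $32, $31, $38, $41, $30, $29, $28, $27, $27||$24, H($21||H$37), $31||$24,
        $31||$20, $37, $38||$37, $29||$24, $29||$20, $19, $18, $17, $35, W$45, W$15, $13,
        H(H$32--($14--$33)), V(H$31--((H$34||$32)--$31)), V($11||V$10), ($21||H$9)--$40, H$6, H$5,
        H$4, H($47||$4), $13||$36, W($36||$15), (H$17||$33)--($7||W$8), H($1--$19), V$12, V$11,
        $5, W((H$34--$22)||$0), $19--$1, $18--$2, W$0, $35--((H$33||$27)--H$35)])
       (((H$0||($14||$0))--$0)><V($14||$0)) ((H$3||$0)><($0||$5)) (($0||$2)><(H$3||$0)) (Stop $0)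
       (Stop $0) (Stop $0) (($0||H$3)><H($0||$8))
       (((H$0--(H$3||$0))--W(H$3||$0))><(H($0||H$10)||($14||($0||H$10))))
       (((H$0||($14||$0))--H$0)><W($4||$0)) (((V$0--H$0)--($4||$0))><(W$0||($4||$0)))
       (((H$1||$0)--V(V$0--H$0))><W((V$0--H$0)--($7||$0))) (($0||$3)><H($0||$7))
       ((H$3||$0)><($0||$6)) (Stop $0) (Stop ($4||$3)) (($0||V$2)><(H$3||$0))
       (($14||$0)><V(H$3||$0)) (((H$0||($4||$0))--$0)><V($14||$0))
       (Use p1342 [V(H$0--(H$1||$0)), W((H$1||$0)--(H$0--V$0))]) (Stop ($14||$3)) (Stop $0)))
      (Stop $0) (($1||$0)><($0||W$15)) (($1||$0)><($0||$8)) (($1||$0)><($0||H$8))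
      (($1||$0)><($0||V$15))
      ($2||$12;; Cell p4321 p3412 (case_s4 (Stop $0) (Stop $0) (Stop (H$0--V$0))
       (($1||$0)><(W$2--$0)) (($1||$0)><(W$2--$0)) (($1||$0)><(W$2--$0)) (Stop $0) (Stop ($5--$4))
       (($1||$0)><(W$2--$0)) (Stop (H$0||V$0)) (($1||$0)><(W$2--$0)) (($1||$0)><(W$2--$0))
       (($1||$0)><(W$2--$0)) (($1||$0)><(W$2--$0)) (($1||$0)><(W$2--$0)) (($1||$0)><(W$2--$0))
       (($0||H$1)><V($0--$2)) (($0||V($6--$4))><H(W$2--$0)) (Stop (H$0||V$0))
       (($1||$0)><(W$2--$0)) (($1||$0)><(W$2--$0)) (Stop (H$0--V$0)) (Stop ($0--V$2))
       (Stop (V$2--$0))))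
      ($8--$7;; $0||$4;; Cell p2143 p4321 (case_s4 (Stop $0) (Stop $0) (($1||$0)><($0||V$11))
       (($1||$0)><($0||$18)) (($1||$0)><($0||V$16)) ((H$0||V$0)><W($6||$0)) (Stop $0) (Stop $0)
       (($1||$0)><($0||H$18)) (($1||$0)><($0||W$11)) (Stop (H$0||V$0)) (($1||$0)><($0||$16))
       (($1||$0)><($0||$17)) (Stop (H$0||V$0)) ((H$0||V$0)><W($6||$0)) (($1||$0)><($0||V$17))
       (Stop $0)
       (Cell p3412 p4321 (case_s4 (Stop $0) (Stop $0) ((H$16||$0)><(V$1--$0))
        ((H$16||$0)><(V$1--$0)) ((H$16||$0)><(V$1--$0)) ((H$16||$0)><(V$1--$0)) (Stop ($6||$16))
        (Stop $0) ((H$16||$0)><(V$1--$0)) ((H$16||$0)><(V$1--$0)) ((H$16||$0)><(V$1--$0))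
        ((H$16||$0)><(V$1--$0)) ((H$16||$0)><(V$1--$0)) ((H$16||$0)><(V$1--$0))
        ((H$16||$0)><(V$1--$0)) ((H$16||$0)><(V$1--$0)) (Stop (W$1--$0)) (($0||$14)><H(V$1--$0))
        ((H$16||$0)><(V$1--$0)) ((H$16||$0)><(V$1--$0)) ((H$16||$0)><(V$1--$0))
        ((H$16||$0)><(V$1--$0)) (Stop ($0--W$1)) (($0||$16)><V($0--H$1))))
       (($1||$0)><($0||H$11)) (($1||$0)><($0||V$18)) (($1||$0)><($0||W$18)) (($1||$0)><($0||$11))
       (Stop $0)
       ($5||$15;; Cell p3412 p4321 (case_s4 (Stop $0) (Stop $0) ((H$0--V$0)><H($2--$0))
        ((($2--$0)||$19)><(H$1||$0)) ((($2--$0)||V$19)><(H$1||$0)) (Stop (H$0--V$0)) (Stop $0)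
        (Stop $0) ((($2--$0)||V$20)><(H$1||$0)) ((V$0||H$0)><V($7||$0)) (Stop (H$0||V$0))
        ((($2--$0)||W$20)><(H$1||$0)) ((($2--$0)||$20)><(H$1||$0)) (Stop (H$0||V$0))
        (Stop (H$0--V$0)) ((($2--$0)||V$18)><(H$1||$0))
        ($0--$5;; Cell p2314 p4321 (case_s4 (Stop $0) (Stop $0)
         ((V$22||((W$2--$0)||W$15))><H((V$0--H$0)||H($0||H$15))) (Stop ((V$0--H$0)||V$0))
         (Stop $0) (Stop $0) ((V$2--$0)><($0--$5)) ((V$2--$0)><($0--$10)) (Stop $0) (Stop $0)
         (((W$2--$0)||W$0)><H(V$1--$0)) ((($0||H$22)||$0)><V(V$22||(W$2--$0)))
         ((($0||V$20)||W$0)><H(($4--$0)||H$22)) ((V$0||H$0)><W($7--$0)) (Stop $0) (Stop $0)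
         (($0--V$2)><H($4--$0)) ((H$22||$0)><V(W$2--$0)) (Stop ($7--$4)) (Stop $0)
         (((V$0--H$0)||H(V$2--$0))><(W$2--$0))
         (((V$0--($4--$0))||(H$2||V$2))><H((V$0--($4--$0))||W$2)) ((H$22||$0)><V(W$2--$0))
         (($0--$2)><H($4--$0))))
        ($2--$0;; $6--$3;; Cell p1432 p4321 (case_s4 (Stop $0) (Stop $0) (Stop (V$3--$0))
         (($0||H$14)><H(V$3--$0)) (Stop $0) (Stop $0) ((V$3--$0)><($0--$4)) ((V$3--$0)><($0--$10))
         (Stop $0) (Stop $0) (($1--$0)><(H$0||V$0)) ((($0||$15)||V$0)><H($0||$15))
         ((W$0||($0||$16))><V($16||($5--$0))) ((H$0||V$0)><($8--$0)) (Stop $0) (Stop $0)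
         (($15||$0)><V(W$3--$0)) (Stop ($0--V$3)) (Stop $0) (Stop $0) (($15||$0)><H(W$3--$0))
         ((V$3--$0)><H($8--$0)) (Stop ($0--W$3)) (Stop ($0--$3))))
        ((V$0||H$0)><V($7||$0)) ((($2--$0)||H$20)><(H$1||$0)) ((($2--$0)||$18)><(H$1||$0))
        ((H$0--V$0)><H($2--$0))
        ($5--$0;; Cell p3412 p1324 (case_s4 (Stop $0) (Stop $0) ((W$2||$0)><($0||$4))
         ((W$2||$0)><($0||V$7)) ((V$0--H$0)><W(H$19||$0)) ((H$19||($0||V$22))><W(V$0--H$0))
         (Stop $0) (Stop $0) ((V$0--H$0)><W(H$3||$0)) ((H$3||($0||H$22))><W(V$0--H$0))
         ((H$0||V$0)><W(H$2||$19)) (Stop ($0||W$2)) (($0||V(V$2--H$2))><V(W$2||$0)) (Stop $0)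
         ((W$2||$0)><V($0||V$21)) (Stop (W$2||$0)) (Stop $0) (Stop $0) ((H$2||$0)><V($0||V$20))
         ((W$2||$0)><V($9||$0)) (($0||H$2)><V($0||V$17)) (($0||V$2)><V($0||$19)) (Stop $0)
         (Stop $0)))
        (($2--$0)--V$5;; $1||$18;; Cell p2341 p1324 (case_s4 (Stop $0) (Stop $0)
         (Use p1234 [$23, $19, $13, $12, $10, $8, $5, $3, $0]) (($0--($0||H$20))><W($0||H$20))
         (Stop ((V$16||$0)--$0)) (Use p1342 [$0--(V$16||($0||H$14)), H$0])
         (((($0--$9)--W$0)||H($0||H$15))><H(V$16||($0||H$15)))
         (((($0--$10)--W$0)||(V$16||$0))><($16||(($0--$10)||V$23)))
         ($16||V$0;; $23||W$1;; V$2--H$2;; $12||$11;; Cell p2134 p2314 (case_s4 (Stop $0)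
          (Stop $0) (Stop $0) (Stop ($5--$0)) (Stop ($0--V$3)) (Stop $0) (Stop $0) (Stop $0)
          ((($5--$0)||V$7)><W($4||V$27)) (Stop (($5--$0)||H$9)) ((($5--$0)--$4)><(W$0||($0||$25)))
          ((W$3||($5--$0))><W(V$5--($14||$0))) (Stop ($0--W$5)) ((H$0||V$0)><W($0||$12))
          (($13||$0)><V($0||V$28)) (Stop ($0||V$5)) (Stop $0) (Stop $0) (Stop ($5--$0))
          (Stop ($5||$3)) ((W$3||($5--$0))><H(($0||V$7)--W$5))
          ((W$3||($5--$0))><H(($0||H$6)--W$5)) (Stop $0) (Stop $0)))
         ($16||V$0;; V$1||H$1;; V$2--H$2;; ($1||W$19)--V$0;; Cell p1324 p2341 (case_s4 (Stop $0)
          (Stop $0) (Stop $0) (Stop $0) (Stop ($0||H$9)) (Stop ($0||V$7)) (($5--$0)><H($0--$14))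
          (($5--$0)><H($0--$16)) (Stop ($0||$10)) (Stop ($0||$13))
          (Use p2143 [W$28, $24, $18, $17, $15, $13, $10, $8, H(V$4||$0)])
          (((H$20||$0)--$0)><V($1--$0)) ((H$0||V$0)><W($0||V$27))
          (Use p3142 [H((V$13--(V$5||$0))||$2), W(V$4||$0)]) (Stop $0) (Stop $0)
          (Stop ((V$3--$4)||W$28)) (Stop $0) (Stop $0) (Stop $0) ((V$4||$0)><V($0||V$26))
          (($5||$0)><V(H$20||$0)) (($5--$0)><($11||$10)) (Stop ($0--V$13))))
         (Stop ($0||($8--$5))) (Stop $0) ((V$0--H$0)><($0||$4))
         (Use p2143 [W$23, $19, $13, $12, $10, $8, $5, $3, V($0||$2)])
         (H$0--V$0;; V$1||$17;; $1||$24;; Cell p3412 p1324 (case_s4 (Stop $0) (Stop $0)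
          (Use p2431 [V($0--$3), H($0--$4)]) (Stop ($3--H$4)) (Stop $0)
          (($0--($26||$1))><W(V$0--H$0)) (Stop $0) (Stop $0) (Stop $0)
          ((H$8||($0||H$27))><W(V$0--H$0))
          (V$3--$4;; $3--$2;; $25||$0;; $1||$19;; $2||$17;; $3||$17;; $19||$18;; V$9||$11;;
           V$8--$12;; $0||W$13;; $1||$30;; H$13||$0;; $14--V$13;; Done action_A4C2_4 [$36, $12, V$11,
           W$11, V$10, $26, $29, $9, $8, W$8, V$7, V$9, V$8, V$12, $11, $25, $6, H$8, $7, H$11,
           $10, V$6, V$25, W$33, $17, V$15, W$15, $5, W(W$17||$3), V(H$15||$3), W$3, W($33||$3),
           V(H$15||$4), V$1, V$3, V($4||$0), V$4, V$2, $5||W$4, V($4||H$0), W(W$17||$2), W$1, W$2,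
           W($33||$2), V($15||$4), V($15||$2)])
          ((H(W$4--$0)||V(W$4--$0))><H((W$4--$0)||$1)) (($4--(V$0||H$0))><V(V$4--$0)) (Stop $0)
          (Stop $0) (Stop (V$4--$0)) (Stop ($8||H$5)) (Stop ($7||$8)) (($14||$0)><W(V$4--H$4))
          ((H$24||$0)><V($7||$0)) (Stop (V$4--$0)) ((W$4--$0)><V(($20||V$4)||$20)) (Stop $0)
          (Stop $0)))
         ((((H$0--($14||((V$0--H$0)||H$14)))--(V$0--H$0))||(V$16||$0))><H(V$16||($0||$23)))
         (Stop (V$0--H$0)) (Stop (V$0--H$0)) (Use p1234 [$23, $19, $13, $12, $10, $8, $5, $3, $0])
         (Stop ((((V$0--H$0)||V(V$16||$0))--V($12--$10))||V$0)) (($0||$5)><V($0||$7))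
         (($0||$8)><V($0||$12)) (Stop (V$0--H$0)) (($0--$3)><H($0--V$8))))))))))
     ((($2--$0)||V$6)><(V$8||($3--$0))) ((($2--$0)||$13)><(V$8||($3--$0)))
     ((($2--$0)||V$11)><(V$8||($3--$0))) ((($2--$0)||$4)><(V$8||($3--$0)))
     ((($2--$0)||H$5)><(V$8||($3--$0))) ((($2--$0)||V$12)><(V$8||($3--$0))) (Stop (H$0--V$0))
     ((($2--$0)||$5)><(V$8||($3--$0))) (Stop $0) (Stop $0) ((($2--$0)||W$13)><(V$8||($3--$0)))
     ((($2--$0)||$6)><(V$8||($3--$0))) ((($2--$0)||H$6)><(V$8||($3--$0))) (($1--$0)><H(H$0--V$0))
     (Stop $0) (Stop $0)))
    (($7||$0)><($0||$4)) (($7||$0)><($0||W$11)) (($7||$0)><($0||V$11)) (($7||$0)><($0||H$4))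
    (($7||$0)><($0||W$4)) (($7||$0)><($0||H$11)) (($7||$0)><($0||$9)) (($7||$0)><($0||H$2))
    (($7||$0)><($0||$6)) (($7||$0)><($0||H$8)) (($7||$0)><($0||$11)) (($7||$0)><($0||V$4))
    (($7||$0)><($0||$2)) (($7||$0)><($0||V$9)) (($7||$0)><($0||$8)) (($7||$0)><($0||V$6))))
   (($4||$0)><($0||$2)) (($4||$0)><($0||$9)) (($4||$0)><($0||V$9)) (($4||$0)><($0||H$2))
   (($4||$0)><($0||$1)) (($4||$0)><($0||V$8)) (($4||$0)><($0||$10)) (($4||$0)><($0||V$3))
   (($4||$0)><($0||V$5)) (Stop (H$0||V$0)) (($4||$0)><($0||$8)) (($4||$0)><($0||H$1))
   (($4||$0)><($0||W$3)) (($4||$0)><($0||H$10)) (Stop (H$0||V$0)) (($4||$0)><($0||$5))))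
  (Use p1234 [$4, $0]) (Stop $0) (Stop $0) (Use p1243 [H$4, $0]) (Use p1234 [$4, $0]) (Stop $0)
  (Stop $0) (Stop (H$4--$0)) (Stop ($4--$0)) (Stop $0) (Stop $0) (Stop ($4--$0))
  (Use p2134 [V$4, $0]) (Stop $0) (Stop $0) ((V$4--$0)><H($4--$0)) (Stop (H$4--$0)) (Stop $0)
  (Stop $0) (Use p2143 [W$4, $0]) ((V$4--$0)><H($4--$0)) (Stop $0))"])
    (simp only: check_eval covered_cases)

lemma covered_8 [covered_cases]: "covered
  [(p2314, p2143, p2143), (p3124, p3412, p3412), (p1324, p4321, p2143)]"
  by (rule covered_by[of "
  $2--W$0;; H$1--$1;; $3||$0;; H$5||V$5;; $5--$0;; Cell p2314 p2314 (case_s4 (Stop $0)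
  (($0||V$5)><(W$7||$0)) (Use p1234 [W((H$6||$0)||W$0)]) (($0||(V$7--H$7))><(H$6||$0))
  (((H$6||$0)--$0)><V(W$7||($0||H$6))) (Use p3124 [W((W$3||$0)||W($0||$2))])
  (($0||V($8--V$6))><(W$7||$0)) (Stop $0)
  (H$0||$6;; V$1||$8;; Cell p3124 p4123 (case_s4 (Stop $0) ((W$3||$0)><V(H$6||$0))
   (Stop ($0||H$10)) (Stop $0) (Stop $0) (Stop ($0||$9)) ((V$3||$0)><V(W$9||$0)) (Stop $0)
   (Stop $0) (($0||W$1)><(V$3||$0)) (($0||W$2)><(W$3||$0)) (Stop (W$3||$10)) (Stop $0)
   (Stop ($0||$10)) (Stop ($0||H$9)) (Stop ($3||$9)) (Stop $0) ((V$3||$0)><V(H$6||$0))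
   (Use p1324 [$0||W$7]) (Stop (V$3||$6)) (Stop (W$3||$6)) ((H$0--(V$3||$0))><V(H$1||$0))
   (Stop $0) (Stop $0)))
  ((((W$3||$0)||W($0||V$2))--(($0||V$2)||W$0))><H(((W$7||$0)||V$2)||W(H$6||$0)))
  (Use p1234 [($0||$1)||W(H$6||$0)]) (($0||(V$6--H$6))><(W$7||$0)) (Stop $0)
  ((((H$6||$0)||W$0)--V(V$0||H$0))><H((W$3||$0)||W(W$7||$0))) (Use p3124 [V((V$0||H$0)||V$3)])
  (Stop (($0||W$4)--$0)) (Stop $0) (($0||V(H$8--$4))><(W$7||$0))
  ((((V$0||H$0)||V$3)--(V$0||H$0))><V(V$0||H$0)) (Stop ((W$7||$0)--$0))
  (($0||(H$6--V$6))><(W$7||$0)) (((($0||V$1)||W(H$6||$0))--(($0||V$1)||W$0))><V(($0||V$1)||W$0))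
  (($0||$5)><(W$7||$0)) (Stop $0))"])
    (simp only: check_eval covered_cases)

lemma covered_9 [covered_cases]: "covered
  [(p2314, p2143, p2143)]"
  by (rule covered_by[of "
  H$0--$0;; Cell p3124 p3412 (case_s4 (Stop $0)
  (((W(V$0--(H$0--V$0))||((V$0--(H$0--V$0))||V$1))--V(H(V$0--(H$0--V$0))||V(V$0--(H$0--V$0))))><(H(V$0--(H$0--V$0))||V(V$0--(H$0--V$0))))
  ((W$0--((((V(W$2||$0)--H(W$2||$0))||(V(W$2||$0)--H(W$2||$0)))--(W$2||$0))||V$1))><H((((V(W$2||$0)--H(W$2||$0))||(V(W$2||$0)--H(W$2||$0)))--(W$2||$0))||V$1))
  (($0||(H$2--V$2))><(W$2||$0)) (((W$0--((W$2||$0)||V$1))||W$0)><W(((V$0--H$0)||H$2)||V($0||V$1)))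
  ((H(W$2||$0)--((W$2||$0)||W$0))><(V(W$2||$0)--H(W$2||$0)))
  ((((W$2||$0)||W$0)--V(V$0||H$0))><W(V$0||H$0)) (Stop $0)
  (((W$0||(W$0--((W$2||$0)||W$1)))--V$0)><W(V$0--H$0))
  ((V(V$0--H$0)--((V(W$2||$0)||H(W$2||$0))--W$0))><W((H$0--(V$0||H$0))--(V(W$2||$0)||H(W$2||$0))))
  (((V$0||H$0)--W(W$2||$0))><V(V(W$2||$0)--H(W$2||$0))) (Stop $0) (($0||(V$2--H$2))><(W$2||$0))
  (((V(W$2||$0)--(H(W$2||$0)--V(W$2||$0)))||V$0)><V((V(W$2||$0)--(H(W$2||$0)--V(W$2||$0)))||$2))
  (($0--(H((V$0--(H$0--V$0))||W$1)||V((V$0--(H$0--V$0))||W$1)))><W(V$0--H$0))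
  (((W$2||$0)||V$0)><H(V$0--H$0))
  (W$0||$2;; $1||$2;; Cell p1324 p4321 (case_s4 (Stop $0) (Stop $0)
   (Stop ((V$4--H$4)||(H$3--V$3))) (Stop (W$2--$0)) ((W$2--$0)><H(W$1--$0)) (Stop $0) (Stop $0)
   (Use p1234 [$5, $3, $0]) ((W$1--$0)><H(H$1--$0)) (Stop $0) (Stop (H$1--V$1)) (Stop (W$1--$0))
   ((W$1--$0)><H(H$1--$0)) (Stop (V$1--H$1)) (Stop $0) (Stop (H$1--$0)) (Use p1324 [$3, $5, $0])
   (Stop $0) (Stop $0) (Stop (W$1--$0)) (Stop (H$1--$0)) (Stop $0) (Stop $0)
   ($1--$0;; $1--$3;; Cell p1324 p1243 (case_s4 (Stop $0) (Use p3412 [W((H$0--$0)||H$7)])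
    (($0||H$2)><($3||$0)) (Stop $0) (($3||$0)><($0||W$7))
    (Use p1243 [W$8, H$5, (($0||$3)||$0)--H$7]) (Use p1234 [H((V$0--H$0)||H$8)]) (Stop $0)
    (($3||$0)><($0||W$6)) (Use p1243 [W$8, H$5, (H$0||($3||$0))--W$8]) (($0||$1)><($3||$0))
    (Use p1243 [W$8, H$5, V(W$7--(($0||(V$7--H$7))||H$0))])
    (Use p1243 [W$8, H$5, V(W$7--(($0||(H$7--$8))||H$0))]) (($0||$2)><($3||$0))
    (Use p1243 [W$8, H$5, H((H$0||($3||$0))--H$7)]) (($3||$0)><($0||H$8)) (Stop $0)
    ((H$0--((V$0--H$0)||V$7))><V(((V$0--H$0)||V$7)--V$0))
    (Use p1243 [W$8, H$5, H(V$6--(H$0||($3||$0)))]) (($3||$0)><($0||V$6))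
    (Use p1243 [W$8, H$5, V(W$7--(($0||(H$7--V$7))||H$0))]) (($0||V$1)><($3||$0))
    ((H$0--((V$0--H$0)||$8))><V(((V$0--H$0)||$8)--V$0)) (Stop $0)))))
  (Use p1234 [H((W$2||$0)||W$0)])
  (((V$0--((V$0--H$0)||(V$0--H$0)))||$1)><V(H(W$2||$0)--V(W$2||$0)))
  ((V($0||H$2)--H($0||H$2))><(($0||H$2)||V$0)) (($0||($2--$1))><(W$2||$0))
  (((((W$2||$0)||W$0)--(V$0--H$0))||(H$0--V$0))><W((V(W$2||$0)--H(W$2||$0))--V(V$0||H$0)))
  (Use p1234 [V((H(W$2||$0)--(V$0--H$0))||W(W$2||$0))]) (Stop (($0||V$2)--$0)))"])
    (simp only: check_eval covered_cases)

lemma covered_10 [covered_cases]: "covered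
  [(p2314, p1342, p1342), (p2314, p2143, p4231)]"
  by (rule covered_by[of "
  H$0||$1;; $0||W$2;; V$3||H$3;; $1--W$2;; W$2--$0;; Cell p3124 p2143 (case_s4 (Stop $0)
  (Stop (V$0||H$0)) (((W$7--$0)--W$0)><W((H$7--V$7)--$0)) (Stop $0) (($0--H$6)><H($0--W$6))
  ((V$3||$0)><V(W$6||$0)) (Stop (V$7--$0)) (Stop $0) (($3||(V$7--$0))><W((V$0--H$0)||H$6))
  ((V$3||$0)><V(W$6||$0)) (Stop (V$7--$0)) (Stop (W$7--$0)) (Stop (W$6||$0)) (Stop $0)
  ((V$3||$0)><W(V$1||H$1)) (($0||$5)><V(V$7--$0)) (Use p1234 [V($0||H$4)]) (Stop $0)
  (Stop (W$6||$0)) (Stop $0) ((W$0||(V$7--$0))><H($4||$0)) (Stop ($0--V$7)) (Stop $0)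
  (Stop ($4||$0)))"])
    (simp only: check_eval covered_cases)

lemma covered_11 [covered_cases]: "covered
  [(p2314, p1342, p1342), (p2314, p2143, p4321), (p2314, p4321, p3412), (p3124, p2314, p3241),
  (p2134, p2143, p3412), (p2134, p2314, p3124), (p2134, p2341, p2134)]"
  by (rule covered_by[of "
  V$5||$6;; $6||$7;; $7||V$6;; V$4--$7;; $0||H$10;; $10||$9;; (H$10||V$10)--$8;; $0||W$13;;
  V$9--($12--V$10);; $14||$0;; H$16||$8;; V$14--$16;; Done action_C6C2C2_3 [$11, V$10, V$9, $9, H$7,
  V$18, $16, $17, $18, $10||H$8, V$6, V$17, $10, V$11, $6, V$16, W$7, W$4, $2, V$2, H($5||W$10),
  H$4, $3, H$11, V(W$18||$6), H($9--$12), H$18||V$18, H(H$16||$18), H$18||$6, V(W$18||$11),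
  W((V$14||$15)--$17), H(W$16||$18), H$10, $1, V(H($13||$12)--$0), H$10||$3, H$18||$3,
  $6--W(V$13||$15), W$5, H$11||$3, H$18, H$1, V($0--H$15), V(W$18||$9), H$18||$9, H$8]"])
    (simp only: check_eval covered_cases)

lemma covered_12 [covered_cases]: "covered
  [(p2314, p1342, p1342), (p2314, p2143, p4321), (p2314, p4321, p3412), (p3124, p2314, p3241),
  (p2134, p2143, p3412)]"
  by (rule covered_by[of "
  H$3--(W$0||$3);; $2||$1;; V$4||$5;; $1--W$6;; $6||$4;; W$8||$0;; Cell p2134 p2314 (case_s4
  (Stop $0) (Stop $0) (Stop $0) (($0--V$7)><(V$10--$0)) (($0--W$7)><(V$10--$0)) (Stop (W$5--$4))
  (Stop ($9||$5)) (Stop $0) ((W$7--(H$11||$0))><V(W$6--$0)) (Stop $0) (Stop (W$4--$3))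
  ((W$11||$0)><W(H$11||$0))
  ($2--V$0;; V$1||$12;; H$7||$9;; $0--V$14;; $4||$15;; $4--V$9;; Cell p2134 p2341 (case_s4
   (Stop $0) ((H$0||V$0)><H($12--$6)) ((H$18||$0)><V($7||$0)) (Stop $0) (Stop $0)
   (Stop (H$18||$0)) (Use p1234 [$14, $15, $16, $17, $18, $7, $0]) (Stop $0) (Stop $0)
   (Use p1342 [H(W$11||$12), $4, H$9||$14, H($11||H$10), $3, ($11--$7)--W$11, W(H$5||$0)])
   (V$6||H$6;; $19--V$17;; $8||V$5;; $9||$6;; H$4||$5;; Cell p1324 p4123 (case_s4 (Stop $0)
    ((W$12||$0)><W($0||W$9)) ((H$0||V$0)><H(V$7--$15)) (Stop $0) (Stop $0) (Stop $0)
    (Stop ($0||H$12)) (Stop $0) (Stop $0) (Stop (W$6||$8)) ((H$0||V$0)><V(W$8--$15)) (Stop $0)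
    (Stop $0)
    (Use p1423 [W(V$15||$16), V($24--(H$9||V$9)), V(H$17||$23), W($16--W$14), V(V$21--$24), $8--$18, W(H$4||$0)])
    (Stop $0) (Stop $0) (Stop ((H$12||V$12)||H$12))
    ($7||W$1;; $9||H$7;; $15||$8;; $14||$4;; $5--H$4;; H$0--$4;; H$6||$18;; W$7--$13;; V$16--$22;;
     H$9||$12;; Done action_S3C2C2_2 [V$9, $8, $21, V$21, V$7, $21||H$16, $34, $23, $16, V$16, V$18,
     V$23, $7, V$8, $18, V$34, $9, $6, V$17, $17, V$6, $18||$11, $23||$17, W$4, H($3--$5),
     W($30--$15), V($30--(H$12||V$12)), V((W$10||$13)--($5||V$29)), (($15||$10)--$16)--W$3,
     V($31--H$19), W(V$17--$25), V(($2||W$27)--W$10), $4, $1, V(W$18--$25), V($2--V$0),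
     V(H$16--($2||W$26)), $24--V$22, V($32--(H$12||$13)), W(($15||V$10)--$5), V(($5||W$29)--W$16),
     H$1, $25--W$22, V(V(H$10||$14)--(V$29||$5)), W($0--H$5), H(V$31--$34)])
    (Stop ($11||$1)) (Stop $0) (Stop $0) (Stop (H$12||$0)) (Stop ($0||V$12)) (Stop $0)))
   (Stop $0) (Stop $0) (Stop ($0||$0)) (Stop (H$0||V$0)) (Stop $0) (Stop $0)
   ((H$0||V$0)><($7--$13)) (($0||H(V$7--$17))><V($7||$0)) (Stop $0) (Stop $0) (Stop ($0||W$18))
   ((W$18||$0)><V(V$7||$0)) (Stop (V$15--($18--V$16)))))
  (Stop ($10--$1)) (Stop $0)
  ($11--V$9;; $2--$1;; $0||H$13;; Cell p2134 p4123 (case_s4 (Stop $0) ((H$15||$0)><V(W$4||$0))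
   (Stop ($0||W$15)) (Stop ($15||($9--W$4))) (Stop ((V$12--$15)||W$4)) (Stop (H$0||V$0))
   (Stop ($0||H$4)) (Stop $0) (Stop $0) ((V$8||(H$0--$0))><((H$0--$0)||V$10))
   (($0||$4)><V($0||$15)) (Stop $0) (Stop $0) (Stop (H$0||V$0)) (Stop (H$15||$0)) (Stop $0)
   (Stop $0) (Stop ($0||W$4))
   ($3||V$2;; $1||$0;; $8--H$3;; $3||$0;; $9--$5;; $5||$8;; $9||V$7;; ($16||H$13)--$22;;
    $22--V$12;; V$10--$23;; V$11||$14;; V$22--$0;; H$16||$6;; H$13||$17;; Done action_S3C2C2_3 [V$12,
    V$10, $18||$9, V$29||($16--$19), $8, $14||$7, $29, $18, $14||$6, H($5||H$14), W$15, H$15, $10,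
    V$8, V$18, V$29, $12, $14, H($21--H$15), H$7, H($4||H$8), H($2||H$14), V$17--$26, V$1,
    W(W$13||$0), V(H$18||$29), W$3, W$0||$11, V(H$0||$6), V(H$18||V$18), W($15||$18), W($5||$0),
    H$10, W($22--$15), V(W$16--$20), W($2||$0), V($1||H$4), H$11, V($27--(V$15||H$15)), W$0,
    V(H$0||$11), V$9, W$18, W(H$13||$0), W$18||$8, H(V$26--$29)])
   (Stop (($7--H$4)--V($7--V$6))) (Stop (V$4--$14)) (Stop (W$4||$0)) (Stop (H$4||$0))
   (Stop (V$12--$3))))
  (Stop $0) (Stop $0) (Stop $0) ((H$0||V$0)><H(V$8--$11)) (Stop ($0||H$11)) (Stop (H$10--$2))
  (Stop $0) (Stop (V$8--($11--V$9))))"])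
    (simp only: check_eval covered_cases)

lemma covered_13 [covered_cases]: "covered
  [(p2314, p1342, p1342)]"
  by (rule covered_by[of "
  Cell p2314 p2143 (case_s4 (Stop $0)
  (V$0||H$0;; H$1--V$1;; V$2--$0;; $2||$4;; H$4||$5;; Cell p3124 p2143 (case_s4 (Stop $0)
   (Stop ($0--V$6)) ((V$5||$0)><(V$6--$0)) (Stop $0) (Stop $0) (Stop (V$0||H$0)) (Stop $0)
   (Stop $0) ((V$5||$0)><(V$6--$0)) (Stop $0) (Stop ($0||(V$6--H$6))) (Stop (W$6--$0))
   (Stop (W$7||$0)) ((W$6||$0)><V(W$7||$0)) (Stop $0) (($0||H$1)><V(V$6--$0)) (Stop ($0||V$6))
   (Stop $0) ((V$5||$0)><(V$6--$0)) (Stop $0) (Stop ($4--$4)) ((V$4--$0)><W(H$1||V$1))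
   ((V$0||H$0)><(V$6--$0)) ((V$5||$0)><(V$6--$0))))
  (H$0--V$0;; H$1||$2;; H$0--V$0;; Cell p3124 p2143 (case_s4 (Stop $0) ((V$0--H$0)><(W$4--$0))
   (Stop $0) (Stop $0) (($0--H$5)><H($0--W$5)) ((W$5||$0)><W(V$4--$0)) (Stop $0) (Stop $0)
   ((W$0||(V$4--$0))><V(H$4||(V$4--$0))) ((W$0||(V$4--$0))><H(W$4||$0))
   (($1--((W$5||$0)||$1))><V(($0||$1)--V(W$5||$0))) (Stop (W$4--$0)) (Stop (W$5||$0))
   (Stop (W$4||$0)) (((H$4||((V$4--$0)||$5))--$4)><V(V$5||(H(W$5||$0)--(W$4||$0))))
   (($0||H$2)><V(V$4--$0)) (((W$5||($0||V$5))--$3)><W($0||V$4)) (Stop ($0||W$4))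
   (Stop ((V$0--H$0)||H$4)) (Stop $0) ((H$5||((V$4--$0)||H$4))><W(V(V$4--$0)||(W$4||$0)))
   (Stop (W$4--$0)) ((V$0||H$0)><(V$4--$0)) (((W$0--($3--$0))||H$4)><W(V(V$4--$0)||(W$4--$0)))))
  (Stop $0) (Stop ($0--W$1))
  ((V(W(V$0--(H$0--V$0))||((V$0--(H$0--V$0))||W$1))--H(W(V$0--(H$0--V$0))||((V$0--(H$0--V$0))||W$1)))><H(H(V$0--(H$0--V$0))||((H$1||$0)--((V$0--H$0)||(V$1--((V$0--(H$0--V$0))||V(H$1||$0)))))))
  (H$0--V$0;; V$1--$0;; H$0||V$0;; V$3--H$3;; H$4||$5;; Cell p2134 p2143 (case_s4 (Stop $0)
   (Stop $0) (($0||$3)><H(W$6--$0)) (Stop ($0--$7)) (Stop ($0--W$7)) (Stop $0) (Stop ($2--$2))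
   (Stop ($0--$5)) (Stop $0) (Stop $0) (($4--$0)><W($0||V$7)) (Stop $0) (Stop $0)
   (($0||W$1)><V($0||W$7)) (Stop (V$6--$0)) (Stop $0) (Stop ((W$6--$0)||$5)) (Stop (H$0||V$0))
   (Stop $0) (Stop $0) (((V$6--$0)||W$1)><V(V$6--$0)) (Stop ((V$0--H$0)||H$6)) (Stop ($5--$5))
   (((H$0||V$0)||V$2)><W($0||$2))))
  (Use p1234 [$0])
  (((V$0--H$0)||(((H$1||$0)||W$0)--H(H$1||$0)))><H($0--((V(H$1||$0)||H(H$1||$0))--W$0)))
  (H$0||$1;; V$1||H$1;; V$2--H$2;; Cell p2314 p2341 (case_s4 (Stop $0) (($0||H$3)><V($4--$0))
   (($2||$0)><($4--$0)) (Stop $0) (($2||$0)><($4--$0)) (Stop ($4--$0)) (($2||$0)><($4--$0))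
   (Stop ($0--$4)) (($2||$0)><($4--$0)) (Stop $0) (($2||$0)><($4--$0)) (Stop ($0--$3))
   (($2||$0)><($4--$0)) (Stop ($2||$5)) (Stop $0) (($2||$0)><($4--$0)) (Stop (H$4||$0))
   (($2||$0)><($4--$0)) (($2||$0)><($4--$0)) (Stop $0) (($2||$0)><($4--$0)) (Stop (H$5||$0))
   (Stop ($0||$4)) (($2||$0)><($4--$0))))
  (H$0||$1;; Cell p3124 p2143 (case_s4 (Stop $0) ((W$0||(V$2--$0))><H(W$2||$0)) (Stop (W$2--$0))
   (Stop $0) (($0--H$3)><H($0--W$3)) ((W$3||$0)><V(W$2||$0))
   ((H($0||V$1)--V($0||V$1))><H(H$3||(V$2--$0))) (Stop $0) (((V$0--H$0)||H$1)><V(H$3||(V$2--$0)))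
   (Stop ((V$2--$0)||$3)) (Stop ($0--V$2)) (Stop (W$2--$0)) (Stop (W$3||$0))
   ((W$0||(V$2--$0))><H(W$2||$0)) (((W$3||$0)--V$2)><H(W$0||(V$2--$0))) (($0||H$1)><V(V$2--$0))
   (((W$2--$0)||V$0)><V((W$2--$0)||$2)) (Stop $0) ((W$3||$0)><W(V$2--$0)) (Stop $0)
   ((H(W$2--$0)||V(W$2--$0))><W(V$1--(V$0||H$0))) (Stop (V$2--$0)) ((V$0||H$0)><(V$2--$0))
   ((H$2||(V$2--$0))><V(V$2--$0))))
  (Stop (H$1||$0)) ((((H$1||$0)--$0)||W(H$1||$0))><W((V$0--H$0)||V(H$1||$0)))
  (Use p1234 [W((H$1||$0)||W$0)])
  ((((V(H$1||$0)||H(H$1||$0))||((H$0--V$0)--H$0))--H(H$1||$0))><V(($1||((H$0--V$0)--H$0))--(V(H$1||$0)||H(H$1||$0))))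
  (Stop $0)
  (H$0||$1;; H$1--V$1;; Cell p3124 p2341 (case_s4 (Stop $0) (Stop $0) (Stop ($0||W$3)) (Stop $0)
   (((W$4||$0)--V$4)><V((W$3||$0)||W$0)) (((W$4||$0)||$2)><((H$0--V$0)||H$4))
   ((W$4||$0)><V(W$3||$0)) (Stop $0) ((W(W$3||$0)--($0--W$2))><W((W$0--(W$3||$0))--W$4))
   ((W$0--(W$3||$0))><H(W$3||$0)) (Stop ($0||$0)) (((W$3||$0)--V$4)><(W$0--(W$3||$0)))
   ((W(W$4||$0)--((W$4||$0)--H$3))><V((W$4||$0)--$1)) (((W$3||$0)--(W$4||$0))><V($0||W$4))
   ((H$0--V$0)><(W$3||$0)) (((W$4||$0)--W(W$3||$0))><H((W$4||$0)--$2))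
   ((W$0||($0--V$3))><H($0--(V$3--H$3))) (Stop (W$4||$0))
   (Use p1324 [$0||(($0||(($0||$3)--$0))--V$3)]) ((($0--H$2)--W(W$4||$0))><V((W$4||$0)--V$2))
   (((W$4||$0)||W(W$3||$0))><H((W$3||$0)--V$2)) ((H$2||(H$0--(W$4||$0)))><W(W$3||$0))
   (($0||$1)><V(W$4||$0)) (($3||((W$3||$0)--W$3))><W(W$0--(W$3||$0)))))
  (V$0||H$0;; $0||$2;; H$2--$1;; $0||V$4;; $0--W$2;; V$0||H$0;; H$6||$7;;
   Cell p2314 p4123 (case_s4 (Stop $0) ((V$6--$0)><H($2--$2)) ((W$6||$0)><V($7||$0)) (Stop $0)
   (($1--$0)><($0--W$9)) (Stop $0) (Stop $0) (Stop $0) ((V$6--$0)><H(H$8||$0))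
   ((V$6--$0)><V($0||V$8)) (($0--(H$1||V$1))><H(V$6--$0)) (($0||V(V$8--H$8))><V(H$9||$0))
   (Stop $0) (Stop (H$9||$0)) (Stop (H$6--V$6)) (Stop (H$8||$0)) (($7||$0)><H(H$4--V$4)) (Stop $0)
   (Stop $0) (($7||$0)><(V$0||H$0)) (((H$8||$0)--H$0)><(V$6--$0)) (Stop $0) (Stop $0)
   (Stop (V$0||H$0))))
  (H$0||$1;; Cell p3124 p2143 (case_s4 (Stop $0) (($0||V(V$2--H$2))><V(W$3||$0))
   ((V$0--H$0)><(W$2--$0)) (Stop $0) (($0--H$3)><H($0--W$3)) ((V$0||H$0)><(V$2--$0))
   (((W$3||$0)--V$2)><((V$2--$0)--W$0)) (Stop $0) (((V$0--H$0)||H$1)><V(H$3||(V$2--$0)))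
   (((V$2--$0)||$0)><V(W$2||$0)) ((((W$2--$0)--V$1)||H$2)><V((W$3||$0)||V$1)) (Stop (W$2--$0))
   (Stop (W$3||$0)) ((H$3||(V$2--$0))><V(V$2--$0))
   ((W$1||(H(W$3||$0)--(H$3||(V$2--$0))))><V((H(V$2--$0)--V(V$2--$0))||(W$3||$0)))
   (($0||H$1)><V(V$2--$0)) (Use p1243 [W$3, W((H$2||(V$2--$0))--V$2)]) (Stop ((V$2--$0)||$2))
   (Stop ($0--V$2)) (Stop $0) ((W$0||(V$2--$0))><V(H$2||(V$2--$0))) (Stop $0)
   ((W$2||$0)><V(W$3||$0)) ((W$0||(V$2--$0))><V(H$2||(V$2--$0)))))
  (Stop (H$1||$0)) ((((H(H$1||$0)--V(H$1||$0))||V(V$0--H$0))--$0)><V(H$1||$0))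
  (Use p1234 [$1, $0])
  (Use p1234 [W((((V$0--H$0)||(V$0--H$0))--$0)||W$1)||((H(H$1||$0)--V(H$1||$0))||(((V$0--H$0)||(V$0--H$0))--$0))])
  ($0||$1;; H$2||$0;; Cell p2314 p4321 (case_s4 (Stop $0) ((W$0||($3--$0))><V(V$3||($3--$0)))
   (($1--($3||$0))><W(H$0--V$0)) (Stop $0) (($0--H$4)><H($0--W$4))
   ((H$4||(((H$2||$0)--((V$0||H$0)||$2))--((H$4||$0)||W$0)))><(V$2--((V($3||$0)--(V$1--$0))||((H$4||$0)||W$0))))
   ((($3||$0)||W$0)><W($3||$0)) (Stop ($0--$3)) ((H$4||$0)><V($3||$0))
   ((W$0||($3--$0))><V(V$3||($3--$0))) (($1--($3||$0))><W(($3||$0)--W$0)) (Stop $0)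
   ((V$1--$0)><H($3||$0)) ((V$0||H$0)><V($3||$0)) (($1--($3||$0))><V(W$0||($3--$0)))
   (Stop (H$4||$0))
   ($0||$2;; $1||$5;; $5--$2;; Cell p3124 p2314 (case_s4 (Stop $0)
    (((V$0||H$0)--W(W$6||$0))><W($8--(W$3||$0))) ((W$2--(V$7||$0))><H(H$0--V$0)) (Stop $0)
    ($8--W$0;; $8||V$1;; Cell p2314 p1243 (case_s4 (Stop $0) (Use p1234 [$0])
     (($0||V$2)><(H$9||$0)) (Stop $0) (Stop ($4||$3)) ((V$4||$0)><V(W$3||$0))
     (Use p3142 [V(H$5||$0)]) (Stop $0) (Stop $0) (Stop $0) ((($0||W$3)--H$0)><W($0||(W$3||$11)))
     (Stop $0) (Stop $0) ((H$0--($0||H$6))><W($0||H(W$3||$9))) (($10||$0)><V(W$3||$0)) (Stop $0)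
     (Stop $0) (Use p3124 [$0||V$1]) (($7||$0)><V(W$3||$0)) (Stop ($7||V$3)) (Stop $0)
     ((($0||$9)--$0)><V($0||V$3)) (($0||$2)><(H$11||$0)) (Stop $0)))
    (($8--(W$3||$0))><H(W$0--(W$2||$0))) ((W$2--(V$7||$0))><H(H$0--V$0)) (Stop $0) (Stop $0)
    ((H$8--($1||$0))><V(W$0--(W$2||$0))) ((V$2--(W$8||$0))><V((V$4||$0)--W$0)) (Stop $0) (Stop $0)
    ((V$2--(W$8||$0))><V((V$4||$0)--W$0)) ((W$2--(V$7||$0))><H(H$0--V$0))
    (H$3||$6;; $6--V$2;; H$4||$8;; Cell p2134 p2143 (case_s4 (Stop $0) (Stop $0) (Stop ($11--$9))
     (($0--V$12)><(V$5--$0)) (($0--W$12)><(V$5--$0)) (Stop ($8--$3)) (Stop ($11--$2))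
     (W$4||$7;; W$5--$8;; $6||$4;; $11--($6--$3);; $4--$5;; $8--$0;; Cell p2134 p1324 (case_s4
      (Stop $0) (Use p1324 [W((V$0--H$0)||W($12||$11))]) (Use p1234 [V((H$0--$0)||$19)]) (Stop $0)
      (Stop (W$19--$6))
      (V$0--H$0;; $13||$12;; (H$2--V$2)||($0--$8);; (H$14--$16)||$2;; Cell p2314 p1432 (case_s4
       (Stop $0)
       (V$0||$3;; $6--$1;; $7--$4;; $0||W$8;; $16||$9;; $0||V$2;; $12||V$11;; $0||$4;; $14||$13;;
        $0||V$6;; $8||V$18;; V(V$11||$20)--$0;; H$17--($14--$12);; H$18||V$18;; $0--$38;;
        $1--H$26;; $30--$28;; $1||$0;; H$27||$17;; $8--$20;; W$25||$11;; Done action_S3C2C2_4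
        [V$20--$19, $26, H$17, W$17, V$26, V$16||$17, $33, $15, V$16, $16, V$15, $13, $12, $14,
        $11, $27, V$9, V$12, V$13, V$11, V$14, $9, V$27, W$19, $8, V$6, $5,
        V($26--H$23)--($21||$45), V($4||H$19), V$4, W$3, $2--H$16, H$1, V$40--$0, $0--W$31, $1,
        V((H$37||$20)--V$14), $3, V$38--($34--V$27), W(($38--$27)||$19), V($2--$12), $5||V$29,
        V(V$29||$6), $8||$29, W$10, $29])
       (Stop $0) (Stop $0) (Stop $0) (Use p1324 [V$0]) ((H$24||$0)><($0||V$10)) (Stop $0)
       (Stop $0) ((W$9||$0)><($0||H$10)) (Stop $0) (Stop $0) (Stop $0) (Stop $0)
       (($4--$0)><(H$0--V$0)) (Stop ($9--$16)) (Stop $0) (Stop (V$0--H$0))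
       ((V$5--($0||V$24))><H($0--W($12||$5))) (Stop $0) (Stop $0) (Stop $0) (Stop (V$0--H$0))
       (Stop $0)))
      (((H$0--V$0)||V$14)><V(V$0--H$0)) (Stop $0) (Stop $0) (((H$0||V$0)--$5)><H($14--(V$0||H$0)))
      ((((W$11||$13)||((V$0--H$0)||W$19))--H$0)><V((W($17--W$11)||((V$0--H$0)||W$19))--W$0))
      (Stop $0) (Stop $0) (Stop (H$0||V$0)) (((($0||$7)||V$0)--$17)><V((V$0||$0)--V$4))
      (Stop ($13--H$11)) (Stop $0) (((W$0||($7||$0))--$13)><H(W(W$11||$19)--(H$0||V$0)))
      ((($0||V(V$12--$2))--W$0)><W((V$0--H$0)||(H$11--$13))) (Stop ($4--H$14)) (Stop $0)
      (Stop (H$0||V$0)) (((V$0--H$0)||H$19)><W(($7||$0)--W$0)) (Stop $0)))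
     (($0--H$7)><H($0--$4)) (Stop $0) (Stop $0) ((V$0--H$0)><V(W$4--$7)) (($0--V$6)><H($0--$7))
     (Stop $0) (Stop $0) (Stop ($0--W$10)) (Use p1234 [$12, $11, $8, $4, $0]) (Stop ($1--V$11))
     (Stop $0) (($0--H$10)><H($0--W$7)) (Stop ($0--$6)) (Stop ($1--$8)) (Stop ($5--$3))
     (Use p1243 [W$12, V$3, V$9, H(W$4||$12), $0])))
    (Stop $0)
    ($4||V$0;; $0--H$7;; $1--W(W$2--$5);; Cell p3124 p2134 (case_s4 (Stop $0) (Stop ($5||$4))
     (Stop $0) (Stop $0) (Stop $0) (Stop $0) (Stop $0) (Stop $0) (Stop ($0--W$6)) (Stop $0)
     (Stop (W$6||$0)) (Stop $0) (Stop $0) (Stop (W$12||$0)) ((V$3--$0)><V($0||V$6))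
     (Stop (((W$4||$6)--H$7)--V$3)) (Stop $0) (Stop $0) (Stop (W$4||$12)) (Stop (V$3--H$3))
     (Stop $0) (Stop ($3--W$7)) (Stop ($11||V$4)) (Stop $0)))
    (($2--(W$2||$0))><H(W$0--(W$2||$0))) (Stop ($0||W$8)) (Stop $0)
    ((V$3--(H$0--V$0))><W($3--(W$6||$0))) ((W$0--(W$2||$0))><V(H$6--(V$7||$0))) (Stop $0)))
   (((V$3||($3--$0))--W$0)><H(V$1--$0)) ((V$3||($3--$0))><(V$0||H$0)) (Stop $0) (Stop $0)
   ((V$0||H$0)><V($3||$0)) ((W$0||($3--$0))><H($3||$0)) (Stop $0))))"])
    (simp only: check_eval covered_cases)

lemma covered_14 [covered_cases]: "covered
  [(p2314, p2314, p2314), (p2134, p2314, p3124), (p4123, p3124, p4132), (p1432, p3124, p3241),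
  (p2341, p2134, p1324)]"
  by (rule covered_by[of "
  $4||V$2;; W$4--($2--$3);; $2--$3;; $1||V$0;; W$4--$6;; $3||$2;; V$8--$9;; $8--$10;;
  W(H$8--$10)--$0;; Cell p1324 p2134 (case_s4 (Stop $0) (Stop $0) (($9--$0)><W(V$14--$0))
  (Stop $0) (Stop $0) (Stop (H$0||V$0)) (($9--($0--$14))><(W$8||$0)) (Stop $0) (Stop $0)
  ((H$0||V$0)><V(W$5||(W$10--$13))) ((H$0||V$0)><H((V$3||$3)--V$11)) (Stop $0) (Stop $0)
  (($0--H(V($14||W$12)||$1))><H((V$14--$0)||W$10))
  ($9--$0;; $10||W$2;; ($16--($9||V$2))--V$16;; $0||$14;; (V$6--$11)--V(V$7||$7);; V$14||$17;;
   $5--$0;; $0||$18;; ($11--V$10)--H$13;; $0||V$20;; $3||V$21;; $23||$12;; $13||$24;; $27||W$14;;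
   $28||V$15;; $24||V$16;; $0||V$28;; Done action_S4_3 [($16||V($25--H$18))--V$15, $13, V$12, W$12,
   V$10, $14, V$28||$12, $28, $9, W$9, V$8, V$28, V$9, V$13, $12, $7, $6, H$9, $8, H$12, $10, V$6,
   V$7, $15, V($5||V$31), V$4, W$4, V$11, $31, V($29||H$18), W$5, H$3, H$2, W$29, V$5, $2, $1,
   V$18, V(H$18||$29), H$0, $3, V$29, W$18, $26, $0, V($5||$29)])
  (Stop $0) (Stop $0) (($14--($0||H$13))><($0--(V$14||$1)))
  ($9--$0;; H$1--($0||$11);; $9||V$2;; W$0--$2;; (V$6--$11)--V(V$7||$7);; $19||V$6;;
   $0--(W$5||($17--$11));; ($10--V$9)--H$12;; $12||V$8;; H$0--($8||H$19);; $2||V$21;; V$11--$25;;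
   $0--W$9;; $25||$14;; $15||$26;; $29||W$16;; $25||V$17;; $0||V$29;; Done action_S4_4 [W$16, H$14,
   V$13, W$13, W$11, H$16, V$29||$13, $29, W$14, H$11, V$10, V$29, W$8, H$8, $13, $7,
   (W$20||$6)--H$9, $5, $10, H$13, V$5, V$29||$5, V$7, $27||W$19, V($4||V$32), V$3, W$3,
   V(V$27||$30), $32, V($30||H$19), W$4, H$2, H$12, W$30, V$4, $12, $1, V$19, V(H$19||$30), H$0,
   $2, V$30, W$19, $27, $0, V($4||$30)])
  (Stop $0) (Stop $0) ((H$0||V$0)><H(W$5--$2)) (Stop $0) (Stop ($7||$8)))"])
    (simp only: check_eval covered_cases)

lemma covered_15 [covered_cases]: "covered
  [(p2314, p2314, p2314)]"
  by (rule covered_by[of "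
  Cell p2134 p2314 (case_s4 (Stop $0) (((H$0--V$0)--($1--$0))><H(($1--$0)--W$0)) (Stop $0)
  (Use p1234 [V(V$0--($1--$0))]) (Use p1324 [V$0--($1--$0)])
  (((H$0--V$0)--($1--$0))><H(V$0--($1--$0))) (Stop $0)
  (((H$0--V$0)--($1--$0))><V(W(V$1--$0)--(H$0--V$0)))
  ($1--$0;; $1--$2;; Cell p1432 p2314 (case_s4 (Stop $0) (Stop ($3--$0)) ((H$0--V$0)><V(V$4--$0))
   (Stop $0) (((V$0--($2--$0))||V$0)><W(V$4--$0)) (Stop $0) ((H$0--V$0)><H($3--$0))
   (($1--$0)><H(H$0--V$0)) (Use p2341 [$0--$3])
   (((V$0--($4--$0))||V($2--$0))><W((V$0--($1--$0))||$0))
   ((($2--$0)||(V$0--($3--$0)))><W(V(V$4--$0)||(V$0--($4--$0))))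
   (((V$0--($3--$0))||$0)><H(V$4--$0)) ((H$0--$0)><H($3--$0)) (Stop $0) (Stop ($3--$0))
   ($1--$0;; $5--$1;; $4--$2;; V$3--$0;; H$4||V$4;; V$3||H$3;; $9--$6;; Cell p1243 p2314 (case_s4
    (Stop $0) (Stop $0) (Stop $0) (Stop (V$8--$12)) (Stop $0) (Stop ($11--$0)) (Stop ($10--$0))
    (Stop $0) (Stop $0) (Stop $0) (Stop $0) (Stop ($4||$9)) (Stop $0) ((H$4||$0)><H($3--$3))
    ((V$12--$0)><H(V$8--$0)) (Stop $0) ((V$8--$0)><H(($2--$2)||((H$9||(V$8--$7))--V$3)))
    (($0||V(V$8--$6))><H(H$0||V$0)) (Stop $0) (($12--$0)><H($6||V$8)) (Stop (V$8--$1))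
    (Stop ($10--$0)) (Stop $0) (Stop ($4||H$11))))
   (Stop $0) (((V$0--($2--$0))||$3)><H(V($4--$0)||($2--$0)))
   (((V$0--($1--$0))||$0)><H((V$0--($3--$0))||$3)) (Stop $0)
   ($3--$0;; $5--$1;; $3--$2;; V$3--$0;; $3||V$1;; $7--$5;; Cell p1243 p2314 (case_s4 (Stop $0)
    (Stop $0) (Stop $0) (Stop $0) (Stop $0) (Stop ($10--$0)) (Stop ($9--$0)) (Stop $0) (Stop $0)
    (Stop $0) (Stop $0) (Stop (H$8||$3)) (Stop $0) (($3||$0)><H(V$2--H$2)) ((H$0--V$0)><H($8--$0))
    (Stop $0) ((H$0--V$0)><H($10--$0)) (($0||W(V$7--$5))><H(H$0||V$0)) (Stop $0)
    (($9--$0)><V(H$4||V$4)) (Stop (V$7--$1)) (Stop ($9--$0)) (Stop $0) (Stop ($10||$3))))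
   (($4--$0)><H($3--$0)) (Stop $0) (($2--$0)><V(H$0--V$0))))
  (Use p1234 [V(W$1||(V$0--($1--$0)))]) (Use p1324 [W$1||(V$0--($1--$0))])
  (Use p2314 [V(V$0--($1--$0))])
  ($1--$0;; V$1--$2;; Cell p4123 p3124 (case_s4 (Stop $0) (Stop $0) ((($3--$0)--W$0)><V($2--$0))
   (((W$0--($3--$0))||$0)><H(W$0--(V$1--$0))) (Stop $0)
   (W$0--$3;; V$1--$2;; H$0||V$0;; $0||H$1;; V$2||H$2;; Cell p4123 p2314 (case_s4 (Stop $0)
    (Stop $0) ((H$6||$0)><(V$8--$0)) ((H$6||$0)><(V$8--$0)) (Stop $0) (Stop $0)
    ((H$6||$0)><(V$8--$0)) (Stop $0) (Stop $0) (Stop ($10--$0)) (Stop $0) (Stop $0)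
    (Stop ($0--V$9)) (Stop ($7--$0)) ((W$6--$0)><H(V$10--$0)) (Stop ($7--$0))
    ((W$6--$0)><H(V$8--$0)) (Stop ($10--$0)) (Stop $0) (Stop $0) (Stop $0) (Stop ($0||H$6))
    (Stop ($10--$0)) (($7--$0)><($1||$1))))
   ($1--H$0;; W$1--$3;; Cell p4123 p2314 (case_s4 (Stop $0) (Stop $0) ((V$6--$0)><H(V$2||H$2))
    ((H$3||$0)><(V$6--$0)) (Stop $0) (Stop ($0||H$3)) (Stop $0) (Stop $0) (Stop $0)
    ((H$3||$0)><(V$6--$0)) (Stop $0) (Stop $0) (Stop ($0--V$6)) ((H$3||$0)><(V$6--$0))
    (Stop (H$1||V$1)) ((H$3||$0)><(V$6--$0)) ((W$3--$0)><H(V$5--$0)) ((H$3||$0)><(V$6--$0))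
    (Stop $0) (Stop $0) (Stop $0) ((H$3||$0)><(V$6--$0)) ((H$3||$0)><(V$6--$0))
    ((H$3||$0)><(V$6--$0))))
   (Stop $0) (Use p2341 [H($0--$3)]) (((V$0||($3--$0))||V(W$4--$0))><H(V$0--(H$4--$0))) (Stop $0)
   ($1--H$0;; W$1--$4;; $1||$0;; $7--H$3;; V$4||H$4;; W$5--$9;; W$6--$8;;
    Cell p2341 p3124 (case_s4 (Stop $0) (Stop (W$8||$0)) ((W$8||$0)><H(V$5--H$5))
    (($10--$0)><H(V$7||H$7)) (Stop ($4||W$8)) ((V$3||$0)><H(W$8--$4)) ((W$12--$0)><H(V$8--$0))
    ((V$8--$0)><H($10--$0)) (Stop $0) (Stop $0) (Stop $0) (Stop $0) (Stop $0)
    ((V$3||$0)><H(H$2--$0)) (Stop $0) (Stop $0) (Stop $0) (Stop $0) (Stop ($0||$1))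
    (Stop ($6--$8)) (Stop $0) (Stop $0) (Stop $0) (Stop $0)))
   (($0--$0)><W($0--V$3)) (((W$0--($3--$0))||W(H$4--$0))><W(V(H$4--$0)||($2--$0)))
   ((H$0--V$0)><V(W$4--$0)) (Use p3142 [V$0--(H$4--$0)]) ((($3--$0)--W$0)><W(H$4--$0))
   (((V$0--(H$4--$0))||($3--$0))><H(V$0||($2--$0))) (Stop $0)
   (W$0--$4;; $0--H$1;; V$2--$3;; $0--H$3;; W$4--$7;; Cell p1432 p3124 (case_s4 (Stop $0)
    (($0||V$4)><H(H$0||V$0)) (Stop $0) (Stop $0) (Stop $0) (Stop $0) ((W$10--$0)><H(V$6--$0))
    ((V$6--$0)><H($8--$0)) (Stop $0) (($0||$4)><H(H$0||V$0)) (($2||$0)><V(V$0||H$0)) (Stop $0)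
    (Stop ($10--H$6)) (Stop $0) (($0||$1)><H(H$0||V$0))
    ($3--H$0;; $0||H$7;; H$8||$0;; H$9||$2;; (W$4--$14)||V$9;; Cell p2341 p2134 (case_s4 (Stop $0)
     (Stop (V$0||H$0)) (Use p1234 [$16, $15, $12, $6, $0]) (Stop $0) (Stop $0)
     (Use p1342 [(H$0--(V$12||$0))||W($10--$7)]) (Use p3412 [V(H$0--$0)]) (Stop $0) (Stop $0)
     ((W$12||$0)><V($0||$15))
     ($5||H$0;; $9--$8;; $5||V$2;; $17--W$7;; $8--$0;; V$6--$8;; W$11--($17--H$12);;
      (H$9||$11)--$1;; Cell p1243 p1432 (case_s4 (Stop $0) (($0--($12||H$9))><(V$8--$0))
      (Use p1342 [W$19, V($19--V$17), V(W$14--$19), H$7, V($0--V(($9||$14)--V$6))]) (Stop $0)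
      (Stop $0) (Use p1324 [V($0--V$8)]) (Stop $0) (Stop ($12--($19||$5))) (Stop $0)
      (Use p3142 [$3||(V$8--$0)]) ((H$0||V$0)><H(W$14--$16)) (Stop $0) (Stop $0)
      (Use p1243 [$19, V($17--$19), H$20, H($16--$15), V(V$8--($0--W$9))]) (Stop ($0||V$10))
      (Stop $0) (Stop $0) (Stop $0) (Stop ($0||$10)) (Stop $0) (Stop $0)
      ((H$0||V$0)><($19--($16--W$13))) (($0--W$6)><(V$8--$0)) (Stop $0)))
     (Stop $0) (Stop $0) (Stop ($0||H$6)) (Stop (V$12||$0)) (Stop $0) (Stop ($5||$12))
     ((W$12||$0)><V($0||V$14)) (Use p3124 [W(H(W$12||$0)--(W$12||$0))]) (Stop $0) (Stop $0)
     (Stop (W$12||$0)) (Use p1234 [V(H($0||$1)--($0||$1))]) (Stop ($12||$5))))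
    (Stop $0) (Stop $0) (Stop (W$6--$8)) (Stop $0) ((V$2||$0)><W(W$10--$0))
    (((V$0||H$0)||V$2)><((H$0||V$0)||H$0)) (Stop $0) (Stop $0)))
   (Stop $0)
   (W$0--$2;; W$1--$4;; Cell p4123 p2314 (case_s4 (Stop $0) (Stop $0) ((W$3--$0)><H(V$5--$0))
    ((H$3||$0)><($4--$0)) (Stop $0) ((H$3||$0)><H(V$7--$0)) (Stop ($0||H$3)) (Stop $0) (Stop $0)
    (Stop (V$3||H$3)) (Stop $0) (Stop $0) (Stop ($0--V$6)) ((H$3||$0)><($4--$0))
    ((V$7--$0)><H(W$3--$0)) ((H$3||$0)><($4--$0)) ((W$3--$0)><H(V$5--$0)) ((V$6--$0)><V(H$1||V$1))
    (Stop $0) (Stop $0) (Stop $0) (Stop $0) ((H$3||$0)><($4--$0)) ((V$7--$0)><H(W$3--$0))))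
   (((W$0--(V$1--$0))||($3--$0))><((H$4--$0)||V($3--$0))) (($2--$0)><(H$0--V$0))))
  (((H(V$1||(V$0--($1--$0)))--V(V$1||(V$0--($1--$0))))||W(V$1--$0))><(H(V$1--$0)||V(V$1--$0)))
  (Stop $0) (Use p2134 [V$0--($1--$0)]) (((H$0--V$0)--(V$1--$0))><H((H$0--V$0)--($1--$0)))
  (((V(V$1||(V$0--($1--$0)))--H(V$1||(V$0--($1--$0))))||H$0)><V(H$0||V$0))
  (((H(V$1||(V$0--($1--$0)))--V(V$1||(V$0--($1--$0))))||W$0)><(H$0||V$0))
  (Use p3214 [V$0--($1--$0)]) (Use p3124 [V(V$0--($1--$0))])
  (((H$0--V$0)--($1--$0))><W(H($1--$0)--V($1--$0))) (Use p3124 [V(W$1||(V$0--($1--$0)))])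
  (((H$0--V$0)--(V$1--$0))><H((H$0--V$0)--($1--$0))))"])
    (simp only: check_eval covered_cases)

lemma covered_16 [covered_cases]: "covered
  [(p2314, p2341, p2341)]"
  by (rule covered_by[of "
  Cell p1324 p2341 (case_s4 (Stop $0) ((V$1--$0)><H($1--$0)) (Use p2134 [(V$0--($1--$0))||$1])
  (Stop $0) (((($1--$0)||(V$0--($1--$0)))--W(V$1--$0))><H((($1--$0)||(V$0--($1--$0)))--W$0))
  (Stop (V$1--$0)) (Use p1234 [V((V$0--($1--$0))||$1)]) (Stop $0) (Use p1234 [V(V$0--($1--$0))])
  ($0--$1;; $1||$0;; $3--$2;; Cell p1324 p4123 (case_s4 (Stop $0) (((H$4--$0)--W$0)><V(H$2||$0))
   (Stop (W$5--$0)) (Stop $0) (((H$1--$0)||(W$5--$0))><H(H$5--$0)) (Stop $0)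
   ((W$5--$0)><H(H$5--$0)) ((H$5--$0)><H(H$4--$0)) ((H$4||$0)><H(H$2--$2)) (Stop $0)
   ((H$2||$0)><H(W$5--$0)) (Stop ($0||H$5)) (((H$4--$0)||(W$5--$0))><H(H$1--$0)) (Stop $0)
   (($5--H$0)||W$0;; W$1--$5;; W$2--$3;; H$3||$5;; Cell p1324 p2134 (case_s4 (Stop $0)
    (Use p2134 [W((H$0--V$0)||H$10)]) (($0||H$9)><W($0||$8))
    ((V$4||$0)><V($0||V($10--(H$5--V$5)))) ((V$4||$0)><($0||V($3||$10))) (Stop ($7||($2--H$5)))
    (Use p1234 [(H$0--$0)||V$10]) (Stop $0) (($0||($10||$3))><(H$7||$0)) (Stop $0)
    (Use p1234 [H((V$0--H$0)||$3)]) ((H$0||V$0)><V(H$9--$1)) (Stop $0) ((H$0||V$0)><W(W$5||$0))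
    (Stop $0) (($0||$2)><W(H$0||V$0)) (Stop $0) ((W$5||$0)><V(H$9||$0)) (Stop $0)
    (($0||H(H$6--$1))><W(H$0||V$0)) ((H$0||V$0)><W(W$5--$8)) (Use p2134 [H((H$0--V$0)||W$10)])
    ((H$0||V$0)><H($6||(W$5--$10))) (Stop $0)))
   ((H(H$4||$0)--V(H$4||$0))><((H$5--$0)||W$5)) (Stop $0) (($3--(H$2||$0))><H(W$0--(H$2||$0)))
   (Use p3142 [H$5||($0--H$4)]) (Stop $0) (((H$4--$0)||H$1)><H((W$5--$0)||W$5)) (Stop ($0||H$1))
   (Stop $0) (Stop (H$0--V$0))))
  (Use p1342 [W$1||(V$0--($1--$0))])
  (((V(H$0||V$0)||(V$0--($1--$0)))--W($0||V$1))><H(V($0||V$1)--H($0||V$1)))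
  (((V((V$0--($1--$0))||V$1)--H((V$0--($1--$0))||V$1))||W$0)><(H$0||V$0))
  (Use p1234 [V((V$0--($1--$0))||W$1)]) (Use p1234 [V((V$0--($1--$0))||$1)]) (Stop $0)
  ((V$0--($1--$0))><H(V$1--$0)) (Use p2341 [V(W$1||(V$0--($1--$0)))])
  (Use p1324 [H((H$0--$0)||W$1)])
  (((H(V$0--($1--$0))--(V(V$1--$0)||(V$0--($1--$0))))||W$1)><V(H($1--$0)--(V(V$1--$0)||(V$0--($1--$0)))))
  ((H(V$1--$0)--(V($1--$0)||(V$0--($1--$0))))><H(H$0--(V($1--$0)||(V$0--($1--$0)))))
  (Stop ($1--$0)) (Use p3142 [V(W$1||(V$0--($1--$0)))]) ((H$0--V$0)><V($1--$0)))"])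
    (simp only: check_eval covered_cases)

lemma covered_17 [covered_cases]: "covered
  [(p2314, p1324, p1324), (p2134, p1324, p1324), (p4321, p1324, p1243)]"
  by (rule covered_by[of "
  $1--$2;; W$3--$0;; V$2--$4;; $1||($3--$4);; $0||H$2;; H$6--$7;; Cell p1432 p1324 (case_s4
  (Stop $0) (Stop $0) (Stop ($0--$8)) (Stop $0) (Stop $0) (Stop $0) (Stop $0) (Stop $0) (Stop $0)
  (Stop $0) (Stop $0) (Stop $0) (((V$0--H$0)||V$1)><(V$4||($8--$0))) (Stop $0)
  ((V(H$9||V$9)--($2||$0))><W((H$3||$0)||V(W$9--$0))) (Stop ($8--$0)) (Stop $0)
  (((W$6--$0)||H$9)><W((V$0--H$0)||V$9)) (((W$9--$0)||W$0)><W(V$0||(V$7--$0))) (Stop $0)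
  (Stop ($8--$0)) (Stop ($0||(V$6||H$6))) (Stop $0) ((W$9--$0)><H(H$8--$0)))"])
    (simp only: check_eval covered_cases)

lemma covered_18 [covered_cases]: "covered
  [(p2314, p1324, p1324)]"
  by (rule covered_by[of "
  Cell p2134 p1324 (case_s4 (Stop $0) (Use p1234 [V(V$0--($1--$0))])
  ($1--$0;; Cell p4321 p1324 (case_s4 (Stop $0) (Use p1234 [$3, $2, $0]) (Use p1342 [$0--$3])
   (Stop ($2--$0)) (Stop ($2--$0)) (Use p1324 [V$3, H$2, $0]) ((H$0--V$0)><W(V$3--$0))
   (Stop (H$0--V$0)) (((H$0||V$0)||(H$2--$0))><H(V$0--($3--$0))) (Stop $0)
   (Use p4132 [V$0--($3--$0)]) (Stop $0) (((H$0||V$0)||($2--$0))><W(V$0--($3--$0)))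
   (Use p4312 [V(V$0--($3--$0))]) ((H$0--V$0)><W($3--$0)) (Stop $0) (Stop (H$0--V$0)) (Stop $0)
   ((V$0||(V$0--($3--$0)))><V((V$0--H$0)||H($3--$0))) (((V$0--H$0)||V(H$2--$0))><W(W$0--($1--$0)))
   (((V$0--H$0)||V($2--$0))><W(W$0--($1--$0))) (Stop $0)
   (($0||(V$0--($3--$0)))><((V$0--H$0)||H(V$3--$0))) (Stop $0)))
  ((V$0--(((W(V$0--($1--$0))||($1||(V$0--($1--$0))))--(V(V$1--$0)||H(V$1--$0)))||(V$0--H$0)))><H((H($1--$0)||V($1--$0))--(H$0||V$0)))
  ((((V$0||H$0)--((W(V$0--($1--$0))||($1||(V$0--($1--$0))))--(V$0||H$0)))||W($1--$0))><(H($1--$0)||V($1--$0)))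
  (Use p1324 [V$0--($1--$0)]) (Use p1234 [V((V$0--H$0)||$1)])
  (((H$0--V$0)--H$0)><((V$1--$0)--W$0)) (Stop $0) (Use p1234 [V(V$0--($1--$0))])
  (Use p1423 [H(V$0--($1--$0))]) (Use p2314 [V(V$0--($1--$0))]) (Stop $0)
  (Use p1243 [W(V$0--($1--$0))]) (Use p1234 [W((V$0--($1--$0))||$1)]) (Use p2134 [V$0--($1--$0)])
  (((H$0--V$0)--($1--$0))><H(H($1--$0)--V($1--$0))) (Use p1324 [V$0--($1--$0)])
  (Use p4123 [W(V$0--($1--$0))]) (Use p3214 [V$0--($1--$0)]) (Use p3124 [V(V$0--($1--$0))])
  (Use p1342 [H(($1--$0)--W$0)]) (Use p3124 [V(V$0--($1--$0))])
  ((V$0--(H$0--V$0))><H(V$0--($1--$0))))"])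
    (simp only: check_eval covered_cases)

lemma covered_19 [covered_cases]: "covered
  []"
  by (rule covered_by[of "
  Fix (case_s4 (Stop $0) (Use p1234 [$0]) (Use p1234 [$0]) (Use p1234 [$0]) (Use p1324 [V$0])
  (Use p1324 [V$0]) (Use p2314 [$0]) (Use p1234 [$0]) (Use p1234 [$0]) (Use p1234 [$0])
  (Use p1423 [W$0]) (Use p2314 [$0]) (Use p1234 [H$0]) (Use p1243 [H$0]) (Use p2134 [V$0])
  (Use p2134 [V$0]) (Use p1324 [V$0]) (Use p1324 [V$0]) (Use p4123 [H$0]) (Use p3214 [V$0])
  (Use p3124 [$0]) (Use p3124 [$0]) (Use p3124 [$0]) (Use p3124 [$0]))"])
    (simp only: check_eval covered_cases)

section \<open>The regular subgroups of the permutations of the symmetric group\<close>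

definition point_index :: "point \<Rightarrow> nat" where
  "point_index = case_point 1 2 3 4"

definition index_point :: "nat \<Rightarrow> point" where
  "index_point i = (if i = 1 then P1 else if i = 2 then P2 else if i = 3 then P3 else P4)"

definition to_perm :: "s4 \<Rightarrow> nat \<Rightarrow> nat" where
  "to_perm x i = (if i \<in> {1..4} then point_index (act x (index_point i)) else i)"

lemma index_point_index [simp]: "index_point (point_index p) = p" and point_index_range: "point_index p \<in> {1..4}"
  by (cases p; simp add: point_index_def index_point_def)+

lemma point_index_index [simp]: "i \<in> {1..4} \<Longrightarrow> point_index (index_point i) = i"
  by (auto simp: point_index_def index_point_def)

lemma act_mul: "act (x \<cdot> y) p = act x (act y p)"
  by (cases x; cases y) (cases p; simp only: s4_eval)+

lemma to_perm_mul: "to_perm (x \<cdot> y) = to_perm x \<circ> to_perm y"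
  using point_index_range by (auto simp: to_perm_def act_mul fun_eq_iff)

lemma to_perm_one: "to_perm p1234 = id"
proof -
  have "act p1234 p = p" for p by (cases p) simp_all
  then show ?thesis by (simp add: fun_eq_iff to_perm_def)
qed

lemma to_perm_permutes: "to_perm x permutes {1..4}"
proof -
  have "to_perm x \<circ> to_perm (s4_inv x) = id" "to_perm (s4_inv x) \<circ> to_perm x = id"
    by (simp_all add: to_perm_one flip: to_perm_mul)
  then have "bij (to_perm x)" by (metis o_bij)
  then have "\<forall>j. \<exists>!i. to_perm x i = j" unfolding bij_iff .
  moreover have "\<forall>i. i \<notin> {1..4} \<longrightarrow> to_perm x i = i" by (simp add: to_perm_def)
  ultimately show ?thesis unfolding permutes_def by blast
qed

lemma inj_to_perm: "inj to_perm"
proof (rule injI)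
  fix x y assume eq: "to_perm x = to_perm y"
  have "act x p = act y p" for p
    using fun_cong[OF eq, of "point_index p"] point_index_range[of p]
    by (auto simp: to_perm_def) (metis index_point_index)
  then show "x = y" by (intro act_inject)
qed

lemma distinct_elems: "distinct elems"
  by (simp add: elems_def)

lemma card_s4: "card (UNIV :: s4 set) = 24"
  using distinct_card[OF distinct_elems] by (simp add: set_elems) (simp add: elems_def)

lemma finite_s4: "finite (UNIV :: s4 set)"
  using card_s4 card.infinite by fastforce

lemma to_perm_iso: "to_perm \<in> iso S4 (sym_group 4)"
proof -
  have "card (range to_perm) = card (carrier (sym_group 4))"
    by (simp add: card_image inj_to_perm card_s4 sym_group_card_carrier fact_numeral)
  moreover have "range to_perm \<subseteq> carrier (sym_group 4)"
    using to_perm_permutes by (auto simp: sym_group_carrier)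
  moreover have "finite (carrier (sym_group 4))"
    by (simp add: sym_group_def finite_permutations)
  ultimately have "range to_perm = carrier (sym_group 4)"
    by (metis card_subset_eq)
  then show ?thesis
    by (auto simp: iso_def hom_def bij_betw_def inj_to_perm to_perm_mul sym_group_mult)
qed

definition of_perm :: "(nat \<Rightarrow> nat) \<Rightarrow> s4" where
  "of_perm = inv_into UNIV to_perm"

lemma of_to_perm [simp]: "of_perm (to_perm x) = x"
  by (simp add: of_perm_def inj_to_perm)

lemma to_of_perm: "p \<in> carrier (sym_group 4) \<Longrightarrow> to_perm (of_perm p) = p"
  using to_perm_iso by (auto simp: of_perm_def iso_def bij_betw_def f_inv_into_f)

lemma of_perm_iso: "of_perm \<in> iso (sym_group 4) S4"
proof -
  have "inv_into (carrier S4) to_perm \<in> iso (sym_group 4) S4"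
    by (rule group.iso_set_sym[OF group_S4 to_perm_iso])
  then show ?thesis by (simp add: of_perm_def)
qed

definition perm_action :: "(s4 \<Rightarrow> s4 \<Rightarrow> s4) \<Rightarrow> (nat \<Rightarrow> nat) \<Rightarrow> (nat \<Rightarrow> nat) \<Rightarrow> nat \<Rightarrow> nat" where
  "perm_action T s x = to_perm (T (of_perm s) (of_perm x))"

definition regular_of :: "(s4 \<Rightarrow> s4 \<Rightarrow> s4) \<Rightarrow> ((nat \<Rightarrow> nat) \<Rightarrow> nat \<Rightarrow> nat) set" where
  "regular_of T = star_translations (sym_group 4) (perm_action T)"

lemma
  assumes "braided S4 T"
  shows braided_perm_action: "braided (sym_group 4) (perm_action T)"
    and star_group_perm_action: "star_group S4 T \<cong> star_group (sym_group 4) (perm_action T)"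
  using braided_transport[OF group_S4 sym_group_is_group to_perm_iso _ assms, of of_perm]
  by (simp_all add: perm_action_def[abs_def])

lemma regular_of_iso:
  assumes "braided S4 T"
  shows "(Perm (sym_group 4))\<lparr>carrier := regular_of T\<rparr> \<cong> star_group S4 T"
proof -
  have "(Perm (sym_group 4))\<lparr>carrier := regular_of T\<rparr> \<cong> star_group (sym_group 4) (perm_action T)"
    unfolding regular_of_def
    by (rule group.star_group_iso[OF sym_group_is_group braided_perm_action[OF assms]])
  also have "\<dots> \<cong> star_group S4 T"
    by (rule group.iso_sym[OF group.group_star_group[OF group_S4 assms] star_group_perm_action[OF assms]])
  finally show ?thesis .
qed

lemma braided_known_actions: "T \<in> known_actions \<Longrightarrow> braided S4 T"
  by (auto simp: orbit_of_def intro: braided_conj_action braided_actions)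

lemma braided_iff_known: "braided S4 T \<longleftrightarrow> T \<in> known_actions"
  using braided_known_actions covered_19 by (auto simp: covered_def)

lemma inj_regular_of: "inj_on regular_of known_actions"
proof (rule inj_onI)
  fix T T' assume T: "T \<in> known_actions" "T' \<in> known_actions" and eq: "regular_of T = regular_of T'"
  have "T s x = T' s x" for s x
  proof -
    have "perm_action T (to_perm s) (to_perm x) = perm_action T' (to_perm s) (to_perm x)"
      by (rule group.star_translations_inj[OF sym_group_is_group
            braided_perm_action[OF braided_known_actions[OF T(1)]] braided_perm_action[OF braided_known_actions[OF T(2)]]
            eq[unfolded regular_of_def]])
        (simp_all only: sym_group_carrier to_perm_permutes)
    then show ?thesis
      using inj_to_perm by (simp add: perm_action_def inj_eq)
  qed
  then show "T = T'" by blast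
qed

lemma normalized_regular_subgroups_sym_4:
  "normalized_regular_subgroups (sym_group 4) = regular_of ` known_actions"
proof
  show "regular_of ` known_actions \<subseteq> normalized_regular_subgroups (sym_group 4)"
    using group.star_translations_normalized_regular[OF sym_group_is_group braided_perm_action]
    by (auto simp: regular_of_def braided_known_actions)
  show "normalized_regular_subgroups (sym_group 4) \<subseteq> regular_of ` known_actions"
  proof
    fix R assume "R \<in> normalized_regular_subgroups (sym_group 4)"
    then obtain t where t: "braided (sym_group 4) t" and R: "R = star_translations (sym_group 4) t"
      using group.normalized_regular_is_star_translations[OF sym_group_is_group] by blast
    define T where "T s x = of_perm (t (to_perm s) (to_perm x))" for s x
    have "braided S4 T"
      using braided_transport(1)[OF sym_group_is_group group_S4 of_perm_iso to_of_perm t]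
      by (simp add: T_def[abs_def])
    moreover have "R = regular_of T"
      unfolding R regular_of_def
    proof (rule group.star_translations_cong[OF sym_group_is_group])
      fix s x assume "s \<in> carrier (sym_group 4)" "x \<in> carrier (sym_group 4)"
      then show "t s x = perm_action T s x"
        using t by (simp add: perm_action_def T_def to_of_perm braided_def)
    qed
    ultimately show "R \<in> regular_of ` known_actions"
      by (simp add: braided_iff_known)
  qed
qed

section \<open>Isomorphism types\<close>

definition star_op :: "(s4 \<Rightarrow> s4 \<Rightarrow> s4) \<Rightarrow> s4 \<Rightarrow> s4 \<Rightarrow> s4" where
  "star_op S x y = x \<cdot> S (s4_inv x) y"

lemma star_group_S4 [simp]:
  "carrier (star_group S4 S) = UNIV" "monoid.mult (star_group S4 S) = star_op S"
  "one (star_group S4 S) = p1234"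
  by (simp_all add: star_group_def star_mult_def star_op_def fun_eq_iff)

lemmas star_eval = star_op_def action_defs on_generators_eval action_rows s4_eval s4.case all_eval
lemmas distinct_eval = elems_def list.map distinct.simps list.set insert_iff empty_iff s4.distinct
  prod.inject simp_thms

lemma inj_by_table: "distinct (map f elems) \<Longrightarrow> inj f"
  by (simp add: distinct_map set_elems)

lemma iso_by_table:
  assumes "\<forall>x y. f (star_op S x y) = star_op S' (f x) (f y)" "distinct (map f elems)"
  shows "star_group S4 S \<cong> star_group S4 S'"
proof (rule is_isoI)
  have "bij f"
    using inj_by_table[OF assms(2)] finite_s4 by (simp add: bij_def finite_UNIV_inj_surj)
  then show "f \<in> iso (star_group S4 S) (star_group S4 S')"
    using assms(1) by (simp add: iso_def hom_def)
qed

lemma iso_of_inj: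
  assumes "h \<in> hom (star_group S4 S) M" "inj h" "card (carrier M) = 24"
  shows "star_group S4 S \<cong> M"
proof (rule is_isoI)
  have "range h = carrier M"
  proof (rule card_subset_eq)
    show "finite (carrier M)" using assms(3) card.infinite by fastforce
    show "range h \<subseteq> carrier M" using assms(1) by (auto simp: hom_def)
    show "card (range h) = card (carrier M)" using assms(2,3) by (simp add: card_image card_s4)
  qed
  then show "h \<in> iso (star_group S4 S) M"
    using assms by (simp add: iso_def bij_betw_def)
qed

text \<open>
  Within each type, the tables are isomorphisms to the group of one chosen action, found by computer search.
\<close>

lemma star_iso_S4:
  assumes "S \<in> set actions_S4"
  shows "star_group S4 S \<cong> star_group S4 action_S4_2"
proof -
  have i1: "star_group S4 action_S4_1 \<cong> star_group S4 action_S4_2"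
    by (rule iso_by_table[where f = "
      case_s4 p1234 p2341 p1243 p3124 p2314 p3142 p4123 p3412 p4132 p1324 p3421 p1342 p2431 p4312
      p2413 p3241 p4321 p3214 p4231 p1423 p4213 p2134 p1432 p2143"])
      (simp_all only: star_eval distinct_eval)
  have i3: "star_group S4 action_S4_3 \<cong> star_group S4 action_S4_2"
    by (rule iso_by_table[where f = "
      case_s4 p1234 p1243 p3214 p4213 p3241 p4231 p2134 p2143 p2314 p2413 p2341 p2431 p3124 p4123
      p1324 p1423 p4321 p3421 p3142 p4132 p1342 p1432 p4312 p3412"])
      (simp_all only: star_eval distinct_eval)
  have i4: "star_group S4 action_S4_4 \<cong> star_group S4 action_S4_2"
    by (rule iso_by_table[where f = "
      case_s4 p1234 p2341 p2413 p1342 p1423 p2134 p4123 p3412 p2314 p3421 p1324 p4213 p3124 p4231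
      p1243 p4132 p2143 p3214 p4312 p3241 p2431 p3142 p1432 p4321"])
      (simp_all only: star_eval distinct_eval)
  show ?thesis
    using assms i1 i3 i4 iso_refl by (auto simp: actions_S4_def)
qed

lemma star_iso_A4C2:
  assumes "S \<in> set actions_A4C2"
  shows "star_group S4 S \<cong> star_group S4 action_A4C2_2"
proof -
  have i1: "star_group S4 action_A4C2_1 \<cong> star_group S4 action_A4C2_2"
    by (rule iso_by_table[where f = "
      case_s4 p1234 p1243 p1324 p1342 p1423 p1432 p2134 p2143 p2314 p2341 p2413 p2431 p4213 p4231
      p4123 p4132 p4321 p4312 p3214 p3241 p3124 p3142 p3421 p3412"])
      (simp_all only: star_eval distinct_eval)
  have i3: "star_group S4 action_A4C2_3 \<cong> star_group S4 action_A4C2_2"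
    by (rule iso_by_table[where f = "
      case_s4 p1234 p1432 p1243 p1342 p1423 p1324 p2341 p2143 p4132 p4231 p3421 p3124 p4213 p4312
      p2413 p2314 p3412 p3214 p3142 p3241 p2431 p2134 p4123 p4321"])
      (simp_all only: star_eval distinct_eval)
  have i4: "star_group S4 action_A4C2_4 \<cong> star_group S4 action_A4C2_2"
    by (rule iso_by_table[where f = "
      case_s4 p1234 p1432 p1243 p1342 p1423 p1324 p2341 p2143 p4132 p4231 p3421 p3124 p2431 p2134
      p3142 p3241 p4321 p4123 p2413 p2314 p4213 p4312 p3214 p3412"])
      (simp_all only: star_eval distinct_eval)
  show ?thesis
    using assms i1 i3 i4 iso_refl by (auto simp: actions_A4C2_def)
qed

lemma star_iso_S3C2C2:
  assumes "S \<in> set actions_S3C2C2"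
  shows "star_group S4 S \<cong> star_group S4 action_S3C2C2_1"
proof -
  have i2: "star_group S4 action_S3C2C2_2 \<cong> star_group S4 action_S3C2C2_1"
    by (rule iso_by_table[where f = "
      case_s4 p1234 p1243 p1324 p1423 p1342 p1432 p2134 p3412 p3124 p2341 p2413 p3241 p2314 p4231
      p4123 p2431 p2143 p4312 p3214 p4213 p4132 p3142 p3421 p4321"])
      (simp_all only: star_eval distinct_eval)
  have i3: "star_group S4 action_S3C2C2_3 \<cong> star_group S4 action_S3C2C2_1"
    by (rule iso_by_table[where f = "
      case_s4 p1234 p1243 p1432 p1423 p1342 p1324 p2134 p3412 p3124 p2413 p2341 p3241 p2314 p4123
      p4231 p2431 p2143 p4312 p3142 p4213 p4132 p3214 p3421 p4321"])
      (simp_all only: star_eval distinct_eval)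
  have i4: "star_group S4 action_S3C2C2_4 \<cong> star_group S4 action_S3C2C2_1"
    by (rule iso_by_table[where f = "
      case_s4 p1234 p1243 p1432 p1342 p1423 p1324 p2134 p2143 p2314 p2413 p2341 p2431 p3124 p3214
      p3142 p3241 p3412 p3421 p4231 p4132 p4213 p4123 p4312 p4321"])
      (simp_all only: star_eval distinct_eval)
  show ?thesis
    using assms i2 i3 i4 iso_refl by (auto simp: actions_S3C2C2_def)
qed

lemma star_iso_C6C2C2:
  assumes "S \<in> set actions_C6C2C2"
  shows "star_group S4 S \<cong> star_group S4 action_C6C2C2_2"
proof -
  have i1: "star_group S4 action_C6C2C2_1 \<cong> star_group S4 action_C6C2C2_2"
    by (rule iso_by_table[where f = "
      case_s4 p1234 p1243 p1324 p1342 p1423 p1432 p2134 p2143 p2314 p2341 p2413 p2431 p3124 p3142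
      p3214 p3241 p3412 p3421 p4321 p4231 p4312 p4132 p4213 p4123"])
      (simp_all only: star_eval distinct_eval)
  have i3: "star_group S4 action_C6C2C2_3 \<cong> star_group S4 action_C6C2C2_2"
    by (rule iso_by_table[where f = "
      case_s4 p1234 p1243 p1432 p1423 p1342 p1324 p2134 p3214 p3421 p2413 p2341 p3142 p2314 p4321
      p4132 p2431 p2143 p4213 p3241 p4312 p4231 p3412 p3124 p4123"])
      (simp_all only: star_eval distinct_eval)
  show ?thesis
    using assms i1 i3 iso_refl by (auto simp: actions_C6C2C2_def)
qed

text \<open>
  Every element of the alternating group is a product of two squares, and squares are even.
\<close>

lemma even_to_perm:
  assumes "x \<in> set [p1234, p1342, p1423, p2143, p2314, p2431, p3124, p3241, p3412, p4132, p4213, p4321]"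
  shows "evenperm (to_perm x)"
proof -
  have even_square: "evenperm (to_perm (y \<cdot> y \<cdot> (z \<cdot> z)))" for y z
  proof -
    have p: "permutation (to_perm y)" for y
      using to_perm_permutes[of y] by (auto simp: permutation_permutes)
    show ?thesis
      by (simp add: to_perm_mul evenperm_comp p permutation_compose)
  qed
  note squares =
    even_square[of p1234 p1234] even_square[of p1234 p1423] even_square[of p1234 p1342]
    even_square[of p1342 p2314] even_square[of p1234 p3124] even_square[of p1234 p4132]
    even_square[of p1234 p2314] even_square[of p1234 p4213] even_square[of p1342 p3241]
    even_square[of p1234 p2431] even_square[of p1234 p3241] even_square[of p1342 p4132]
  show ?thesis
    using assms squares[unfolded s4_eval] by auto
qed

lemma to_perm_fix_4:
  assumes "act x P4 = P4"
  shows "to_perm x \<in> carrier (sym_group 3)"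
proof -
  have "to_perm x 4 = 4"
    using assms by (simp add: to_perm_def index_point_def point_index_def)
  then have "to_perm x i = i" if "i \<in> {1..4} - {1..3}" for i
    using that by (cases "i = 4") auto
  then have "to_perm x permutes {1..3}"
    by (intro permutes_superset[OF to_perm_permutes]) auto
  then show ?thesis by (simp add: sym_group_carrier)
qed

lemma star_S4: "star_group S4 action_S4_2 \<cong> sym_group 4"
proof (rule is_isoI)
  have "star_op action_S4_2 x y = x \<cdot> y" for x y
  proof -
    have "\<forall>x y. star_op action_S4_2 x y = x \<cdot> y"
      by (simp only: star_eval)
    then show ?thesis by blast
  qed
  then show "to_perm \<in> iso (star_group S4 action_S4_2) (sym_group 4)"
    using to_perm_iso by (simp add: iso_def hom_def)
qed

text \<open>
  The tables list the components of an isomorphism to the direct product.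
\<close>

lemma star_A4C2: "star_group S4 action_A4C2_2 \<cong> alt_group 4 \<times>\<times> integer_mod_group 2"
proof -
  define u :: "s4 \<Rightarrow> s4" where "u =
      (case_s4 p1234 p1342 p1423 p1342 p1423 p1234 p2431 p2143 p2314 p2143 p2314 p2431 p3124
      p3241 p3412 p3241 p3412 p3124 p4321 p4132 p4213 p4132 p4213 p4321)"
  define i :: "s4 \<Rightarrow> int" where "i =
      (case_s4 0 1 1 0 0 1 1 0 0 1 1 0 0 1 1 0 0 1 1 0 0 1 1 0)"
  note ui = case_s4_rows[OF u_def] case_s4_rows[OF i_def]
  have hom: "\<forall>x y. u (star_op action_A4C2_2 x y) = u x \<cdot> u y" "\<forall>x y. i (star_op action_A4C2_2 x y) = (i x + i y) mod 2"
    by (simp_all only: star_eval ui) simp_all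
  have range: "\<forall>x. u x \<in> set [p1234, p1342, p1423, p2143, p2314, p2431, p3124, p3241, p3412, p4132, p4213, p4321] \<and> (i x = 0 \<or> i x = 1)"
    by (simp only: all_eval ui list.set insert_iff empty_iff zero_neq_one)
  have "distinct (map (\<lambda>x. (u x, i x)) elems)"
    by (simp only: distinct_eval ui zero_neq_one one_neq_zero)
  then have "inj (\<lambda>x. (to_perm (u x), i x))"
    using inj_by_table inj_to_perm by (fastforce simp: inj_def)
  moreover have "card (carrier (alt_group 4 \<times>\<times> integer_mod_group 2)) = 24"
    using alt_group_card_carrier[of 4] by (simp add: carrier_integer_mod_group card_cartesian_product fact_numeral)
  moreover have "to_perm (u x) \<in> carrier (alt_group 4)" "i x \<in> carrier (integer_mod_group 2)" for x
    using spec[OF range, of x] even_to_perm[of "u x"] to_perm_permutes[of "u x"]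
    by (auto simp: alt_group_carrier carrier_integer_mod_group)
  ultimately show ?thesis
    using hom by (intro iso_of_inj[where h = "\<lambda>x. (to_perm (u x), i x)"])
      (auto simp: hom_def to_perm_mul alt_group_mult)
qed

lemma star_S3C2C2:
  "star_group S4 action_S3C2C2_1 \<cong> sym_group 3 \<times>\<times> integer_mod_group 2 \<times>\<times> integer_mod_group 2"
proof -
  define u :: "s4 \<Rightarrow> s4" where "u =
      (case_s4 p1234 p1324 p2134 p2314 p3124 p3214 p1324 p1234 p3124 p3214 p2134 p2314 p2314
      p2134 p3214 p3124 p1234 p1324 p3214 p3124 p2314 p2134 p1324 p1234)"
  define i :: "s4 \<Rightarrow> int" where "i =
      (case_s4 0 0 0 0 0 0 0 0 0 0 0 0 1 1 1 1 1 1 1 1 1 1 1 1)"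
  define j :: "s4 \<Rightarrow> int" where "j =
      (case_s4 0 0 0 0 0 0 1 1 1 1 1 1 0 0 0 0 0 0 1 1 1 1 1 1)"
  note uij = case_s4_rows[OF u_def] case_s4_rows[OF i_def] case_s4_rows[OF j_def]
  have hom: "\<forall>x y. u (star_op action_S3C2C2_1 x y) = u x \<cdot> u y"
    "\<forall>x y. i (star_op action_S3C2C2_1 x y) = (i x + i y) mod 2"
    "\<forall>x y. j (star_op action_S3C2C2_1 x y) = (j x + j y) mod 2"
    by (simp_all only: star_eval uij) simp_all
  have range: "\<forall>x. act (u x) P4 = P4 \<and> (i x = 0 \<or> i x = 1) \<and> (j x = 0 \<or> j x = 1)"
    by (simp only: all_eval uij act.simps point.case zero_neq_one)
  have "distinct (map (\<lambda>x. (u x, i x, j x)) elems)"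
    by (simp only: distinct_eval uij zero_neq_one one_neq_zero)
  then have "inj (\<lambda>x. (to_perm (u x), i x, j x))"
    using inj_by_table inj_to_perm by (fastforce simp: inj_def)
  moreover have "card (carrier (sym_group 3 \<times>\<times> integer_mod_group 2 \<times>\<times> integer_mod_group 2)) = 24"
    by (simp add: carrier_integer_mod_group card_cartesian_product sym_group_card_carrier fact_numeral)
  moreover have "to_perm (u x) \<in> carrier (sym_group 3)"
    "i x \<in> carrier (integer_mod_group 2)" "j x \<in> carrier (integer_mod_group 2)" for x
    using spec[OF range, of x] to_perm_fix_4[of "u x"] by (auto simp: carrier_integer_mod_group)
  ultimately show ?thesis
    using hom by (intro iso_of_inj[where h = "\<lambda>x. (to_perm (u x), i x, j x)"])
      (auto simp: hom_def to_perm_mul sym_group_mult)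
qed

lemma star_C6C2C2:
  "star_group S4 action_C6C2C2_2 \<cong> integer_mod_group 6 \<times>\<times> integer_mod_group 2 \<times>\<times> integer_mod_group 2"
proof -
  define k :: "s4 \<Rightarrow> int" where "k =
      (case_s4 0 1 5 4 2 3 1 0 2 3 5 4 1 2 0 5 3 4 0 5 1 2 4 3)"
  define i :: "s4 \<Rightarrow> int" where "i =
      (case_s4 0 0 0 0 0 0 0 0 0 0 0 0 1 1 1 1 1 1 1 1 1 1 1 1)"
  define j :: "s4 \<Rightarrow> int" where "j =
      (case_s4 0 0 0 0 0 0 1 1 1 1 1 1 0 0 0 0 0 0 1 1 1 1 1 1)"
  note kij = case_s4_rows[OF k_def] case_s4_rows[OF i_def] case_s4_rows[OF j_def]
  have hom: "\<forall>x y. k (star_op action_C6C2C2_2 x y) = (k x + k y) mod 6"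
    "\<forall>x y. i (star_op action_C6C2C2_2 x y) = (i x + i y) mod 2"
    "\<forall>x y. j (star_op action_C6C2C2_2 x y) = (j x + j y) mod 2"
    by (simp_all only: star_eval kij) simp_all
  have range: "\<forall>x. k x \<in> set [0, 1, 2, 3, 4, 5] \<and> (i x = 0 \<or> i x = 1) \<and> (j x = 0 \<or> j x = 1)"
    by (simp add: all_s4 elems_def kij)
  have "distinct (map (\<lambda>x. (k x, i x, j x)) elems)"
    by (simp add: elems_def kij)
  then have "inj (\<lambda>x. (k x, i x, j x))"
    by (rule inj_by_table)
  moreover have "card (carrier (integer_mod_group 6 \<times>\<times> integer_mod_group 2 \<times>\<times> integer_mod_group 2)) = 24"
    by (simp add: carrier_integer_mod_group card_cartesian_product)
  moreover have "k x \<in> carrier (integer_mod_group 6)"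
    "i x \<in> carrier (integer_mod_group 2)" "j x \<in> carrier (integer_mod_group 2)" for x
    using spec[OF range, of x] by (auto simp: carrier_integer_mod_group)
  ultimately show ?thesis
    using hom by (intro iso_of_inj[where h = "\<lambda>x. (k x, i x, j x)"]) (auto simp: hom_def)
qed

lemma card_filter_elems: "card {x. P x} = length (filter P elems)"
proof -
  have "{x. P x} = set (filter P elems)" by (auto simp: set_elems)
  then show ?thesis
    using distinct_card[of "filter P elems"] distinct_elems by simp
qed

text \<open>
  A form of the recursion in which each tail is evaluated only once.
\<close>

lemma length_filter_eval:
  "length (filter P []) = 0"
  "length (filter P (x # xs)) = of_bool (P x) + length (filter P xs)"
  by simp_all

lemma power_count_star:
  assumes "braided S4 S"
  shows "power_count 2 (star_group S4 S) = length (filter (\<lambda>x. star_op S x x = p1234) elems)"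
    and "power_count 3 (star_group S4 S) = length (filter (\<lambda>x. star_op S (star_op S x x) x = p1234) elems)"
proof -
  interpret group "star_group S4 S" by (rule group.group_star_group[OF group_S4 assms])
  have "x [^]\<^bsub>star_group S4 S\<^esub> (2::nat) = star_op S x x" "x [^]\<^bsub>star_group S4 S\<^esub> (3::nat) = star_op S (star_op S x x) x" for x
    using l_one[of x] by (simp_all add: numeral_2_eq_2 numeral_3_eq_3)
  then show "power_count 2 (star_group S4 S) = length (filter (\<lambda>x. star_op S x x = p1234) elems)"
    "power_count 3 (star_group S4 S) = length (filter (\<lambda>x. star_op S (star_op S x x) x = p1234) elems)"
    by (simp_all add: power_count_def card_filter_elems)
qed

lemma power_count_S4:
  "power_count 2 (sym_group 4) = 10" "power_count 3 (sym_group 4) = 9"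
proof -
  have G: "group (sym_group 4)"
    by (simp add: sym_group_is_group alt_group_is_group DirProd_group)
  have S: "group (star_group S4 action_S4_2)"
    by (rule group.group_star_group[OF group_S4 braided_action_S4_2])
  have "length (filter (\<lambda>x. star_op action_S4_2 x x = p1234) elems) = 10"
    by (simp only: star_eval length_filter_eval of_bool_eq)
  then show "power_count 2 (sym_group 4) = 10"
    using power_count_iso[OF S G star_S4] power_count_star[OF braided_action_S4_2] by simp
  have "length (filter (\<lambda>x. star_op action_S4_2 (star_op action_S4_2 x x) x = p1234) elems) = 9"
    by (simp only: star_eval length_filter_eval of_bool_eq)
  then show "power_count 3 (sym_group 4) = 9"
    using power_count_iso[OF S G star_S4] power_count_star[OF braided_action_S4_2] by simp
qed

lemma power_count_A4C2:
  "power_count 2 (alt_group 4 \<times>\<times> integer_mod_group 2) = 8" "power_count 3 (alt_group 4 \<times>\<times> integer_mod_group 2) = 9"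
proof -
  have G: "group (alt_group 4 \<times>\<times> integer_mod_group 2)"
    by (simp add: sym_group_is_group alt_group_is_group DirProd_group)
  have S: "group (star_group S4 action_A4C2_2)"
    by (rule group.group_star_group[OF group_S4 braided_action_A4C2_2])
  have "length (filter (\<lambda>x. star_op action_A4C2_2 x x = p1234) elems) = 8"
    by (simp only: star_eval length_filter_eval of_bool_eq)
  then show "power_count 2 (alt_group 4 \<times>\<times> integer_mod_group 2) = 8"
    using power_count_iso[OF S G star_A4C2] power_count_star[OF braided_action_A4C2_2] by simp
  have "length (filter (\<lambda>x. star_op action_A4C2_2 (star_op action_A4C2_2 x x) x = p1234) elems) = 9"
    by (simp only: star_eval length_filter_eval of_bool_eq)
  then show "power_count 3 (alt_group 4 \<times>\<times> integer_mod_group 2) = 9"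
    using power_count_iso[OF S G star_A4C2] power_count_star[OF braided_action_A4C2_2] by simp
qed

lemma power_count_S3C2C2:
  "power_count 2 (sym_group 3 \<times>\<times> integer_mod_group 2 \<times>\<times> integer_mod_group 2) = 16" "power_count 3 (sym_group 3 \<times>\<times> integer_mod_group 2 \<times>\<times> integer_mod_group 2) = 3"
proof -
  have G: "group (sym_group 3 \<times>\<times> integer_mod_group 2 \<times>\<times> integer_mod_group 2)"
    by (simp add: sym_group_is_group alt_group_is_group DirProd_group)
  have S: "group (star_group S4 action_S3C2C2_1)"
    by (rule group.group_star_group[OF group_S4 braided_action_S3C2C2_1])
  have "length (filter (\<lambda>x. star_op action_S3C2C2_1 x x = p1234) elems) = 16"
    by (simp only: star_eval length_filter_eval of_bool_eq)
  then show "power_count 2 (sym_group 3 \<times>\<times> integer_mod_group 2 \<times>\<times> integer_mod_group 2) = 16"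
    using power_count_iso[OF S G star_S3C2C2] power_count_star[OF braided_action_S3C2C2_1] by simp
  have "length (filter (\<lambda>x. star_op action_S3C2C2_1 (star_op action_S3C2C2_1 x x) x = p1234) elems) = 3"
    by (simp only: star_eval length_filter_eval of_bool_eq)
  then show "power_count 3 (sym_group 3 \<times>\<times> integer_mod_group 2 \<times>\<times> integer_mod_group 2) = 3"
    using power_count_iso[OF S G star_S3C2C2] power_count_star[OF braided_action_S3C2C2_1] by simp
qed

lemma power_count_C6C2C2:
  "power_count 2 (integer_mod_group 6 \<times>\<times> integer_mod_group 2 \<times>\<times> integer_mod_group 2) = 8" "power_count 3 (integer_mod_group 6 \<times>\<times> integer_mod_group 2 \<times>\<times> integer_mod_group 2) = 3"
proof -
  have G: "group (integer_mod_group 6 \<times>\<times> integer_mod_group 2 \<times>\<times> integer_mod_group 2)"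
    by (simp add: sym_group_is_group alt_group_is_group DirProd_group)
  have S: "group (star_group S4 action_C6C2C2_2)"
    by (rule group.group_star_group[OF group_S4 braided_action_C6C2C2_2])
  have "length (filter (\<lambda>x. star_op action_C6C2C2_2 x x = p1234) elems) = 8"
    by (simp only: star_eval length_filter_eval of_bool_eq)
  then show "power_count 2 (integer_mod_group 6 \<times>\<times> integer_mod_group 2 \<times>\<times> integer_mod_group 2) = 8"
    using power_count_iso[OF S G star_C6C2C2] power_count_star[OF braided_action_C6C2C2_2] by simp
  have "length (filter (\<lambda>x. star_op action_C6C2C2_2 (star_op action_C6C2C2_2 x x) x = p1234) elems) = 3"
    by (simp only: star_eval length_filter_eval of_bool_eq)
  then show "power_count 3 (integer_mod_group 6 \<times>\<times> integer_mod_group 2 \<times>\<times> integer_mod_group 2) = 3"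
    using power_count_iso[OF S G star_C6C2C2] power_count_star[OF braided_action_C6C2C2_2] by simp
qed

section \<open>Counting\<close>

text \<open>
  Cardinality of the set of entries, in a form in which each tail is evaluated only once.
\<close>

primrec num_distinct :: "'a list \<Rightarrow> nat" where
  "num_distinct [] = 0"
| "num_distinct (x # xs) = (if x \<in> set xs then 0 else 1) + num_distinct xs"

lemma card_set_num_distinct: "card (set xs) = num_distinct xs"
  by (induction xs) (auto simp: insert_absorb)

text \<open>
  A braided action is determined by its values at the two generators, which can be compared by evaluation.
\<close>

definition signature :: "(s4 \<Rightarrow> s4 \<Rightarrow> s4) \<Rightarrow> s4 list" where
  "signature T = map (T p2134) elems @ map (T p2341) elems"

lemma inj_signature: "inj_on signature known_actions"
proof (rule inj_onI)
  fix T T' assume T: "T \<in> known_actions" "T' \<in> known_actions" and "signature T = signature T'"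
  then have "T p2134 x = T' p2134 x \<and> T p2341 x = T' p2341 x" for x
    using set_elems by (auto simp: signature_def)
  then have rq: "T p2134 = T' p2134" "T p2341 = T' p2341" by auto
  show "T = T'"
  proof
    fix s
    show "T s = T' s"
      unfolding braided_on_generators[OF braided_known_actions[OF T(1)], of s] rq
      by (rule braided_on_generators[OF braided_known_actions[OF T(2)], symmetric])
  qed
qed

lemma card_orbit_of:
  assumes "set Ss \<subseteq> set actions"
  shows "card (orbit_of Ss) =
    num_distinct (concat (map (\<lambda>S. map (\<lambda>g. signature (conj_action g S)) elems) Ss))"
proof -
  have "orbit_of Ss \<subseteq> known_actions"
    using assms by (auto simp: orbit_of_def)
  then have "card (orbit_of Ss) = card (signature ` orbit_of Ss)"
    by (metis card_image inj_on_subset inj_signature)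
  also have "signature ` orbit_of Ss = set (concat (map (\<lambda>S. map (\<lambda>g. signature (conj_action g S)) elems) Ss))"
    by (force simp: orbit_of_def set_elems)
  finally show ?thesis unfolding card_set_num_distinct .
qed

lemmas orbit_eval = num_distinct.simps concat.simps list.map append.simps signature_def conj_action_def
  s4_conj_def action_defs on_generators_eval action_rows s4_eval elems_def list.set insert_iff empty_iff list.inject
  s4.distinct simp_thms if_True if_False

lemma card_orbit_S4: "card (orbit_of actions_S4) = 8"
proof -
  have "set actions_S4 \<subseteq> set actions" by (auto simp: actions_def)
  then show ?thesis
    by (subst card_orbit_of, assumption)
      (simp only: actions_S4_def orbit_eval cong: conj_left_cong disj_left_cong)
qed

lemma card_orbit_A4C2: "card (orbit_of actions_A4C2) = 36"
proof -
  have "set actions_A4C2 \<subseteq> set actions" by (auto simp: actions_def)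
  then show ?thesis
    by (subst card_orbit_of, assumption)
      (simp only: actions_A4C2_def orbit_eval cong: conj_left_cong disj_left_cong)
qed

lemma card_orbit_S3C2C2: "card (orbit_of actions_S3C2C2) = 24"
proof -
  have "set actions_S3C2C2 \<subseteq> set actions" by (auto simp: actions_def)
  then show ?thesis
    by (subst card_orbit_of, assumption)
      (simp only: actions_S3C2C2_def orbit_eval cong: conj_left_cong disj_left_cong)
qed

lemma card_orbit_C6C2C2: "card (orbit_of actions_C6C2C2) = 48"
proof -
  have "set actions_C6C2C2 \<subseteq> set actions" by (auto simp: actions_def)
  then show ?thesis
    by (subst card_orbit_of, assumption)
      (simp only: actions_C6C2C2_def orbit_eval cong: conj_left_cong disj_left_cong)
qed

lemma known_actions_eq:
  "known_actions =
    orbit_of actions_S4 \<union> orbit_of actions_A4C2 \<union> orbit_of actions_S3C2C2 \<union> orbit_of actions_C6C2C2"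
  by (auto simp: orbit_of_def actions_def)

abbreviation group_on :: "((nat \<Rightarrow> nat) \<Rightarrow> nat \<Rightarrow> nat) set \<Rightarrow> ((nat \<Rightarrow> nat) \<Rightarrow> nat \<Rightarrow> nat) monoid" where
  "group_on R \<equiv> (Perm (sym_group 4))\<lparr>carrier := R\<rparr>"

lemma orbit_type:
  assumes star: "\<And>S. S \<in> set Ss \<Longrightarrow> star_group S4 S \<cong> M" and sub: "set Ss \<subseteq> set actions"
    and M: "group M" and R: "R \<in> regular_of ` orbit_of Ss"
  shows "group (group_on R)" and "group_on R \<cong> M" and "power_count k (group_on R) = power_count k M"
proof -
  obtain g S where S: "S \<in> set Ss" and R_eq: "R = regular_of (conj_action g S)"
    using R by (auto simp: orbit_of_def)
  have br: "braided S4 S" using S sub braided_actions by blast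
  have "conj_action g S \<in> known_actions" using S sub by (auto simp: orbit_of_def)
  then have "R \<in> normalized_regular_subgroups (sym_group 4)"
    unfolding normalized_regular_subgroups_sym_4 R_eq by (rule imageI)
  then have "subgroup R (Perm (sym_group 4))"
    by (simp add: normalized_regular_subgroups_def regular_subgroup_def)
  then show grp: "group (group_on R)"
    by (rule subgroup.subgroup_is_group[OF _ group_BijGroup])
  have "group_on R \<cong> star_group S4 (conj_action g S)"
    unfolding R_eq by (rule regular_of_iso[OF braided_conj_action[OF br]])
  also have "\<dots> \<cong> star_group S4 S"
    by (rule group.iso_sym[OF group.group_star_group[OF group_S4 br] star_group_conj_action[OF br]])
  also have "\<dots> \<cong> M" by (rule star[OF S])
  finally show iso: "group_on R \<cong> M" .
  show "power_count k (group_on R) = power_count k M"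
    by (rule power_count_iso[OF grp M iso])
qed

text \<open>
  Conjugate actions give isomorphic regular subgroups, so all members of such a union of conjugacy classes have type
  \<open>M\<close>.
\<close>

lemma orbit_of_type:
  assumes star: "\<And>S. S \<in> set Ss \<Longrightarrow> star_group S4 S \<cong> M" and sub: "set Ss \<subseteq> set actions" and M: "group M"
  shows "{R \<in> regular_of ` orbit_of Ss. group_on R \<cong> N} =
    (if M \<cong> N then regular_of ` orbit_of Ss else {})"
proof -
  have "group_on R \<cong> N \<longleftrightarrow> M \<cong> N" if "R \<in> regular_of ` orbit_of Ss" for R
    using orbit_type(1,2)[OF assms that] iso_trans group.iso_sym by metis
  then show ?thesis by auto
qed

lemma card_regular_of_orbit:
  assumes "set Ss \<subseteq> set actions"
  shows "card (regular_of ` orbit_of Ss) = card (orbit_of Ss)"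
proof (rule card_image)
  show "inj_on regular_of (orbit_of Ss)"
    by (rule inj_on_subset[OF inj_regular_of]) (use assms in \<open>auto simp: orbit_of_def\<close>)
qed

theorem theorem1p1:
  shows "(\<forall>N :: ('a, 'm) monoid_scheme. group N \<and> order N = fact 4 \<longrightarrow>
      card (normalized_regular_subgroups_of_type (sym_group 4) N) =
        (if N \<cong> sym_group 4 then 8
         else if N \<cong> alt_group 4 \<times>\<times> integer_mod_group 2 then 36
         else if N \<cong> sym_group 3 \<times>\<times> integer_mod_group 2 \<times>\<times> integer_mod_group 2 then 24
         else if N \<cong> integer_mod_group 6 \<times>\<times> integer_mod_group 2 \<times>\<times> integer_mod_group 2 then 48
         else 0))
    \<and> card (normalized_regular_subgroups (sym_group 4)) = 116"
proof -
  define E1 E2 E3 E4 where E_defs: "E1 = regular_of ` orbit_of actions_S4"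
    "E2 = regular_of ` orbit_of actions_A4C2" "E3 = regular_of ` orbit_of actions_S3C2C2"
    "E4 = regular_of ` orbit_of actions_C6C2C2"
  let ?M1 = "sym_group 4" and ?M2 = "alt_group 4 \<times>\<times> integer_mod_group 2"
  let ?M3 = "sym_group 3 \<times>\<times> integer_mod_group 2 \<times>\<times> integer_mod_group 2"
  let ?M4 = "integer_mod_group 6 \<times>\<times> integer_mod_group 2 \<times>\<times> integer_mod_group 2"
  have grp: "group ?M1" "group ?M2" "group ?M3" "group ?M4"
    by (simp_all add: sym_group_is_group alt_group_is_group DirProd_group)
  have sub: "set actions_S4 \<subseteq> set actions" "set actions_A4C2 \<subseteq> set actions"
    "set actions_S3C2C2 \<subseteq> set actions" "set actions_C6C2C2 \<subseteq> set actions"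
    by (auto simp: actions_def)
  have type1: "star_group S4 S \<cong> ?M1" if "S \<in> set actions_S4" for S
    by (rule iso_trans[OF star_iso_S4[OF that] star_S4])
  have type2: "star_group S4 S \<cong> ?M2" if "S \<in> set actions_A4C2" for S
    by (rule iso_trans[OF star_iso_A4C2[OF that] star_A4C2])
  have type3: "star_group S4 S \<cong> ?M3" if "S \<in> set actions_S3C2C2" for S
    by (rule iso_trans[OF star_iso_S3C2C2[OF that] star_S3C2C2])
  have type4: "star_group S4 S \<cong> ?M4" if "S \<in> set actions_C6C2C2" for S
    by (rule iso_trans[OF star_iso_C6C2C2[OF that] star_C6C2C2])
  have E: "normalized_regular_subgroups (sym_group 4) = E1 \<union> E2 \<union> E3 \<union> E4"
    unfolding normalized_regular_subgroups_sym_4 known_actions_eq E_defs by (simp only: image_Un)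
  have card: "card E1 = 8" "card E2 = 36" "card E3 = 24" "card E4 = 48"
    unfolding E_defs card_regular_of_orbit[OF sub(1)] card_regular_of_orbit[OF sub(2)]
      card_regular_of_orbit[OF sub(3)] card_regular_of_orbit[OF sub(4)]
    by (rule card_orbit_S4 card_orbit_A4C2 card_orbit_S3C2C2 card_orbit_C6C2C2)+
  then have fin: "finite E1" "finite E2" "finite E3" "finite E4"
    by (auto intro: card_ge_0_finite)
  have inv: "R \<in> E1 \<Longrightarrow> power_count 2 (group_on R) = 10 \<and> power_count 3 (group_on R) = 9"
    "R \<in> E2 \<Longrightarrow> power_count 2 (group_on R) = 8 \<and> power_count 3 (group_on R) = 9"
    "R \<in> E3 \<Longrightarrow> power_count 2 (group_on R) = 16 \<and> power_count 3 (group_on R) = 3"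
    "R \<in> E4 \<Longrightarrow> power_count 2 (group_on R) = 8 \<and> power_count 3 (group_on R) = 3" for R
    unfolding E_defs
    using orbit_type(3)[OF type1 sub(1) grp(1)] orbit_type(3)[OF type2 sub(2) grp(2)]
      orbit_type(3)[OF type3 sub(3) grp(3)] orbit_type(3)[OF type4 sub(4) grp(4)]
    by (simp_all only: power_count_S4 power_count_A4C2 power_count_S3C2C2 power_count_C6C2C2 simp_thms)
  have "E1 \<inter> E2 = {}" "(E1 \<union> E2) \<inter> E3 = {}" "(E1 \<union> E2 \<union> E3) \<inter> E4 = {}"
    using inv by fastforce+
  then have total: "card (normalized_regular_subgroups (sym_group 4)) = 116"
    unfolding E using fin card by (simp add: card_Un_disjoint)
  have "card (normalized_regular_subgroups_of_type (sym_group 4) N) =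
        (if N \<cong> ?M1 then 8 else if N \<cong> ?M2 then 36 else if N \<cong> ?M3 then 24
         else if N \<cong> ?M4 then 48 else 0)"
    if N: "group N" for N :: "('a, 'm) monoid_scheme"
  proof -
    have sym: "?M1 \<cong> N \<longleftrightarrow> N \<cong> ?M1" "?M2 \<cong> N \<longleftrightarrow> N \<cong> ?M2"
      "?M3 \<cong> N \<longleftrightarrow> N \<cong> ?M3" "?M4 \<cong> N \<longleftrightarrow> N \<cong> ?M4"
      using group.iso_sym[OF N] grp[THEN group.iso_sym] by blast+
    have counts: "N \<cong> ?M1 \<Longrightarrow> power_count 2 N = 10 \<and> power_count 3 N = 9"
      "N \<cong> ?M2 \<Longrightarrow> power_count 2 N = 8 \<and> power_count 3 N = 9"
      "N \<cong> ?M3 \<Longrightarrow> power_count 2 N = 16 \<and> power_count 3 N = 3"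
      "N \<cong> ?M4 \<Longrightarrow> power_count 2 N = 8 \<and> power_count 3 N = 3"
      using power_count_iso[OF N grp(1)] power_count_iso[OF N grp(2)]
        power_count_iso[OF N grp(3)] power_count_iso[OF N grp(4)]
      by (simp_all only: power_count_S4 power_count_A4C2 power_count_S3C2C2 power_count_C6C2C2 simp_thms)
    have types: "{R \<in> E1. group_on R \<cong> N} = (if N \<cong> ?M1 then E1 else {})"
      "{R \<in> E2. group_on R \<cong> N} = (if N \<cong> ?M2 then E2 else {})"
      "{R \<in> E3. group_on R \<cong> N} = (if N \<cong> ?M3 then E3 else {})"
      "{R \<in> E4. group_on R \<cong> N} = (if N \<cong> ?M4 then E4 else {})"
      unfolding E_defs sym [symmetric]
      subgoal by (rule orbit_of_type[OF type1 sub(1) grp(1)])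
      subgoal by (rule orbit_of_type[OF type2 sub(2) grp(2)])
      subgoal by (rule orbit_of_type[OF type3 sub(3) grp(3)])
      subgoal by (rule orbit_of_type[OF type4 sub(4) grp(4)])
      done
    have "normalized_regular_subgroups_of_type (sym_group 4) N =
      {R \<in> E1. group_on R \<cong> N} \<union> {R \<in> E2. group_on R \<cong> N} \<union>
      {R \<in> E3. group_on R \<cong> N} \<union> {R \<in> E4. group_on R \<cong> N}"
      unfolding normalized_regular_subgroups_of_type_def E by blast
    also have "\<dots> = (if N \<cong> ?M1 then E1 else {}) \<union> (if N \<cong> ?M2 then E2 else {}) \<union>
      (if N \<cong> ?M3 then E3 else {}) \<union> (if N \<cong> ?M4 then E4 else {})"
      by (simp only: types)
    finally show ?thesis
      using counts card by auto
  qed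
  with total show ?thesis by blast
qed

end
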